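(* Let $C$ be a branch with $\Gamma(C)=\langle v_0,\ldots,v_g\rangle$ and let $1\le k\le g$. Then $$d_k(C)=\frac{e_{k-1}v_k}{(v_0)^2},\qquad\text{where } e_{k-1}=\gcd(v_0,\ldots,v_{k-1}).$$
   Context: $K$ is an algebraically closed field of arbitrary characteristic. A branch $C:\{f=0\}$ is the ideal of $K[[x,y]]$ generated by an irreducible power series $f$; its multiplicity is $m(C)=\mathrm{ord}\, f$. For branches $C:\{f=0\}$, $D:\{g=0\}$ put $(C,D)_0=\dim_K K[[x,y]]/(f,g)$ (possibly $+\infty$) and $d(C,D)=\frac{(C,D)_0}{m(C)m(D)}$. The semigroup of a branch $C:\{f=0\}$ is $\Gamma(C)=\{\dim_K K[[x,y]]/(f,g): g\in K[[x,y]],\ g\not\equiv 0\pmod f\}$. The notation $\Gamma(C)=\langle v_0,\dots,v_g\rangle$ means that $v_0<v_1<\cdots<v_g$ is the minimal system of generators: $v_0=\min(\Gamma(C)\setminus\{0\})=m(C)$, $v_k=\min(\Gamma(C)\setminus(\mathbb{N}v_0+\cdots+\mathbb{N}v_{k-1}))$ for $1\le k\le g$, and $\Gamma(C)=\mathbb{N}v_0+\cdots+\mathbb{N}v_g$. With $e_k=\gcd(v_0,\dots,v_k)$, the Zariski pairs of $C$ are $(v_k/e_k,\ e_{k-1}/e_k)$, $1\le k\le g$; thus $C$ has exactly $g$ Zariski pairs (none if $C$ is smooth, i.e. of multiplicity $1$). For a positive integer $k$, $\mathcal{B}_k$ is the family of branches having at most $k-1$ Zariski pairs, and $d_k(C):=\sup\{d(C,W):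 W\in\mathcal{B}_k\}$. *)

theory Defs
  imports
    "HOL-Library.Extended_Real"
    "HOL-Computational_Algebra.Computational_Algebra"
begin

text \<open>
  The ring \<open>K[[x,y]]\<close> is represented as \<open>K[[x]][[y]]\<close>, i.e. by the type \<open>'a fps fps\<close>; the
  coefficient of \<open>x^i y^j\<close> in \<open>f\<close> is \<open>fps_nth (fps_nth f j) i\<close>.

  A branch (the ideal generated by an irreducible power series) is represented by such a generator
  \<open>f\<close>, its equation.  Generators of the same ideal differ by a unit factor, and none of the notions
  below (multiplicity, intersection number, semigroup, ...) is affected by such a factor.
\<close>

type_synonym 'a fps2 = "'a fps fps"

definition branch :: "'a::field fps2 \<Rightarrow> bool" where
  "branch f \<longleftrightarrow> irreducible f"

text \<open>The order is the least total degree of a monomial of \<open>f\<close>; it is only meaningful for \<open>f \<noteq> 0\<close>.\<close>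

definition fps2_order :: "'a::zero fps2 \<Rightarrow> nat" where
  "fps2_order f = (LEAST n. \<exists>i j. i + j = n \<and> fps_nth (fps_nth f j) i \<noteq> 0)"

definition ideal2 :: "'a::field fps2 \<Rightarrow> 'a fps2 \<Rightarrow> 'a fps2 set" where
  "ideal2 f g = {a * f + b * g |a b. True}"

text \<open>
  \<open>quotient_basis I B\<close>: the residue classes of the elements of the finite set \<open>B\<close> are pairwise
  distinct and form a basis of the \<open>K\<close>-vector space \<open>K[[x,y]]/I\<close>, i.e. every element is congruent
  modulo \<open>I\<close> to exactly one \<open>K\<close>-linear combination of \<open>B\<close>.
\<close>

definition quotient_basis :: "'a::field fps2 set \<Rightarrow> 'a fps2 set \<Rightarrow> bool" where
  "quotient_basis I B \<longleftrightarrow> finite B \<and>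
     (\<forall>h. \<exists>!c. (\<forall>b. b \<notin> B \<longrightarrow> c b = 0) \<and> h - (\<Sum>b\<in>B. fps_const (fps_const (c b)) * b) \<in> I)"

text \<open>
  The dimension of \<open>K[[x,y]]/I\<close> over \<open>K\<close>.  All finite bases have the same cardinality, and
  the infimum is \<open>\<infinity>\<close> if there is no finite basis.
\<close>

definition quotient_dim :: "'a::field fps2 set \<Rightarrow> enat" where
  "quotient_dim I = (INF B\<in>{B. quotient_basis I B}. enat (card B))"

definition intersection_number :: "'a::field fps2 \<Rightarrow> 'a fps2 \<Rightarrow> enat" where
  "intersection_number f g = quotient_dim (ideal2 f g)"

definition contact :: "'a::field fps2 \<Rightarrow> 'a fps2 \<Rightarrow> ereal" where
  "contact f g = ereal_of_enat (intersection_number f g) /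
                 ereal (real (fps2_order f) * real (fps2_order g))"

definition branch_semigroup :: "'a::field fps2 \<Rightarrow> nat set" where
  "branch_semigroup f = {n. \<exists>g. \<not> f dvd g \<and> intersection_number f g = enat n}"

definition nat_span :: "(nat \<Rightarrow> nat) \<Rightarrow> nat \<Rightarrow> nat set" where
  "nat_span v k = {\<Sum>i<k. c i * v i |c :: nat \<Rightarrow> nat. True}"

text \<open>
  \<open>\<Gamma> = \<langle>v 0, \<dots>, v g\<rangle>\<close>.  As \<open>nat_span v 0 = {0}\<close>, the case \<open>k = 0\<close> of the minimality condition
  says that \<open>v 0\<close> is the least nonzero element of \<open>\<Gamma>\<close>.  Values of \<open>v\<close> beyond \<open>g\<close> are irrelevant.
\<close>

definition minimal_generators :: "nat set \<Rightarrow> nat \<Rightarrow> (nat \<Rightarrow> nat) \<Rightarrow> bool" where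
  "minimal_generators \<Gamma> g v \<longleftrightarrow>
     strict_mono_on {0..g} v \<and>
     (\<forall>k\<le>g. v k \<in> \<Gamma> - nat_span v k \<and> (\<forall>n \<in> \<Gamma> - nat_span v k. v k \<le> n)) \<and>
     \<Gamma> = nat_span v (Suc g)"

definition gens_gcd :: "(nat \<Rightarrow> nat) \<Rightarrow> nat \<Rightarrow> nat" where
  "gens_gcd v k = Gcd (v ` {0..k})"

definition zariski_pairs :: "nat \<Rightarrow> (nat \<Rightarrow> nat) \<Rightarrow> (nat \<times> nat) list" where
  "zariski_pairs g v =
     map (\<lambda>k. (v k div gens_gcd v k, gens_gcd v (k - 1) div gens_gcd v k)) [1..<Suc g]"

definition branch_family :: "nat \<Rightarrow> 'a::field fps2 set" where
  "branch_family k = {w. branch w \<and>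
     (\<exists>g v. minimal_generators (branch_semigroup w) g v \<and> length (zariski_pairs g v) \<le> k - 1)}"

definition contact_sup :: "nat \<Rightarrow> 'a::field fps2 \<Rightarrow> ereal" where
  "contact_sup k f = (SUP w\<in>branch_family k. contact f w)"

end

(*
  Everything is read off from arcs, i.e. local homomorphisms K[[x,y]] -> K[[t]].  Blowing up
  repeatedly, and either dropping the multiplicity or accumulating a smooth arc, shows that every
  branch g carries an arc killing g.  The order along such an arc is a valuation v on K[[x,y]]/(g)
  with residue field K, and counting the gaps v(f) + S in its value semigroup S shows that v is
  proportional to the intersection number (g, -).

  Choose coordinates with m = (g, x) equal to the multiplicity.  For j < m let a_j be the largest
  value of a series whose restriction to x = 0 has order j.  The a_j are strictly increasing, lie in
  different classes modulo m, satisfy a_i + a_j <= a_(i+j), and S is the union of the a_j + m N.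
  These properties alone force v_k = a_b for b = v_0 / e_(k-1), and make a_j / j < v_k / b for
  0 < j < b.

  After a base change x = a(t) all branches involved split into linear factors y - alpha(t), which
  gives the ultrametric inequality for (f, g) / ((f, x) (g, x)).  A series w attaining a_b is a
  branch for which v_w and v_f are proportional below y-order b.  Hence its semigroup is generated
  by v_0 / e, ..., v_(k-1) / e with e = e_(k-1), and it attains the supremum.  If a branch w had
  larger contact, v_w and v_f would be proportional up to y-order b, and w would have at least k
  Zariski pairs.
*)
theory Submission
  imports Defs
begin

text \<open>Since the characteristic is arbitrary, the roots of f in y need not be fractional power
  series in x. An arc likewise need not be a primitive parametrization: it has to kill g and have a
  nonzero x-component, and the factor by which it traces the branch too often cancels, because all
  comparisons are cross-multiplied identities between natural numbers or infinity. The index b = v_0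
  / e_(k-1) arises from counting: modulo v_0 there are exactly b classes divisible by e_(k-1), so
  the span of v_0, ..., v_(k-1) uses up the a_j with j < b, and the next new value is a_b. Contact
  is defined by multiplicities, whereas the arguments run on y-orders. The two agree when x = 0 is
  transversal; a shear depending on the pair of branches achieves this for both at once, and it
  changes neither intersection numbers nor semigroups. The series w that attains the supremum is not
  shown to be transversal; an inequality for its multiplicity is enough.\<close>

unbundle fps_syntax

section \<open>Local homomorphisms\<close>

abbreviation K2 :: "'a::comm_ring_1 \<Rightarrow> 'a fps2" where
  "K2 c \<equiv> fps_const (fps_const c)"

abbreviation xx :: "'a::comm_ring_1 fps2" where
  "xx \<equiv> fps_const fps_X"

abbreviation yy :: "'a::comm_ring_1 fps2" where
  "yy \<equiv> fps_X"

text \<open>Membership in the k-th power of the maximal ideal. Unlike \<open>fps2_order\<close> it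
  is meaningful for 0 and can therefore express congruence of series.\<close>

definition vanish :: "nat \<Rightarrow> 'a::zero fps2 \<Rightarrow> bool" where
  "vanish k f \<longleftrightarrow> (\<forall>i j. i + j < k \<longrightarrow> f $ j $ i = 0)"

lemma vanish_0 [simp]: "vanish 0 f"
  by (simp add: vanish_def)

lemma vanish_zero [simp]: "vanish k 0"
  by (simp add: vanish_def)

lemma vanish_1_iff: "vanish (Suc 0) f \<longleftrightarrow> f $ 0 $ 0 = 0"
  by (simp add: vanish_def)

lemma vanish_mono: "vanish k f \<Longrightarrow> l \<le> k \<Longrightarrow> vanish l f"
  by (simp add: vanish_def)

lemma vanish_add: "vanish k f \<Longrightarrow> vanish k g \<Longrightarrow> vanish k (f + g)"
  for f :: "'a::comm_ring_1 fps2"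
  by (simp add: vanish_def)

lemma vanish_diff: "vanish k f \<Longrightarrow> vanish k g \<Longrightarrow> vanish k (f - g)"
  for f :: "'a::comm_ring_1 fps2"
  by (simp add: vanish_def)

lemma vanish_sum: "(\<And>q. q \<in> I \<Longrightarrow> vanish k (u q)) \<Longrightarrow> vanish k (\<Sum>q\<in>I. u q)"
  for u :: "'i \<Rightarrow> 'a::comm_ring_1 fps2"
  by (induction I rule: infinite_finite_induct) (auto intro: vanish_add)

lemma fps2_mult_nth:
  "(f * g) $ j $ i = (\<Sum>q\<le>j. \<Sum>p\<le>i. f $ q $ p * g $ (j - q) $ (i - p))"
  for f g :: "'a::comm_ring_1 fps2"
  by (simp add: fps_mult_nth fps_sum_nth atLeast0AtMost)

lemma vanish_mult:
  fixes f g :: "'a::comm_ring_1 fps2"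
  assumes "vanish k f" "vanish l g"
  shows "vanish (k + l) (f * g)"
  unfolding vanish_def
proof (intro allI impI)
  fix i j assume ij: "i + j < k + l"
  have "f $ q $ p * g $ (j - q) $ (i - p) = 0" if "q \<le> j" "p \<le> i" for q p
  proof (cases "p + q < k")
    case True
    then show ?thesis using assms(1) by (simp add: vanish_def)
  next
    case False
    then have "(i - p) + (j - q) < l" using that ij by linarith
    then show ?thesis using assms(2) by (simp add: vanish_def)
  qed
  then show "(f * g) $ j $ i = 0"
    unfolding fps2_mult_nth by (intro sum.neutral ballI) auto
qed

lemma vanish_mult_right: "vanish l g \<Longrightarrow> vanish l (f * g)"
  for f g :: "'a::comm_ring_1 fps2"
  using vanish_mult[of 0 f l g] by simp

lemma vanish_power: "vanish (Suc 0) f \<Longrightarrow> vanish k (f ^ k)"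
  for f :: "'a::comm_ring_1 fps2"
  by (induction k) (use vanish_mult[of "Suc 0" f] in auto)

lemma vanish_all_imp_0: "(\<And>k. vanish k f) \<Longrightarrow> f = 0"
  unfolding vanish_def by (intro fps_ext) (metis fps_zero_nth lessI)

lemma vanish_all_imp_eq: "(\<And>k. vanish k (f - g)) \<Longrightarrow> f = g"
  for f g :: "'a::comm_ring_1 fps2"
  using vanish_all_imp_0[of "f - g"] by simp

section \<open>Convergent sums and substitution into power series\<close>

definition fsum :: "(nat \<Rightarrow> 'a::comm_ring_1 fps2) \<Rightarrow> 'a fps2" where
  "fsum u = Abs_fps (\<lambda>j. Abs_fps (\<lambda>i. \<Sum>q\<le>i + j. u q $ j $ i))"

text \<open>Terms of index above i + j contribute nothing to x^i y^j, so the truncated sums in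
  \<open>fsum\<close> are the coefficients of the limit.\<close>

lemma fsum_approx:
  assumes "\<And>q. vanish q (u q)"
  shows "vanish k (fsum u - (\<Sum>q<k. u q))"
  unfolding vanish_def
proof (intro allI impI)
  fix i j assume ij: "i + j < k"
  have "(\<Sum>q<k. u q $ j $ i) = (\<Sum>q\<le>i + j. u q $ j $ i)"
    by (rule sum.mono_neutral_right) (use assms ij in \<open>auto simp: vanish_def not_le\<close>)
  then show "(fsum u - (\<Sum>q<k. u q)) $ j $ i = 0"
    by (simp add: fsum_def fps_sum_nth)
qed

lemma fsum_unique:
  assumes "\<And>q. vanish q (u q)" "\<And>k. vanish k (f - (\<Sum>q<k. u q))"
  shows "f = fsum u"
proof (rule vanish_all_imp_eq)
  fix k
  show "vanish k (f - fsum u)"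
    using vanish_diff[OF assms(2)[of k] fsum_approx[of u k, OF assms(1)]] by simp
qed

lemma fsum_mult:
  assumes "\<And>q. vanish q (u q)"
  shows "fsum (\<lambda>q. a * u q) = a * fsum u"
proof (rule fsum_unique[symmetric])
  show "vanish q (a * u q)" for q using assms by (rule vanish_mult_right)
  show "vanish k (a * fsum u - (\<Sum>q<k. a * u q))" for k
    using vanish_mult_right[OF fsum_approx[of u k, OF assms], of a]
    by (simp add: algebra_simps sum_distrib_left)
qed

lemma fsum_Suc:
  assumes "\<And>q. vanish q (u q)"
  shows "fsum u = u 0 + fsum (\<lambda>q. u (Suc q))"
proof -
  have v: "vanish q (u (Suc q))" for q using vanish_mono[OF assms[of "Suc q"]] by simp
  have "vanish k (u 0 + fsum (\<lambda>q. u (Suc q)) - (\<Sum>q<k. u q))" for k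
  proof -
    have "vanish k (u 0 + fsum (\<lambda>q. u (Suc q)) - (\<Sum>q<Suc k. u q))"
      using fsum_approx[of "\<lambda>q. u (Suc q)" k, OF v]
      unfolding sum.lessThan_Suc_shift by (simp add: algebra_simps)
    from vanish_add[OF this assms[of k]] show ?thesis by (simp add: algebra_simps)
  qed
  with assms show ?thesis by (intro fsum_unique[symmetric]) auto
qed

lemma fps_expand_0: "F = fps_const (F $ 0) + fps_X * fps_shift 1 F" for F :: "'c::comm_ring_1 fps"
  by (simp add: fps_eq_iff)

text \<open>Coefficients are mapped by \<open>\<phi>\<close>, the variable goes to b. The
  coefficient ring is left open because the construction is applied twice, over K and over
  K[[x]].\<close>

definition series_eval :: "('c::comm_ring_1 \<Rightarrow> 'a::comm_ring_1 fps2) \<Rightarrow> 'a fps2 \<Rightarrow> 'c fps \<Rightarrow> 'a fps2"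
  where "series_eval \<phi> b F = fsum (\<lambda>q. \<phi> (F $ q) * b ^ q)"

locale eval_data =
  fixes \<phi> :: "'c::comm_ring_1 \<Rightarrow> 'a::comm_ring_1 fps2" and b :: "'a fps2"
  assumes hom_add: "\<phi> (r + s) = \<phi> r + \<phi> s"
    and hom_mult: "\<phi> (r * s) = \<phi> r * \<phi> s"
    and b: "vanish (Suc 0) b"
begin

lemma hom_0: "\<phi> 0 = 0"
  using hom_add[of 0 0] by simp

lemma term_vanish: "vanish q (\<phi> (F q) * b ^ q)"
  by (intro vanish_mult_right vanish_power b)

lemma eval_add: "series_eval \<phi> b (F + G) = series_eval \<phi> b F + series_eval \<phi> b G"
  by (simp add: series_eval_def fsum_def fps_eq_iff hom_add distrib_right sum.distrib)

lemma eval_rec: "series_eval \<phi> b F = \<phi> (F $ 0) + b * series_eval \<phi> b (fps_shift 1 F)"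
  unfolding series_eval_def
  by (subst fsum_Suc[OF term_vanish], subst fsum_mult[OF term_vanish, symmetric])
     (simp add: algebra_simps)

lemma eval_const_mult: "series_eval \<phi> b (fps_const c * G) = \<phi> c * series_eval \<phi> b G"
  unfolding series_eval_def
  by (subst fsum_mult[OF term_vanish, symmetric]) (simp add: hom_mult algebra_simps)

lemma eval_X_mult: "series_eval \<phi> b (fps_X * G) = b * series_eval \<phi> b G"
proof -
  have "fps_shift 1 (fps_X * G) = G" by (simp add: fps_eq_iff)
  then show ?thesis by (subst eval_rec) (simp add: hom_0)
qed

text \<open>Splitting off the constant term of F turns the defect of multiplicativity into b times
  the defect for the shifted series. As b is a nonunit, the defect lies in every power of the
  maximal ideal.\<close>

lemma eval_mult: "series_eval \<phi> b (F * G) = series_eval \<phi> b F * series_eval \<phi> b G"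
proof (rule vanish_all_imp_eq)
  fix k
  show "vanish k (series_eval \<phi> b (F * G) - series_eval \<phi> b F * series_eval \<phi> b G)"
  proof (induction k arbitrary: F)
    case (Suc k)
    define F' where "F' = fps_shift 1 F"
    have "F * G = fps_const (F $ 0) * G + fps_X * (F' * G)"
      using fps_expand_0[of F] by (metis F'_def distrib_right mult.assoc)
    then have "series_eval \<phi> b (F * G) = \<phi> (F $ 0) * series_eval \<phi> b G + b * series_eval \<phi> b (F' * G)"
      by (simp only: eval_add eval_const_mult eval_X_mult)
    moreover have "series_eval \<phi> b F = \<phi> (F $ 0) + b * series_eval \<phi> b F'"
      unfolding F'_def by (rule eval_rec)
    ultimately have "series_eval \<phi> b (F * G) - series_eval \<phi> b F * series_eval \<phi> b G
        = b * (series_eval \<phi> b (F' * G) - series_eval \<phi> b F' * series_eval \<phi> b G)"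
      by (simp add: algebra_simps)
    then show ?case using vanish_mult[OF b Suc.IH[of F']] by simp
  qed simp
qed

lemma eval_const: "series_eval \<phi> b (fps_const c) = \<phi> c"
proof -
  have "fps_shift 1 (fps_const c) = 0" by (simp add: fps_eq_iff)
  moreover have "series_eval \<phi> b 0 = 0"
    using eval_add[of 0 0] by simp
  ultimately show ?thesis by (subst eval_rec) simp
qed

lemma eval_X: "\<phi> 1 = 1 \<Longrightarrow> series_eval \<phi> b fps_X = b"
  using eval_X_mult[of "fps_const 1"] eval_const[of 1] by simp

end

text \<open>Continuity need not be required: it follows from locality, see \<open>local_hom_unique\<close>.\<close>

definition local_hom :: "('a::field fps2 \<Rightarrow> 'a fps2) \<Rightarrow> bool" where
  "local_hom \<Theta> \<longleftrightarrow> (\<forall>f g. \<Theta> (f + g) = \<Theta> f + \<Theta> g) \<and> (\<forall>f g. \<Theta> (f * g) = \<Theta> f * \<Theta> g) \<and>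
     (\<forall>c. \<Theta> (K2 c) = K2 c) \<and> vanish (Suc 0) (\<Theta> xx) \<and> vanish (Suc 0) (\<Theta> yy)"

lemma local_hom_add: "local_hom \<Theta> \<Longrightarrow> \<Theta> (f + g) = \<Theta> f + \<Theta> g"
  and local_hom_mult: "local_hom \<Theta> \<Longrightarrow> \<Theta> (f * g) = \<Theta> f * \<Theta> g"
  and local_hom_K: "local_hom \<Theta> \<Longrightarrow> \<Theta> (K2 c) = K2 c"
  and local_hom_x: "local_hom \<Theta> \<Longrightarrow> vanish (Suc 0) (\<Theta> xx)"
  and local_hom_y: "local_hom \<Theta> \<Longrightarrow> vanish (Suc 0) (\<Theta> yy)"
  by (auto simp: local_hom_def)

lemma local_hom_0: "local_hom \<Theta> \<Longrightarrow> \<Theta> 0 = 0"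
  using local_hom_K[of \<Theta> 0] by simp

lemma local_hom_1: "local_hom \<Theta> \<Longrightarrow> \<Theta> 1 = 1"
  using local_hom_K[of \<Theta> 1] by simp

lemma local_hom_minus: "local_hom \<Theta> \<Longrightarrow> \<Theta> (- f) = - \<Theta> f"
  using local_hom_add[of \<Theta> f "-f"] local_hom_0[of \<Theta>] by (simp add: add_eq_0_iff)

lemma local_hom_diff: "local_hom \<Theta> \<Longrightarrow> \<Theta> (f - g) = \<Theta> f - \<Theta> g"
  using local_hom_add[of \<Theta> f "-g"] local_hom_minus[of \<Theta> g] by simp

lemma local_hom_sum: "local_hom \<Theta> \<Longrightarrow> \<Theta> (\<Sum>i\<in>I. u i) = (\<Sum>i\<in>I. \<Theta> (u i))"
  by (induction I rule: infinite_finite_induct) (auto simp: local_hom_0 local_hom_add)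

lemma local_hom_power: "local_hom \<Theta> \<Longrightarrow> \<Theta> (f ^ k) = \<Theta> f ^ k"
  by (induction k) (auto simp: local_hom_1 local_hom_mult)

text \<open>One variable at a time: substituting for x gives the map \<open>\<psi>\<close> on
  K[[x]], which then serves as coefficient map for the substitution of y.\<close>

lemma local_hom_exists:
  fixes A B :: "'a::field fps2"
  assumes "vanish (Suc 0) A" "vanish (Suc 0) B"
  shows "\<exists>\<Theta>. local_hom \<Theta> \<and> \<Theta> xx = A \<and> \<Theta> yy = B"
proof -
  interpret E1: eval_data "K2 :: 'a \<Rightarrow> 'a fps2" A
    by standard (use assms in \<open>simp_all\<close>)
  define \<psi> where "\<psi> = series_eval K2 A"
  interpret E2: eval_data \<psi> B
    by standard (use assms in \<open>simp_all add: \<psi>_def E1.eval_add E1.eval_mult\<close>)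
  have \<psi>K: "\<psi> (fps_const c) = K2 c" for c by (simp add: \<psi>_def E1.eval_const)
  have \<psi>X: "\<psi> fps_X = A" by (simp add: \<psi>_def E1.eval_X)
  have "\<psi> 1 = 1" using \<psi>K[of 1] by simp
  then have "series_eval \<psi> B yy = B" by (rule E2.eval_X)
  then show ?thesis
    by (intro exI[of _ "series_eval \<psi> B"])
       (simp add: local_hom_def E2.eval_add E2.eval_mult E2.eval_const \<psi>K \<psi>X assms)
qed

text \<open>After the constant term is removed, the difference of the two maps is the image of a
  variable times a difference of the same kind, hence lies in every power of the maximal ideal.
  Series in x alone come before general ones.\<close>

lemma local_hom_unique:
  assumes "local_hom \<Theta>" "local_hom \<Psi>" "\<Theta> xx = \<Psi> xx" "\<Theta> yy = \<Psi> yy"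
  shows "\<Theta> = \<Psi>"
proof
  fix f
  have const: "\<Theta> (fps_const C) = \<Psi> (fps_const C)" for C
  proof (rule vanish_all_imp_eq)
    fix k
    show "vanish k (\<Theta> (fps_const C) - \<Psi> (fps_const C))"
    proof (induction k arbitrary: C)
      case (Suc k)
      have "fps_const C = K2 (C $ 0) + xx * fps_const (fps_shift 1 C)"
        using fps_expand_0[of C] by (metis fps_const_add fps_const_mult)
      then have "\<Theta> (fps_const C) - \<Psi> (fps_const C) =
          \<Theta> xx * (\<Theta> (fps_const (fps_shift 1 C)) - \<Psi> (fps_const (fps_shift 1 C)))"
        using assms by (simp only: local_hom_add local_hom_mult local_hom_K) (simp add: algebra_simps)
      then show ?case using vanish_mult[OF local_hom_x[OF assms(1)] Suc.IH] by simp
    qed simp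
  qed
  show "\<Theta> f = \<Psi> f"
  proof (rule vanish_all_imp_eq)
    fix k
    show "vanish k (\<Theta> f - \<Psi> f)"
    proof (induction k arbitrary: f)
      case (Suc k)
      have "\<Theta> f - \<Psi> f = \<Theta> yy * (\<Theta> (fps_shift 1 f) - \<Psi> (fps_shift 1 f))"
        using assms const
        by (subst (1 2) fps_expand_0[of f]) (simp add: local_hom_add local_hom_mult algebra_simps)
      then show ?case using vanish_mult[OF local_hom_y[OF assms(1)] Suc.IH] by simp
    qed simp
  qed
qed

lemma vanish_local_hom_1:
  assumes "local_hom \<Theta>" "vanish (Suc 0) f"
  shows "vanish (Suc 0) (\<Theta> f)"
proof -
  have "f = K2 (f $ 0 $ 0) + xx * fps_const (fps_shift 1 (f $ 0)) + yy * fps_shift 1 f"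
    using fps_expand_0[of f] fps_expand_0[of "f $ 0"] by (metis fps_const_add fps_const_mult)
  then have "f = xx * fps_const (fps_shift 1 (f $ 0)) + yy * fps_shift 1 f"
    using assms(2) by (simp add: vanish_1_iff)
  then have "\<Theta> f = \<Theta> xx * \<Theta> (fps_const (fps_shift 1 (f $ 0))) + \<Theta> yy * \<Theta> (fps_shift 1 f)"
    using local_hom_add[OF assms(1)] local_hom_mult[OF assms(1)] by metis
  then show ?thesis
    using vanish_mult[OF local_hom_x[OF assms(1)] vanish_0] vanish_mult[OF local_hom_y[OF assms(1)] vanish_0]
    by (metis add_0_right vanish_add)
qed

lemma local_hom_comp: "local_hom \<Theta> \<Longrightarrow> local_hom \<Psi> \<Longrightarrow> local_hom (\<Theta> \<circ> \<Psi>)"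
  unfolding local_hom_def[of "\<Theta> \<circ> \<Psi>"]
  using vanish_local_hom_1[of \<Theta>, OF _ local_hom_x] vanish_local_hom_1[of \<Theta>, OF _ local_hom_y]
  by (auto simp: local_hom_add local_hom_mult local_hom_K)

lemma fps_expand_at:
  "f = (\<Sum>j<m. fps_X ^ j * fps_const (f $ j)) + fps_X ^ m * fps_shift m f"
  for f :: "'c::comm_ring_1 fps"
proof (induction m)
  case (Suc m)
  have "fps_shift m f = fps_const (f $ m) + fps_X * fps_shift (Suc m) f"
    by (subst fps_expand_0) (simp add: fps_eq_iff)
  with Suc.IH show ?case by (simp add: algebra_simps)
qed simp

lemma fps_X_power_shift:
  fixes C :: "'c::comm_ring_1 fps"
  assumes "\<And>i. i < m \<Longrightarrow> C $ i = 0"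
  shows "C = fps_X ^ m * fps_shift m C"
  using fps_expand_at[of C m] assms by simp

text \<open>The constant terms of the \<open>h j\<close> are the coefficients of the degree m part
  of f. This lets a homomorphism be followed on that part while all higher terms stay hidden in the
  \<open>h j\<close>.\<close>

lemma vanish_decomposition:
  fixes f :: "'a::comm_ring_1 fps2"
  assumes "vanish m f"
  shows "\<exists>h. f = (\<Sum>j\<le>m. xx ^ (m - j) * yy ^ j * h j) \<and> (\<forall>j\<le>m. h j $ 0 $ 0 = f $ j $ (m - j))"
proof -
  define h where "h = (\<lambda>j. if j < m then fps_const (fps_shift (m - j) (f $ j)) else fps_shift m f)"
  have low: "yy ^ j * fps_const (f $ j) = xx ^ (m - j) * yy ^ j * h j" if "j < m" for j
  proof -
    have "f $ j $ i = 0" if "i < m - j" for i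
      using assms that by (auto simp: vanish_def)
    then have "f $ j = fps_X ^ (m - j) * fps_shift (m - j) (f $ j)"
      by (rule fps_X_power_shift)
    then have "fps_const (f $ j) = xx ^ (m - j) * h j"
      using that by (simp add: h_def fps_const_power)
    then show ?thesis by (simp add: algebra_simps)
  qed
  have "f = (\<Sum>j<m. yy ^ j * fps_const (f $ j)) + yy ^ m * fps_shift m f"
    by (rule fps_expand_at)
  also have "(\<Sum>j<m. yy ^ j * fps_const (f $ j)) = (\<Sum>j<m. xx ^ (m - j) * yy ^ j * h j)"
    by (intro sum.cong refl low) simp
  also have "\<dots> + yy ^ m * fps_shift m f = (\<Sum>j\<le>m. xx ^ (m - j) * yy ^ j * h j)"
    unfolding lessThan_Suc_atMost[symmetric] by (simp add: h_def)
  finally have "f = (\<Sum>j\<le>m. xx ^ (m - j) * yy ^ j * h j)" .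
  moreover have "\<forall>j\<le>m. h j $ 0 $ 0 = f $ j $ (m - j)"
    by (auto simp: h_def)
  ultimately show ?thesis by blast
qed

section \<open>Weierstrass division\<close>

text \<open>\<open>at_x0 f\<close> is \<open>f(0,y)\<close>, so \<open>yord f\<close> is the intersection number of \<open>f\<close> with the line \<open>x = 0\<close>.\<close>

definition at_x0 :: "'a::field fps2 \<Rightarrow> 'a fps" where
  "at_x0 f = Abs_fps (\<lambda>j. f $ j $ 0)"

abbreviation yord :: "'a::field fps2 \<Rightarrow> nat" where
  "yord f \<equiv> subdegree (at_x0 f)"

lemma at_x0_nth [simp]: "at_x0 f $ j = f $ j $ 0"
  by (simp add: at_x0_def)

lemma at_x0_add [simp]: "at_x0 (f + g) = at_x0 f + at_x0 g"
  and at_x0_diff [simp]: "at_x0 (f - g) = at_x0 f - at_x0 g"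
  and at_x0_0 [simp]: "at_x0 0 = 0"
  and at_x0_xx [simp]: "at_x0 xx = 0"
  and at_x0_K2 [simp]: "at_x0 (K2 c) = fps_const c"
  and at_x0_yy [simp]: "at_x0 yy = fps_X"
  by (auto simp: fps_eq_iff)

lemma at_x0_1 [simp]: "at_x0 1 = 1"
  by (simp add: fps_eq_iff)

lemma at_x0_mult [simp]: "at_x0 (f * g) = at_x0 f * at_x0 g"
  by (simp add: fps_eq_iff fps_mult_nth fps_sum_nth)

lemma at_x0_power [simp]: "at_x0 (f ^ k) = at_x0 f ^ k"
  by (induction k) auto

lemma at_x0_sum: "at_x0 (\<Sum>i\<in>I. u i) = (\<Sum>i\<in>I. at_x0 (u i))"
  by (induction I rule: infinite_finite_induct) auto

lemma at_x0_eq_0_iff: "at_x0 f = 0 \<longleftrightarrow> (\<exists>z. f = xx * z)"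
proof
  assume "at_x0 f = 0"
  then have "f $ j $ 0 = 0" for j by (metis at_x0_nth fps_zero_nth)
  then have "f = xx * Abs_fps (\<lambda>j. fps_shift 1 (f $ j))"
    by (simp add: fps_eq_iff)
  then show "\<exists>z. f = xx * z" ..
qed auto

lemma fps2_unit_iff: "(f :: 'a::field fps2) dvd 1 \<longleftrightarrow> f $ 0 $ 0 \<noteq> 0"
proof
  assume "f dvd 1"
  then obtain g where "1 = f * g" by (elim dvdE)
  then have "(f * g) $ 0 $ 0 = 1" by (metis fps_one_nth)
  then show "f $ 0 $ 0 \<noteq> 0" by auto
next
  assume "f $ 0 $ 0 \<noteq> 0"
  then have "inverse (f $ 0) * f $ 0 = 1" by (simp add: inverse_mult_eq_1)
  then have "fps_left_inverse f (inverse (f $ 0)) * f = 1" by (rule fps_left_inverse)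
  then show "f dvd 1" by (metis dvd_triv_right)
qed

lemma unit_iff_yord: "(f :: 'a::field fps2) dvd 1 \<longleftrightarrow> at_x0 f \<noteq> 0 \<and> yord f = 0"
  unfolding fps2_unit_iff subdegree_eq_0_iff at_x0_nth by (metis at_x0_nth fps_zero_nth)

lemma irreducible_not_unit2: "irreducible f \<Longrightarrow> f $ 0 $ 0 = 0" for f :: "'a::field fps2"
  using fps2_unit_iff irreducible_not_unit by blast

definition yser :: "'a::field fps \<Rightarrow> 'a fps2" where
  "yser \<kappa> = Abs_fps (\<lambda>j. fps_const (\<kappa> $ j))"

lemma at_x0_yser [simp]: "at_x0 (yser \<kappa>) = \<kappa>"
  by (simp add: fps_eq_iff yser_def)

text \<open>At x = 0 the \<open>P j\<close> have the orders 0, ..., r - 1, so triangular elimination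
  removes all terms below y^r, and what remains is divisible by u(0,y). \<open>yser\<close> lifts
  that quotient back to two variables.\<close>

lemma weierstrass_division_mod_x:
  fixes P :: "nat \<Rightarrow> 'a::field fps2"
  assumes P: "\<And>j. j < r \<Longrightarrow> at_x0 (P j) \<noteq> 0 \<and> yord (P j) = j" and u: "at_x0 u \<noteq> 0" "yord u = r"
  shows "\<exists>l \<kappa> z. h = (\<Sum>j<r. K2 (l j) * P j) + yser \<kappa> * u + xx * z"
proof -
  have "\<exists>l. \<forall>i<m. at_x0 (h - (\<Sum>j<m. K2 (l j) * P j)) $ i = 0" if "m \<le> r" for m
    using that
  proof (induction m)
    case (Suc m)
    then obtain l where l: "\<forall>i<m. at_x0 (h - (\<Sum>j<m. K2 (l j) * P j)) $ i = 0" by auto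
    have Pm: "at_x0 (P m) $ m \<noteq> 0" "\<And>i. i < m \<Longrightarrow> at_x0 (P m) $ i = 0"
      using P[of m] Suc.prems nth_subdegree_nonzero[of "at_x0 (P m)"]
        nth_less_subdegree_zero[of _ "at_x0 (P m)"] by auto
    define d where "d = h - (\<Sum>j<m. K2 (l j) * P j)"
    define l' where "l' = l(m := at_x0 d $ m / at_x0 (P m) $ m)"
    have "(\<Sum>j<m. K2 (l' j) * P j) = (\<Sum>j<m. K2 (l j) * P j)"
      by (intro sum.cong) (auto simp: l'_def)
    then have "h - (\<Sum>j<Suc m. K2 (l' j) * P j) = d - K2 (at_x0 d $ m / at_x0 (P m) $ m) * P m"
      by (simp add: d_def l'_def)
    then have "at_x0 (h - (\<Sum>j<Suc m. K2 (l' j) * P j)) =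
        at_x0 d - fps_const (at_x0 d $ m / at_x0 (P m) $ m) * at_x0 (P m)"
      by (simp only: at_x0_diff at_x0_mult at_x0_K2)
    then have "\<forall>i<Suc m. at_x0 (h - (\<Sum>j<Suc m. K2 (l' j) * P j)) $ i = 0"
      using Pm l by (auto simp: less_Suc_eq d_def[symmetric] simp del: at_x0_nth)
    then show ?case by blast
  qed auto
  then obtain l where l: "\<And>i. i < r \<Longrightarrow> at_x0 (h - (\<Sum>j<r. K2 (l j) * P j)) $ i = 0" by blast
  define d where "d = h - (\<Sum>j<r. K2 (l j) * P j)"
  have "at_x0 u dvd at_x0 d"
  proof (cases "at_x0 d = 0")
    case False
    then have "r \<le> subdegree (at_x0 d)" using l unfolding d_def by (intro subdegree_geI)
    then show ?thesis using u False by (subst fps_dvd_iff) auto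
  qed simp
  then obtain \<kappa> where "at_x0 d = at_x0 u * \<kappa>" by (elim dvdE)
  then have "at_x0 (d - yser \<kappa> * u) = 0" by (simp add: mult.commute)
  then obtain z where "d - yser \<kappa> * u = xx * z" using at_x0_eq_0_iff by blast
  then have "h = (\<Sum>j<r. K2 (l j) * P j) + yser \<kappa> * u + xx * z"
    by (simp add: d_def algebra_simps)
  then show ?thesis by blast
qed

text \<open>Here d is the total error of a division repeated on the successive remainders
  \<open>z h\<close>.\<close>

lemma fps_X_iter_eq_0:
  assumes "\<And>h. d h = xx * d (z h)"
  shows "d h = (0 :: 'a::field fps2)"
proof (rule vanish_all_imp_0)
  fix k
  show "vanish k (d h)"
  proof (induction k arbitrary: h)
    case (Suc k)
    have "vanish (Suc 0) (xx :: 'a fps2)" by (simp add: vanish_1_iff)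
    from vanish_mult[OF this Suc.IH[of "z h"]] show ?case using assms[of h] by simp
  qed simp
qed

text \<open>Weierstrass division is the case where \<open>P j\<close> is the power \<open>y^j\<close>.\<close>

lemma weierstrass_division:
  fixes P :: "nat \<Rightarrow> 'a::field fps2"
  assumes P: "\<And>j. j < r \<Longrightarrow> at_x0 (P j) \<noteq> 0 \<and> yord (P j) = j" and u: "at_x0 u \<noteq> 0" "yord u = r"
  shows "\<exists>C \<kappa>. h = (\<Sum>j<r. fps_const (C j) * P j) + \<kappa> * u"
proof -
  from weierstrass_division_mod_x[OF P u, where h = _] obtain l \<kappa> z
    where step: "h = (\<Sum>j<r. K2 (l h j) * P j) + yser (\<kappa> h) * u + xx * z h" for h
    by metis
  \<comment> \<open>The k-th remainder supplies the coefficients of x^k, both for the digits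
    \<open>C\<close> and for the quotient \<open>Q\<close>.\<close>
  define C where "C = (\<lambda>h j. Abs_fps (\<lambda>k. l ((z ^^ k) h) j))"
  define Q where "Q = (\<lambda>h. Abs_fps (\<lambda>j. Abs_fps (\<lambda>k. \<kappa> ((z ^^ k) h) $ j)))"
  define d where "d = (\<lambda>h. h - (\<Sum>j<r. fps_const (C h j) * P j) - Q h * u)"
  have C: "fps_const (C h j) = K2 (l h j) + xx * fps_const (C (z h) j)" for h j
    by (simp add: fps_eq_iff C_def fps_X_mult_nth funpow_swap1 flip: funpow.simps(2))
       (auto simp: fps_eq_iff gr0_conv_Suc funpow_swap1 fps_X_mult_nth)
  have Q: "Q h = yser (\<kappa> h) + xx * Q (z h)" for h
    by (auto simp: fps_eq_iff Q_def yser_def gr0_conv_Suc funpow_swap1 fps_X_mult_nth)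
  have "d h = xx * d (z h)" for h
  proof -
    have "(\<Sum>j<r. fps_const (C h j) * P j) =
        (\<Sum>j<r. K2 (l h j) * P j) + xx * (\<Sum>j<r. fps_const (C (z h) j) * P j)"
      by (subst C) (simp only: distrib_right sum.distrib sum_distrib_left mult.assoc)
    moreover have "Q h * u = yser (\<kappa> h) * u + xx * (Q (z h) * u)"
      by (subst Q) (simp only: distrib_right mult.assoc)
    ultimately have "d h = h - (\<Sum>j<r. K2 (l h j) * P j) - yser (\<kappa> h) * u
        - xx * ((\<Sum>j<r. fps_const (C (z h) j) * P j) + Q (z h) * u)"
      by (simp add: d_def algebra_simps)
    also have "h - (\<Sum>j<r. K2 (l h j) * P j) - yser (\<kappa> h) * u = xx * z h"
      using step[of h] by (simp add: algebra_simps)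
    finally show ?thesis by (simp add: d_def algebra_simps)
  qed
  from fps_X_iter_eq_0[of d, OF this, of h]
  have "h = (\<Sum>j<r. fps_const (C h j) * P j) + Q h * u" by (simp add: d_def algebra_simps)
  then show ?thesis by blast
qed

section \<open>Semivaluations and dimensions of quotients\<close>

declare fps_const_mult [simp del] fps_const_power [simp del]

section \<open>Gap counts in additive sets of naturals\<close>

lemma card_diff_translate_add:
  fixes S :: "nat set"
  assumes closed: "\<And>s t. s \<in> S \<Longrightarrow> t \<in> S \<Longrightarrow> s + t \<in> S" and "a \<in> S"
    and fin: "finite (S - (+) a ` S)" "finite (S - (+) b ` S)"
  shows "finite (S - (+) (a + b) ` S)"
    "b \<in> S \<Longrightarrow> card (S - (+) (a + b) ` S) = card (S - (+) a ` S) + card (S - (+) b ` S)"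
proof -
  have sub: "S - (+) (a + b) ` S \<subseteq> (S - (+) a ` S) \<union> (+) a ` (S - (+) b ` S)"
    by (auto simp: image_iff add.assoc)
  with fin show "finite (S - (+) (a + b) ` S)"
    by (auto intro: finite_subset)
  assume b: "b \<in> S"
  \<comment> \<open>The gaps left by a + b are those left by a together with the a-translates of
    those left by b.\<close>
  have "S - (+) (a + b) ` S = (S - (+) a ` S) \<union> (+) a ` (S - (+) b ` S)"
    using sub closed[OF \<open>a \<in> S\<close>] closed[OF b] by (fastforce simp: image_iff add.assoc)
  moreover have "(S - (+) a ` S) \<inter> (+) a ` (S - (+) b ` S) = {}"
    by auto
  ultimately show "card (S - (+) (a + b) ` S) = card (S - (+) a ` S) + card (S - (+) b ` S)"
    using fin by (simp add: card_Un_disjoint card_image)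
qed

lemma card_diff_translate_times:
  fixes S :: "nat set"
  assumes closed: "\<And>s t. s \<in> S \<Longrightarrow> t \<in> S \<Longrightarrow> s + t \<in> S" and "0 \<in> S" "a \<in> S"
    and fin: "finite (S - (+) a ` S)"
  shows "k * a \<in> S \<and> finite (S - (+) (k * a) ` S) \<and>
    card (S - (+) (k * a) ` S) = k * card (S - (+) a ` S)"
proof (induction k)
  case (Suc k)
  then show ?case
    using card_diff_translate_add[OF closed \<open>a \<in> S\<close> fin, of "k * a"] closed \<open>a \<in> S\<close> by auto
qed (use assms in auto)

text \<open>The gaps left by a N are counted twice, as a copies of the gaps left by N and as N
  copies of the gaps left by a. This makes gap counts proportional to values.\<close>

lemma card_diff_translate:
  fixes S :: "nat set"
  assumes closed: "\<And>s t. s \<in> S \<Longrightarrow> t \<in> S \<Longrightarrow> s + t \<in> S" and "0 \<in> S" "a \<in> S" "N \<in> S"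
    and "0 < N" and fin: "finite (S - (+) N ` S)"
  shows "finite (S - (+) a ` S)"
    "N * card (S - (+) a ` S) = card (S - (+) N ` S) * a"
proof -
  note N = card_diff_translate_times[OF closed \<open>0 \<in> S\<close> \<open>N \<in> S\<close> fin]
  have mult: "k * a \<in> S" for k
    by (induction k) (use closed assms in auto)
  have "S - (+) a ` S \<subseteq> S - (+) (a * N) ` S"
  proof -
    have "a * N + s \<in> (+) a ` S" if "s \<in> S" for s
    proof -
      have "a * N + s = a + ((N - 1) * a + s)"
        using \<open>0 < N\<close> by (cases N) (auto simp: algebra_simps)
      with closed[OF mult that] show ?thesis by blast
    qed
    then show ?thesis by blast
  qed
  with N[of a] show f: "finite (S - (+) a ` S)" by (metis finite_subset)
  from card_diff_translate_times[OF closed \<open>0 \<in> S\<close> \<open>a \<in> S\<close> f, of N] N[of a]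
  show "N * card (S - (+) a ` S) = card (S - (+) N ` S) * a"
    by (simp add: mult.commute)
qed

section \<open>Dimensions of quotients of K[[x,y]]\<close>

lemma K2_vector_space: "vector_space (\<lambda>(c::'a::field) h. K2 c * h)"
  by standard (simp_all add: algebra_simps flip: fps_const_add fps_const_mult)

text \<open>\<open>\<pi>\<close> moves each series modulo I into the span of B. Independence modulo
  I makes it injective on A with linearly independent image.\<close>

lemma independent_mod_card_le:
  fixes I :: "'a::field fps2 set"
  assumes B: "quotient_basis I B"
    and I: "\<And>f g. f \<in> I \<Longrightarrow> g \<in> I \<Longrightarrow> f + g \<in> I" "\<And>c f. f \<in> I \<Longrightarrow> c * f \<in> I" "0 \<in> I"
    and A: "finite A" "\<And>c. (\<Sum>a\<in>A. K2 (c a) * a) \<in> I \<Longrightarrow> \<forall>a\<in>A. c a = 0"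
  shows "card A \<le> card B"
proof -
  interpret vector_space "\<lambda>(c::'a) h. K2 c * h" by (rule K2_vector_space)
  have finB: "finite B" using B by (simp add: quotient_basis_def)
  have sumI: "(\<Sum>i\<in>X. u i) \<in> I" if "\<And>i. i \<in> X \<Longrightarrow> u i \<in> I" for X :: "'a fps2 set" and u
    using that by (induction X rule: infinite_finite_induct) (auto intro: I)
  from B obtain C where C: "h - (\<Sum>b\<in>B. K2 (C h b) * b) \<in> I" for h
    unfolding quotient_basis_def by metis
  define \<pi> where "\<pi> = (\<lambda>h. \<Sum>b\<in>B. K2 (C h b) * b)"
  have \<pi>: "h - \<pi> h \<in> I" for h using C by (simp add: \<pi>_def)
  have indep: "\<forall>a\<in>A. c a = 0" if "(\<Sum>a\<in>A. K2 (c a) * \<pi> a) = 0" for c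
  proof (rule A(2))
    have "(\<Sum>a\<in>A. K2 (c a) * a) = (\<Sum>a\<in>A. K2 (c a) * (a - \<pi> a))"
      using that by (simp add: right_diff_distrib sum_subtractf)
    then show "(\<Sum>a\<in>A. K2 (c a) * a) \<in> I" using \<pi> by (auto intro!: sumI I)
  qed
  have inj: "inj_on \<pi> A"
  proof (rule inj_onI, rule ccontr)
    fix a a' assume aa: "a \<in> A" "a' \<in> A" "\<pi> a = \<pi> a'" "a \<noteq> a'"
    define c :: "'a fps2 \<Rightarrow> 'a" where "c = (\<lambda>b. if b = a then 1 else if b = a' then -1 else 0)"
    have "(\<Sum>b\<in>A. K2 (c b) * \<pi> b) = (\<Sum>b\<in>{a, a'}. K2 (c b) * \<pi> b)"
      using aa A(1) by (intro sum.mono_neutral_right) (auto simp: c_def)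
    also have "\<dots> = 0" using aa by (simp add: c_def flip: fps_const_neg)
    finally have "c a = 0" using indep aa by blast
    then show False by (simp add: c_def)
  qed
  have "independent (\<pi> ` A)"
  proof (rule independent_if_scalars_zero)
    fix c x assume c: "(\<Sum>x\<in>\<pi> ` A. K2 (c x) * x) = 0" and x: "x \<in> \<pi> ` A"
    from c have "(\<Sum>a\<in>A. K2 (c (\<pi> a)) * \<pi> a) = 0" by (simp add: sum.reindex[OF inj])
    from indep[OF this] x show "c x = 0" by auto
  qed (use A in auto)
  moreover have "\<pi> ` A \<subseteq> span B"
    unfolding \<pi>_def by (auto intro!: span_sum span_scale intro: span_base)
  ultimately have "card (\<pi> ` A) \<le> card B"
    using independent_span_bound[OF finB] by blast
  then show ?thesis using inj by (simp add: card_image)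
qed

text \<open>The dimension is an infimum over all bases. By uniqueness of the coordinates of 0 a
  basis is independent modulo I, so no other basis is smaller.\<close>

lemma quotient_dim_eqI:
  fixes I :: "'a::field fps2 set"
  assumes B: "quotient_basis I B"
    and I: "\<And>f g. f \<in> I \<Longrightarrow> g \<in> I \<Longrightarrow> f + g \<in> I" "\<And>c f. f \<in> I \<Longrightarrow> c * f \<in> I" "0 \<in> I"
  shows "quotient_dim I = enat (card B)"
  unfolding quotient_dim_def
proof (rule antisym)
  show "(INF B\<in>{B. quotient_basis I B}. enat (card B)) \<le> enat (card B)"
    using B by (intro INF_lower) simp
  show "enat (card B) \<le> (INF B\<in>{B. quotient_basis I B}. enat (card B))"
  proof (rule INF_greatest)
    fix B' assume "B' \<in> {B. quotient_basis I B}"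
    then have "card B \<le> card B'"
    proof (intro independent_mod_card_le[of I B'] I)
      show "finite B" using B by (simp add: quotient_basis_def)
      fix c assume c: "(\<Sum>b\<in>B. K2 (c b) * b) \<in> I"
      define c' where "c' = (\<lambda>b. if b \<in> B then c b else 0)"
      have c': "(\<Sum>b\<in>B. K2 (c' b) * b) = (\<Sum>b\<in>B. K2 (c b) * b)"
        by (intro sum.cong) (auto simp: c'_def)
      define Q where "Q = (\<lambda>c. (\<forall>b. b \<notin> B \<longrightarrow> c b = 0) \<and> 0 - (\<Sum>b\<in>B. K2 (c b) * b) \<in> I)"
      have "\<exists>!c. Q c"
        using B unfolding quotient_basis_def Q_def by blast
      moreover have "Q c'"
        using I(2)[OF c, of "-1"] c' by (simp add: c'_def Q_def)
      moreover have "Q (\<lambda>_. 0)"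
        using I(3) by (simp add: Q_def)
      ultimately have "c' = (\<lambda>_. 0)" by blast
      then show "\<forall>b\<in>B. c b = 0" by (metis c'_def)
    qed simp_all
    then show "enat (card B) \<le> enat (card B')" by simp
  qed
qed

lemma ideal2_add: "f \<in> ideal2 a b \<Longrightarrow> g \<in> ideal2 a b \<Longrightarrow> f + g \<in> ideal2 a b"
proof -
  assume "f \<in> ideal2 a b" "g \<in> ideal2 a b"
  then obtain r s r' s' where "f = r * a + s * b" "g = r' * a + s' * b"
    unfolding ideal2_def by blast
  then have "f + g = (r + r') * a + (s + s') * b" by (simp add: algebra_simps)
  then show ?thesis unfolding ideal2_def by blast
qed

lemma ideal2_mult: "f \<in> ideal2 a b \<Longrightarrow> c * f \<in> ideal2 a b"
proof -
  assume "f \<in> ideal2 a b"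
  then obtain r s where "f = r * a + s * b" unfolding ideal2_def by blast
  then have "c * f = (c * r) * a + (c * s) * b" by (simp add: algebra_simps)
  then show ?thesis unfolding ideal2_def by blast
qed

lemma ideal2_0: "0 \<in> ideal2 a b"
  unfolding ideal2_def by (auto intro: exI[of _ 0])

lemma ideal2_commute: "ideal2 a b = ideal2 b a"
  unfolding ideal2_def by (metis add.commute)

lemma intersection_number_commute: "intersection_number f g = intersection_number g f"
  by (simp add: intersection_number_def ideal2_commute)

text \<open>An abstraction of the order of a series along an arc. Infinite values off 0 are allowed
  and form the prime ideal of the arc. \<open>v_res\<close> says that the residue field is K: equal
  finite values can be made to cancel by a scalar. N is the value of x.\<close>

locale semival =
  fixes v :: "'a::field fps2 \<Rightarrow> enat" and N :: nat
  assumes v_mult: "v (f * h) = v f + v h"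
    and v_add: "min (v f) (v h) \<le> v (f + h)"
    and v_0 [simp]: "v 0 = \<infinity>"
    and v_K: "c \<noteq> 0 \<Longrightarrow> v (K2 c) = 0"
    and v_x: "v xx = enat N"
    and N_pos: "0 < N"
    and v_y: "0 < v yy"
    and v_res: "v f = enat s \<Longrightarrow> v h = enat s \<Longrightarrow> \<exists>c. enat s < v (f - K2 c * h)"
begin

lemma v_1 [simp]: "v 1 = 0"
  using v_K[of 1] by simp

lemma v_minus [simp]: "v (- f) = v f"
  using v_mult[of "K2 (-1)" f] v_K[of "-1"] by (simp flip: fps_const_neg)

lemma v_add_ge: "c \<le> v f \<Longrightarrow> c \<le> v h \<Longrightarrow> c \<le> v (f + h)"
  using v_add[of f h] by (metis min.boundedI order.trans)

lemma v_diff_ge: "c \<le> v f \<Longrightarrow> c \<le> v h \<Longrightarrow> c \<le> v (f - h)"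
  using v_add_ge[of c f "-h"] by simp

lemma v_sum_ge: "(\<And>i. i \<in> I \<Longrightarrow> c \<le> v (t i)) \<Longrightarrow> c \<le> v (\<Sum>i\<in>I. t i)"
  by (induction I rule: infinite_finite_induct) (auto intro: v_add_ge)

lemma v_add_eq: "v f < v h \<Longrightarrow> v (f + h) = v f"
proof (rule antisym)
  assume lt: "v f < v h"
  show "v (f + h) \<le> v f"
  proof (rule ccontr)
    assume "\<not> v (f + h) \<le> v f"
    then have "v f < min (v (f + h)) (v h)" using lt by auto
    also have "\<dots> \<le> v (f + h - h)" using v_add[of "f + h" "-h"] by simp
    finally show False by simp
  qed
qed (auto intro: v_add_ge)

lemma v_add_inf: "v h = \<infinity> \<Longrightarrow> v (f + h) = v f"
  using v_add_eq[of f h] v_add_ge[of \<infinity> f h] by (cases "v f = \<infinity>") auto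

lemma v_add_neq: "v f \<noteq> v h \<Longrightarrow> v (f + h) = min (v f) (v h)"
  using v_add_eq[of f h] v_add_eq[of h f] by (auto simp: add.commute min_def)

lemma v_power: "v (f ^ k) = of_nat k * v f"
  by (induction k) (auto simp: v_mult algebra_simps)

lemma v_x_power: "v (xx ^ k) = enat (k * N)"
  by (simp add: v_power v_x of_nat_eq_enat)

lemma v_unit: "f dvd 1 \<Longrightarrow> v f = 0"
  using v_mult[of f] by (elim dvdE) (metis v_1 add_eq_0_iff_both_eq_0)

lemma v_const: "C \<noteq> 0 \<Longrightarrow> v (fps_const C) = enat (subdegree C * N)"
proof -
  assume "C \<noteq> 0"
  then have nz: "fps_shift (subdegree C) C $ 0 \<noteq> 0" by simp
  have "C = fps_X ^ subdegree C * fps_shift (subdegree C) C"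
    by (intro fps_X_power_shift) auto
  then have "fps_const C = xx ^ subdegree C * fps_const (fps_shift (subdegree C) C)"
    by (metis fps_const_mult fps_const_power)
  moreover have "v (fps_const (fps_shift (subdegree C) C)) = 0"
    using nz by (intro v_unit) (simp add: fps2_unit_iff)
  ultimately show ?thesis by (metis v_mult v_x_power add_0_right)
qed

lemma v_nonunit: "f $ 0 $ 0 = 0 \<Longrightarrow> 0 < v f"
proof -
  assume f: "f $ 0 $ 0 = 0"
  have "f = K2 (f $ 0 $ 0) + xx * fps_const (fps_shift 1 (f $ 0)) + yy * fps_shift 1 f"
    using fps_expand_0[of f] fps_expand_0[of "f $ 0"] by (metis fps_const_add fps_const_mult)
  with f have "f = xx * fps_const (fps_shift 1 (f $ 0)) + yy * fps_shift 1 f" by simp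
  moreover have "eSuc 0 \<le> v (xx * fps_const (fps_shift 1 (f $ 0)))"
  proof -
    have "0 < enat N" using N_pos by (simp add: zero_enat_def)
    then show ?thesis unfolding v_mult v_x by (intro ileI1 add_pos_nonneg zero_le)
  qed
  moreover have "eSuc 0 \<le> v (yy * fps_shift 1 f)"
    unfolding v_mult using v_y by (intro ileI1 add_pos_nonneg zero_le)
  ultimately have "eSuc 0 \<le> v f" using v_add_ge by metis
  then show ?thesis by (cases "v f") (auto simp: zero_enat_def eSuc_enat)
qed

definition S :: "nat set" where
  "S = {s. \<exists>h. v h = enat s}"

lemma S_I: "v h = enat s \<Longrightarrow> s \<in> S"
  by (auto simp: S_def)

lemma S_add: "s \<in> S \<Longrightarrow> t \<in> S \<Longrightarrow> s + t \<in> S"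
proof -
  assume "s \<in> S" "t \<in> S"
  then obtain f h where "v f = enat s" "v h = enat t" by (auto simp: S_def)
  then show ?thesis by (intro S_I[of "f * h"]) (simp add: v_mult)
qed

lemma S_0: "0 \<in> S"
  using S_I[of 1 0] by (simp add: zero_enat_def)

lemma S_N: "N \<in> S"
  using v_x by (rule S_I)

text \<open>Terms with different finite values cannot cancel. Infinite values may coincide, since
  they come from zero coefficients.\<close>

lemma v_sum_distinct:
  assumes "finite I" "\<And>i j. i \<in> I \<Longrightarrow> j \<in> I \<Longrightarrow> v (t i) = v (t j) \<Longrightarrow> v (t i) \<noteq> \<infinity> \<Longrightarrow> i = j"
  shows "v (\<Sum>i\<in>I. t i) = \<infinity> \<and> (\<forall>i\<in>I. v (t i) = \<infinity>) \<or>
    (\<exists>i\<in>I. v (\<Sum>i\<in>I. t i) = v (t i) \<and> v (t i) \<noteq> \<infinity>)"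
  using assms
proof (induction I rule: finite_induct)
  case (insert k I)
  have IH: "v (\<Sum>i\<in>I. t i) = \<infinity> \<and> (\<forall>i\<in>I. v (t i) = \<infinity>) \<or>
    (\<exists>i\<in>I. v (\<Sum>i\<in>I. t i) = v (t i) \<and> v (t i) \<noteq> \<infinity>)"
    using insert.IH insert.prems by blast
  show ?case
  proof (cases "v (t k) = v (\<Sum>i\<in>I. t i)")
    case True
    have "v (t k) = \<infinity>"
    proof (rule ccontr)
      assume "v (t k) \<noteq> \<infinity>"
      with True IH obtain i where "i \<in> I" "v (t k) = v (t i)" by auto
      with insert.prems[of k i] \<open>v (t k) \<noteq> \<infinity>\<close> insert.hyps show False by auto
    qed
    with True IH insert.hyps show ?thesis by (auto simp: v_add_inf)
  next
    case False
    from v_add_neq[OF this] insert.hyps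
    have "v (\<Sum>i\<in>insert k I. t i) = min (v (t k)) (v (\<Sum>i\<in>I. t i))" by simp
    then show ?thesis using IH False by (auto simp: min_def)
  qed
qed simp

lemma v_inf_if_ge: "(\<And>k. enat (k * N) \<le> v h) \<Longrightarrow> v h = \<infinity>"
proof (rule ccontr)
  assume le: "\<And>k. enat (k * N) \<le> v h" and "v h \<noteq> \<infinity>"
  then obtain n where n: "v h = enat n" by auto
  from le[of "Suc n"] n N_pos have "Suc n * N \<le> n" by simp
  moreover have "Suc n \<le> Suc n * N" using N_pos by (simp del: mult_Suc)
  ultimately have "Suc n \<le> n" by (rule order.trans[rotated])
  then show False by simp
qed

lemma S_minus_mult:
  assumes "\<And>s. s \<in> S \<Longrightarrow> c + N \<le> s \<Longrightarrow> s - N \<in> S"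
  shows "s \<in> S \<Longrightarrow> c + k * N \<le> s \<Longrightarrow> s - k * N \<in> S"
proof (induction k)
  case (Suc k)
  from Suc have "s - k * N \<in> S" "c + N \<le> s - k * N" by auto
  from assms[OF this] show ?case by (simp add: algebra_simps)
qed simp

text \<open>This is where the completeness of \<open>K[[x,y]]\<close> enters.\<close>

lemma large_value_multiple:
  assumes p: "v p = enat m"
    and m: "\<And>s. s \<in> S \<Longrightarrow> c \<le> s \<Longrightarrow> m \<le> s \<and> s - m \<in> S"
    and N: "\<And>s. s \<in> S \<Longrightarrow> c + N \<le> s \<Longrightarrow> s - N \<in> S"
    and h: "enat c \<le> v h"
  shows "\<exists>z. v (h - p * z) = \<infinity>"
proof -
  \<comment> \<open>A window of N consecutive numbers: every value from c on is an element of
    \<open>I\<close> plus a multiple of N, so powers of x times finitely many products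
    \<open>p * q s\<close> reach all large values.\<close>
  define I where "I = S \<inter> {c..<c + N}"
  have finI: "finite I" by (simp add: I_def)
  have "\<exists>q. v q = enat (s - m)" if "s \<in> I" for s
    using m[of s] that by (auto simp: I_def S_def)
  then obtain q where q: "\<And>s. s \<in> I \<Longrightarrow> v (q s) = enat (s - m)" by metis
  have e: "v (p * q s) = enat s" if "s \<in> I" for s
    using m[of s] q[OF that] that by (auto simp: v_mult p I_def)
  \<comment> \<open>The value of h is raised one unit at a time. If it equals c + k N + j, then x^k
    times \<open>p * q (c + j)\<close> has the same value, and a scalar makes the two
    cancel.\<close>
  have step: "\<exists>l. enat (c + k * N + j) \<le> v (h - xx ^ k * (\<Sum>s\<in>I. K2 (l s) * (p * q s)))"
    if "enat (c + k * N) \<le> v h" "j \<le> N" for h k j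
    using that(2)
  proof (induction j)
    case 0
    then show ?case using that(1) by (auto intro: exI[of _ "\<lambda>_. 0"])
  next
    case (Suc j)
    then obtain l where l: "enat (c + k * N + j) \<le> v (h - xx ^ k * (\<Sum>s\<in>I. K2 (l s) * (p * q s)))"
      by auto
    define h' where "h' = h - xx ^ k * (\<Sum>s\<in>I. K2 (l s) * (p * q s))"
    show ?case
    proof (cases "v h' = enat (c + k * N + j)")
      case False
      then have "enat (c + k * N + Suc j) \<le> v h'"
        using l by (cases "v h'") (auto simp: h'_def)
      then show ?thesis unfolding h'_def by blast
    next
      case True
      have "c + j = c + k * N + j - k * N" by simp
      then have "c + j \<in> S"
        using S_minus_mult[of c "c + k * N + j" k, OF N S_I[OF True]] by simp
      then have t: "c + j \<in> I" using Suc.prems by (simp add: I_def)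
      have "v (xx ^ k * (p * q (c + j))) = enat (c + k * N + j)"
        using e[OF t] v_mult[of "xx ^ k" "p * q (c + j)"] by (simp add: v_x_power)
      from v_res[OF True this] obtain d
        where d: "enat (c + k * N + j) < v (h' - K2 d * (xx ^ k * (p * q (c + j))))" by blast
      define l' where "l' = l(c + j := l (c + j) + d)"
      have "(\<Sum>s\<in>I - {c + j}. K2 (l' s) * (p * q s)) = (\<Sum>s\<in>I - {c + j}. K2 (l s) * (p * q s))"
        by (intro sum.cong) (auto simp: l'_def)
      then have "(\<Sum>s\<in>I. K2 (l' s) * (p * q s)) = (\<Sum>s\<in>I. K2 (l s) * (p * q s)) + K2 d * (p * q (c + j))"
        using t finI by (simp add: sum.remove[of I "c + j"] l'_def algebra_simps flip: fps_const_add)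
      then have "h - xx ^ k * (\<Sum>s\<in>I. K2 (l' s) * (p * q s)) = h' - K2 d * (xx ^ k * (p * q (c + j)))"
        by (simp add: h'_def algebra_simps)
      with ileI1[OF d] have "enat (c + k * N + Suc j) \<le> v (h - xx ^ k * (\<Sum>s\<in>I. K2 (l' s) * (p * q s)))"
        by (simp add: eSuc_enat)
      then show ?thesis by blast
    qed
  qed
  have "\<exists>l. enat (c + Suc k * N) \<le> v (h - xx ^ k * (\<Sum>s\<in>I. K2 (l s) * (p * q s)))"
    if "enat (c + k * N) \<le> v h" for h k
    using step[OF that, of N] by (simp add: algebra_simps)
  note ex = this
  define L where "L = (\<lambda>k h. SOME l. enat (c + Suc k * N) \<le> v (h - xx ^ k * (\<Sum>s\<in>I. K2 (l s) * (p * q s))))"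
  have L: "enat (c + Suc k * N) \<le> v (h - xx ^ k * (\<Sum>s\<in>I. K2 (L k h s) * (p * q s)))"
    if "enat (c + k * N) \<le> v h" for h k
    using someI_ex[OF ex[OF that]] unfolding L_def .
  define H where "H = rec_nat h (\<lambda>k h. h - xx ^ k * (\<Sum>s\<in>I. K2 (L k h s) * (p * q s)))"
  have H: "enat (c + k * N) \<le> v (H k)" for k
    by (induction k) (use h L in \<open>auto simp: H_def\<close>)
  \<comment> \<open>The scalars of round k become coefficients of x^k, so infinitely many
    corrections combine into one finite sum z over K[[x]].\<close>
  define C where "C = (\<lambda>s. Abs_fps (\<lambda>k. L k (H k) s))"
  define z where "z = (\<Sum>s\<in>I. fps_const (C s) * q s)"
  have shiftC: "fps_const (fps_shift k (C s)) = K2 (L k (H k) s) + xx * fps_const (fps_shift (Suc k) (C s))"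
    for k s
    by (subst fps_expand_0[of "fps_shift k (C s)"])
       (simp add: C_def fps_eq_iff fps_X_mult_nth)
  have key: "h - p * z = H k - xx ^ k * (\<Sum>s\<in>I. fps_const (fps_shift k (C s)) * (p * q s))" for k
  proof (induction k)
    case 0
    then show ?case by (simp add: H_def z_def sum_distrib_left algebra_simps)
  next
    case (Suc k)
    have "(\<Sum>s\<in>I. fps_const (fps_shift k (C s)) * (p * q s)) =
        (\<Sum>s\<in>I. K2 (L k (H k) s) * (p * q s)) + xx * (\<Sum>s\<in>I. fps_const (fps_shift (Suc k) (C s)) * (p * q s))"
      by (subst shiftC) (simp only: distrib_right sum.distrib sum_distrib_left mult.assoc)
    with Suc.IH show ?case by (simp add: H_def algebra_simps)
  qed
  have "enat (k * N) \<le> v (h - p * z)" for k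
  proof -
    have "enat (k * N) \<le> enat (c + k * N)" by simp
    also note H[of k]
    finally have "enat (k * N) \<le> v (H k)" .
    moreover have "enat (k * N) \<le> v (xx ^ k * (\<Sum>s\<in>I. fps_const (fps_shift k (C s)) * (p * q s)))"
      unfolding v_mult v_x_power by (rule le_iff_add[THEN iffD2]) blast
    ultimately show ?thesis unfolding key[of k] by (rule v_diff_ge)
  qed
  from v_inf_if_ge[OF this] show ?thesis by blast
qed

end

section \<open>The Apery sequence of a branch\<close>

lemma mod_eq_imp_add_mult:
  fixes s t N :: nat
  assumes "s mod N = t mod N" "s \<le> t"
  shows "\<exists>d. t = s + N * d"
proof -
  have "N dvd t - s" using assms by (metis mod_eq_dvd_iff_nat)
  then obtain d where "t - s = N * d" by (elim dvdE)
  then have "t = s + N * d" using assms by simp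
  then show ?thesis ..
qed

text \<open>Only that v is infinite on g is assumed; that the multiples of g are the whole kernel is
  derived in \<open>v_inf_iff\<close>.\<close>

locale semival_branch = semival v N for v :: "'a::field fps2 \<Rightarrow> enat" and N +
  fixes g :: "'a fps2"
  assumes irr: "irreducible g" and v_g: "v g = \<infinity>" and at_x0_g: "at_x0 g \<noteq> 0"
begin

text \<open>The least y-order in the kernel of v. It equals the y-order of g, but the proof of this
  uses the sequence \<open>ap\<close>, which is controlled only below \<open>rho\<close>.\<close>

definition rho :: nat where
  "rho = (LEAST r. \<exists>u. v u = \<infinity> \<and> at_x0 u \<noteq> 0 \<and> yord u = r)"

text \<open>The maximum exists for j < rho by \<open>finite_values\<close>. From \<open>rho\<close>
  on the set is unbounded, because a large power of x can be added to a kernel element.\<close>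

definition ap :: "nat \<Rightarrow> nat" where
  "ap j = Max {s. \<exists>q. at_x0 q \<noteq> 0 \<and> yord q = j \<and> v q = enat s}"

lemma rho_attained: "\<exists>u. v u = \<infinity> \<and> at_x0 u \<noteq> 0 \<and> yord u = rho"
  unfolding rho_def by (rule LeastI[of _ "yord g"]) (use v_g at_x0_g in blast)

lemma rho_le: "v u = \<infinity> \<Longrightarrow> at_x0 u \<noteq> 0 \<Longrightarrow> rho \<le> yord u"
  unfolding rho_def by (rule Least_le) blast

text \<open>As N lies in S, the larger of two different elements of S that are congruent modulo N
  lies in N + S. Hence each residue class contributes at most one element.\<close>

lemma finite_S_minus: "finite (S - (+) N ` S)"
proof (rule inj_on_finite)
  show "(\<lambda>s. s mod N) ` (S - (+) N ` S) \<subseteq> {..<N}" using N_pos by auto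
  have *: "s = t" if s: "s \<in> S - (+) N ` S" "t \<in> S - (+) N ` S" "s mod N = t mod N" "s \<le> t" for s t
  proof (rule ccontr)
    assume "s \<noteq> t"
    with s have "s < t" by simp
    obtain d where d: "t = s + N * d" using mod_eq_imp_add_mult[of s N t] s by auto
    then obtain d' where d': "d = Suc d'" using \<open>s < t\<close> by (cases d) auto
    have "N * d' \<in> S" by (induction d') (use S_0 S_add[OF S_N] in auto)
    then have "s + N * d' \<in> S" using s S_add by auto
    moreover have "t = N + (s + N * d')" using d d' by simp
    ultimately show False using s by blast
  qed
  show "inj_on (\<lambda>s. s mod N) (S - (+) N ` S)"
  proof (rule inj_onI)
    fix s t assume "s \<in> S - (+) N ` S" "t \<in> S - (+) N ` S" "s mod N = t mod N"
    with *[of s t] *[of t s] show "s = t" by (cases "s \<le> t") auto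
  qed
qed simp

lemma S_minus_N: "\<exists>c. \<forall>s\<in>S. c \<le> s \<longrightarrow> N \<le> s \<and> s - N \<in> S"
proof -
  have "\<exists>c. \<forall>s\<in>S - (+) N ` S. s < c"
    using finite_S_minus by (metis finite_nat_set_iff_bounded)
  then obtain c where c: "\<And>s. s \<in> S - (+) N ` S \<Longrightarrow> s < c" by blast
  have "N \<le> s \<and> s - N \<in> S" if "s \<in> S" "c \<le> s" for s
  proof -
    have "s \<in> (+) N ` S" using c[of s] that by auto
    then show ?thesis by auto
  qed
  then show ?thesis by blast
qed

text \<open>A series h of large value is a multiple x z up to a kernel element. That kernel element
  has the same restriction to x = 0 as h, so the y-order of h is at least
  \<open>rho\<close>.\<close>

lemma bounded_below_rho: "\<exists>M. \<forall>h. at_x0 h \<noteq> 0 \<longrightarrow> yord h < rho \<longrightarrow> v h < enat M"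
proof -
  obtain c where c: "\<And>s. s \<in> S \<Longrightarrow> c \<le> s \<Longrightarrow> N \<le> s \<and> s - N \<in> S"
    using S_minus_N by blast
  have "v h < enat c" if "at_x0 h \<noteq> 0" "yord h < rho" for h
  proof (rule ccontr)
    assume "\<not> v h < enat c"
    then have "enat c \<le> v h" by simp
    with large_value_multiple[OF v_x, of c h] c obtain z where "v (h - xx * z) = \<infinity>"
      by force
    from rho_le[OF this] that show False by simp
  qed
  then show ?thesis by blast
qed

lemma finite_values: "j < rho \<Longrightarrow> finite {s. \<exists>q. at_x0 q \<noteq> 0 \<and> yord q = j \<and> v q = enat s}"
proof -
  assume "j < rho"
  obtain M where M: "\<And>h. at_x0 h \<noteq> 0 \<Longrightarrow> yord h < rho \<Longrightarrow> v h < enat M"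
    using bounded_below_rho by blast
  have "{s. \<exists>q. at_x0 q \<noteq> 0 \<and> yord q = j \<and> v q = enat s} \<subseteq> {..<M}"
    using M \<open>j < rho\<close> by force
  then show ?thesis by (rule finite_subset) simp
qed

lemma v_finite: "at_x0 q \<noteq> 0 \<Longrightarrow> yord q < rho \<Longrightarrow> \<exists>s. v q = enat s"
  using bounded_below_rho by (metis less_enatE)

lemma ap_attained:
  assumes "j < rho"
  shows "\<exists>q. at_x0 q \<noteq> 0 \<and> yord q = j \<and> v q = enat (ap j)"
proof -
  have "at_x0 (yy ^ j) \<noteq> 0" "yord (yy ^ j) = j" by simp_all
  with v_finite[of "yy ^ j"] assms obtain s where "v (yy ^ j) = enat s" by auto
  then have "{s. \<exists>q. at_x0 q \<noteq> 0 \<and> yord q = j \<and> v q = enat s} \<noteq> {}"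
    using \<open>at_x0 (yy ^ j) \<noteq> 0\<close> \<open>yord (yy ^ j) = j\<close> by blast
  from Max_in[OF finite_values[OF assms] this] show ?thesis unfolding ap_def by blast
qed

lemma ap_ge:
  assumes "at_x0 q \<noteq> 0" "yord q < rho"
  shows "v q \<le> enat (ap (yord q))"
proof -
  obtain s where s: "v q = enat s" using v_finite assms by blast
  then have "s \<le> ap (yord q)"
    unfolding ap_def using assms by (intro Max_ge finite_values) auto
  with s show ?thesis by simp
qed

lemma ap_superadd:
  assumes "i + j < rho"
  shows "ap i + ap j \<le> ap (i + j)"
proof -
  obtain p q where "at_x0 p \<noteq> 0" "yord p = i" "v p = enat (ap i)" "at_x0 q \<noteq> 0" "yord q = j" "v q = enat (ap j)"
    using ap_attained[of i] ap_attained[of j] assms by auto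
  then show ?thesis using ap_ge[of "p * q"] assms by (simp add: v_mult)
qed

lemma ap_0: "0 < rho \<Longrightarrow> ap 0 = 0"
proof -
  assume "0 < rho"
  then obtain q where "at_x0 q \<noteq> 0" "yord q = 0" "v q = enat (ap 0)" using ap_attained by blast
  then have "v q = 0" using unit_iff_yord v_unit by blast
  with \<open>v q = enat (ap 0)\<close> show ?thesis by (simp add: zero_enat_def)
qed

text \<open>A series of y-order j - i > 0 is a nonunit and has positive value; superadditivity does
  the rest.\<close>

lemma ap_strict_mono:
  assumes "i < j" "j < rho"
  shows "ap i < ap j"
proof -
  have "j - i < rho" using assms by linarith
  from ap_attained[OF this] obtain q where q: "at_x0 q \<noteq> 0" "yord q = j - i" "v q = enat (ap (j - i))"
    by blast
  then have "\<not> q dvd 1" using assms by (simp add: unit_iff_yord)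
  then have "0 < v q" by (intro v_nonunit) (simp add: fps2_unit_iff)
  then have "0 < ap (j - i)" using q by (simp add: zero_enat_def)
  with ap_superadd[of i "j - i"] assms show ?thesis by simp
qed

text \<open>Otherwise x^r times an optimal p of y-order i matches the value of an optimal q of
  y-order j. Subtracting a scalar multiple raises the value of q and, because r > 0, leaves q at x =
  0 unchanged.\<close>

lemma ap_mod_distinct:
  assumes "i < j" "j < rho"
  shows "ap i mod N \<noteq> ap j mod N"
proof
  assume "ap i mod N = ap j mod N"
  with ap_strict_mono[OF assms] obtain r where r: "ap j = ap i + N * r"
    using mod_eq_imp_add_mult[of "ap i" N "ap j"] by auto
  with ap_strict_mono[OF assms] have "r \<noteq> 0" by (cases r) auto
  obtain p q where p: "v p = enat (ap i)" and q: "at_x0 q \<noteq> 0" "yord q = j" "v q = enat (ap j)"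
    using ap_attained[of i] ap_attained[of j] assms by auto
  have "v (xx ^ r * p) = enat (ap j)" by (simp add: v_mult v_x_power p r mult.commute)
  from v_res[OF q(3) this] obtain c where c: "enat (ap j) < v (q - K2 c * (xx ^ r * p))" by blast
  define q' where "q' = q - K2 c * (xx ^ r * p)"
  have "at_x0 q' = at_x0 q" using \<open>r \<noteq> 0\<close> by (simp add: q'_def)
  with ap_ge[of q'] q assms have "v q' \<le> enat (ap j)" by simp
  with c show False by (simp add: q'_def)
qed

lemma ap_mod_inj: "i < rho \<Longrightarrow> j < rho \<Longrightarrow> ap i mod N = ap j mod N \<Longrightarrow> i = j"
  using ap_mod_distinct[of i j] ap_mod_distinct[of j i] by (cases i j rule: linorder_cases) auto

text \<open>The \<open>P j\<close> span the quotient by u over K[[x]], with values that are pairwise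
  incongruent modulo N.\<close>

definition apery_basis :: "(nat \<Rightarrow> 'a fps2) \<Rightarrow> 'a fps2 \<Rightarrow> bool" where
  "apery_basis P u \<longleftrightarrow> (\<forall>j<rho. v (P j) = enat (ap j)) \<and> v u = \<infinity> \<and> at_x0 u \<noteq> 0 \<and> yord u = rho \<and>
    (\<forall>h. \<exists>C \<kappa>. h = (\<Sum>j<rho. fps_const (C j) * P j) + \<kappa> * u)"

lemma apery_basis_exists: "\<exists>P u. apery_basis P u"
proof -
  obtain P where P: "\<And>j. j < rho \<Longrightarrow> at_x0 (P j) \<noteq> 0 \<and> yord (P j) = j \<and> v (P j) = enat (ap j)"
    using ap_attained by metis
  obtain u where u: "v u = \<infinity>" "at_x0 u \<noteq> 0" "yord u = rho" using rho_attained by blast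
  have "\<exists>C \<kappa>. h = (\<Sum>j<rho. fps_const (C j) * P j) + \<kappa> * u" for h
    using P u by (intro weierstrass_division) blast+
  with P u have "apery_basis P u" unfolding apery_basis_def by blast
  then show ?thesis by blast
qed

lemma v_apery_sum:
  assumes P: "\<And>j. j < rho \<Longrightarrow> v (P j) = enat (ap j)"
  shows "v (\<Sum>j<rho. fps_const (C j) * P j) = \<infinity> \<and> (\<forall>j<rho. C j = 0) \<or>
    (\<exists>j<rho. \<exists>k. v (\<Sum>j<rho. fps_const (C j) * P j) = enat (ap j + k * N))"
proof -
  have t: "v (fps_const (C j) * P j) = (if C j = 0 then \<infinity> else enat (ap j + subdegree (C j) * N))"
    if "j < rho" for j
    using P[OF that] by (simp add: v_mult v_const add.commute)
  have dist: "i = j" if "i < rho" "j < rho" "v (fps_const (C i) * P i) = v (fps_const (C j) * P j)"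
    "v (fps_const (C i) * P i) \<noteq> \<infinity>" for i j
  proof -
    from that t have "ap i + subdegree (C i) * N = ap j + subdegree (C j) * N"
      by (auto split: if_splits)
    then have "ap i mod N = ap j mod N" by (metis mod_mult_self1)
    with ap_mod_inj that show ?thesis by blast
  qed
  from v_sum_distinct[of "{..<rho}" "\<lambda>j. fps_const (C j) * P j"] dist
  have "v (\<Sum>j<rho. fps_const (C j) * P j) = \<infinity> \<and> (\<forall>i\<in>{..<rho}. v (fps_const (C i) * P i) = \<infinity>) \<or>
    (\<exists>i\<in>{..<rho}. v (\<Sum>j<rho. fps_const (C j) * P j) = v (fps_const (C i) * P i) \<and> v (fps_const (C i) * P i) \<noteq> \<infinity>)"
    by blast
  then show ?thesis
  proof (elim disjE conjE bexE)
    assume "\<forall>i\<in>{..<rho}. v (fps_const (C i) * P i) = \<infinity>" "v (\<Sum>j<rho. fps_const (C j) * P j) = \<infinity>"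
    then show ?thesis using t by (simp split: if_splits)
  next
    fix i assume "i \<in> {..<rho}" "v (\<Sum>j<rho. fps_const (C j) * P j) = v (fps_const (C i) * P i)"
      "v (fps_const (C i) * P i) \<noteq> \<infinity>"
    then show ?thesis using t[of i] by (auto split: if_splits)
  qed
qed

text \<open>A series of infinite value has zero remainder on division by u, so u generates the
  kernel. The irreducible g lies in it and is therefore associated to u.\<close>

lemma v_inf_iff_rho: "(v h = \<infinity> \<longleftrightarrow> g dvd h) \<and> yord g = rho"
proof -
  obtain P u where "apery_basis P u" using apery_basis_exists by blast
  then have P: "\<And>j. j < rho \<Longrightarrow> v (P j) = enat (ap j)"
    and u: "v u = \<infinity>" "at_x0 u \<noteq> 0" "yord u = rho"
    and dec: "\<And>h. \<exists>C \<kappa>. h = (\<Sum>j<rho. fps_const (C j) * P j) + \<kappa> * u"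
    unfolding apery_basis_def by auto
  have mult: "u dvd h" if "v h = \<infinity>" for h
  proof -
    obtain C \<kappa> where h: "h = (\<Sum>j<rho. fps_const (C j) * P j) + \<kappa> * u" using dec by blast
    have "v (\<kappa> * u) = \<infinity>" using u by (simp add: v_mult)
    then have "v (\<Sum>j<rho. fps_const (C j) * P j) = \<infinity>"
      using h that v_add_inf by metis
    with v_apery_sum[OF P, where C = C] have "\<forall>j<rho. C j = 0" by auto
    then have "h = \<kappa> * u" using h by simp
    then show ?thesis by simp
  qed
  from mult[OF v_g] obtain \<kappa> where \<kappa>: "g = u * \<kappa>" by (elim dvdE)
  have "\<not> u dvd 1" using v_unit[of u] u by auto
  with irr \<kappa> have "\<kappa> dvd 1" using irreducibleD by blast
  then obtain \<kappa>' where "1 = \<kappa> * \<kappa>'" by (elim dvdE)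
  then have "u = g * \<kappa>'" by (simp add: \<kappa> mult.assoc flip: \<open>1 = \<kappa> * \<kappa>'\<close>)
  then have "g dvd u" by simp
  moreover have "v h = \<infinity>" if "g dvd h" using that v_g by (elim dvdE) (simp add: v_mult)
  moreover have "yord g = rho"
    using \<kappa> u \<open>\<kappa> dvd 1\<close> unfolding unit_iff_yord by simp
  ultimately show ?thesis using mult dvd_trans by blast
qed

lemma v_inf_iff: "v h = \<infinity> \<longleftrightarrow> g dvd h"
  and yord_g: "yord g = rho"
  using v_inf_iff_rho by auto

lemma rho_pos: "0 < rho"
  using irr at_x0_g irreducible_not_unit[of g] unit_iff_yord[of g] yord_g by fastforce

lemma S_eq: "S = (\<Union>j<rho. range (\<lambda>k. ap j + k * N))"
proof (intro equalityI subsetI)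
  fix s assume "s \<in> S"
  then obtain h where h: "v h = enat s" by (auto simp: S_def)
  obtain P u where "apery_basis P u" using apery_basis_exists by blast
  then have P: "\<And>j. j < rho \<Longrightarrow> v (P j) = enat (ap j)"
    and u: "v u = \<infinity>" "at_x0 u \<noteq> 0" "yord u = rho"
    and dec: "\<And>h. \<exists>C \<kappa>. h = (\<Sum>j<rho. fps_const (C j) * P j) + \<kappa> * u"
    unfolding apery_basis_def by auto
  obtain C \<kappa> where "h = (\<Sum>j<rho. fps_const (C j) * P j) + \<kappa> * u" using dec by blast
  moreover have "v (\<kappa> * u) = \<infinity>" using u by (simp add: v_mult)
  ultimately have "v (\<Sum>j<rho. fps_const (C j) * P j) = enat s" using h v_add_inf by metis
  with v_apery_sum[OF P, where C = C] show "s \<in> (\<Union>j<rho. range (\<lambda>k. ap j + k * N))" by auto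
next
  fix s assume "s \<in> (\<Union>j<rho. range (\<lambda>k. ap j + k * N))"
  then obtain j k where "j < rho" "s = ap j + k * N" by blast
  moreover from this obtain q where "v q = enat (ap j)" using ap_attained by blast
  ultimately have "v (xx ^ k * q) = enat s" by (simp add: v_mult v_x_power add.commute)
  then show "s \<in> S" by (rule S_I)
qed

section \<open>Intersection numbers as gap counts\<close>

lemma S_minus_eq: "S - (+) N ` S = ap ` {..<rho}"
proof (intro equalityI subsetI)
  fix s assume s: "s \<in> S - (+) N ` S"
  then obtain j k where jk: "j < rho" "s = ap j + k * N" by (auto simp: S_eq)
  have "k = 0"
  proof (rule ccontr)
    assume "k \<noteq> 0"
    then have "s = N + (ap j + (k - 1) * N)" using jk by (cases k) auto
    moreover have "ap j + (k - 1) * N \<in> S" using jk by (auto simp: S_eq)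
    ultimately show False using s by blast
  qed
  with jk show "s \<in> ap ` {..<rho}" by auto
next
  fix s assume "s \<in> ap ` {..<rho}"
  then obtain j where j: "j < rho" "s = ap j" by auto
  have "s \<in> S" using j by (auto simp: S_eq intro!: bexI[of _ j] rev_image_eqI[of 0])
  moreover have "s \<notin> (+) N ` S"
  proof
    assume "s \<in> (+) N ` S"
    then obtain i k where i: "i < rho" "s = N + (ap i + k * N)" by (auto simp: S_eq)
    then have "s mod N = ap i mod N" by simp
    then have "i = j" using ap_mod_inj i j by metis
    with i j N_pos show False by simp
  qed
  ultimately show "s \<in> S - (+) N ` S" by blast
qed

lemma card_S_minus_N: "card (S - (+) N ` S) = rho"
proof -
  have "inj_on ap {..<rho}" by (rule inj_onI) (simp add: ap_mod_inj)
  then show ?thesis by (simp add: S_minus_eq card_image)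
qed

text \<open>One series is taken for each value in S outside m + S. A leading value in m + S is
  cancelled by a multiple of f, any other one by a basis element, and a remainder of large value is
  a multiple of f modulo g.\<close>

lemma quotient_basis_exists:
  assumes f: "v f = enat m"
  shows "\<exists>B. quotient_basis (ideal2 g f) B \<and> card B = card (S - (+) m ` S)"
proof -
  define D where "D = S - (+) m ` S"
  have finD: "finite D"
    unfolding D_def using card_diff_translate(1)[OF S_add S_0 S_I[OF f] S_N N_pos finite_S_minus] .
  have "\<exists>q. v q = enat s" if "s \<in> D" for s using that by (auto simp: D_def S_def)
  then obtain E where E: "\<And>s. s \<in> D \<Longrightarrow> v (E s) = enat s" by metis
  have injE: "inj_on E D" by (intro inj_onI) (metis E enat.inject)
  define B where "B = E ` D"
  have I: "a * g + b * f \<in> ideal2 g f" for a b by (auto simp: ideal2_def)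
  have v_I: "v h \<in> {\<infinity>} \<union> enat ` (+) m ` S" if "h \<in> ideal2 g f" for h
  proof -
    from that obtain a b where "h = a * g + b * f" by (auto simp: ideal2_def)
    moreover have "v (a * g) = \<infinity>" by (simp add: v_mult v_g)
    ultimately have "v h = v b + enat m" by (metis add.commute f v_add_inf v_mult)
    then show ?thesis by (cases "v b") (auto intro!: imageI S_I simp: add.commute)
  qed
  have approx: "\<exists>c A. enat k \<le> v (h - (\<Sum>s\<in>D. K2 (c s) * E s) - f * A)" for h k
  proof (induction k)
    case 0
    then show ?case by (simp add: zero_enat_def[symmetric])
  next
    case (Suc k)
    then obtain c A where cA: "enat k \<le> v (h - (\<Sum>s\<in>D. K2 (c s) * E s) - f * A)" by blast
    define h' where "h' = h - (\<Sum>s\<in>D. K2 (c s) * E s) - f * A"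
    show ?case
    proof (cases "v h' = enat k")
      case False
      then have "enat (Suc k) \<le> v h'" using cA by (cases "v h'") (auto simp: h'_def)
      then show ?thesis unfolding h'_def by blast
    next
      case True
      show ?thesis
      proof (cases "k \<in> D")
        case D: True
        from v_res[OF True E[OF D]] obtain d where d: "enat k < v (h' - K2 d * E k)" by blast
        define c' where "c' = c(k := c k + d)"
        have "(\<Sum>s\<in>D - {k}. K2 (c' s) * E s) = (\<Sum>s\<in>D - {k}. K2 (c s) * E s)"
          by (intro sum.cong) (auto simp: c'_def)
        then have "(\<Sum>s\<in>D. K2 (c' s) * E s) = (\<Sum>s\<in>D. K2 (c s) * E s) + K2 d * E k"
          using D finD by (simp add: sum.remove[of D k] c'_def algebra_simps flip: fps_const_add)
        then have "h - (\<Sum>s\<in>D. K2 (c' s) * E s) - f * A = h' - K2 d * E k"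
          by (simp add: h'_def algebra_simps)
        with ileI1[OF d] have "enat (Suc k) \<le> v (h - (\<Sum>s\<in>D. K2 (c' s) * E s) - f * A)"
          by (simp add: eSuc_enat)
        then show ?thesis by blast
      next
        case nD: False
        from S_I[OF True] nD obtain s where s: "s \<in> S" "k = m + s" by (auto simp: D_def)
        then obtain q where q: "v q = enat s" by (auto simp: S_def)
        have "v (f * q) = enat k" using f q s by (simp add: v_mult)
        from v_res[OF True this] obtain d where d: "enat k < v (h' - K2 d * (f * q))" by blast
        have "h - (\<Sum>s\<in>D. K2 (c s) * E s) - f * (A + K2 d * q) = h' - K2 d * (f * q)"
          by (simp add: h'_def algebra_simps)
        with ileI1[OF d] have "enat (Suc k) \<le> v (h - (\<Sum>s\<in>D. K2 (c s) * E s) - f * (A + K2 d * q))"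
          by (simp add: eSuc_enat)
        then show ?thesis by blast
      qed
    qed
  qed
  obtain c1 where c1: "\<And>s. s \<in> S \<Longrightarrow> c1 \<le> s \<Longrightarrow> N \<le> s \<and> s - N \<in> S"
    using S_minus_N by blast
  obtain c2 where c2: "\<And>s. s \<in> D \<Longrightarrow> s < c2" using finD by (metis finite_nat_set_iff_bounded)
  have c2': "m \<le> s \<and> s - m \<in> S" if "s \<in> S" "c2 \<le> s" for s
  proof -
    have "s \<in> (+) m ` S" using c2[of s] that by (auto simp: D_def)
    then show ?thesis by auto
  qed
  have ex: "\<exists>c. h - (\<Sum>s\<in>D. K2 (c s) * E s) \<in> ideal2 g f" for h
  proof -
    obtain c A where cA: "enat (max c1 c2) \<le> v (h - (\<Sum>s\<in>D. K2 (c s) * E s) - f * A)"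
      using approx by blast
    from large_value_multiple[OF f _ _ cA] c1 c2' obtain z
      where "v (h - (\<Sum>s\<in>D. K2 (c s) * E s) - f * A - f * z) = \<infinity>" by auto
    then obtain b where "h - (\<Sum>s\<in>D. K2 (c s) * E s) - f * A - f * z = g * b"
      unfolding v_inf_iff by (elim dvdE)
    then have "h - (\<Sum>s\<in>D. K2 (c s) * E s) = b * g + (A + z) * f"
      by (simp add: algebra_simps)
    then have "h - (\<Sum>s\<in>D. K2 (c s) * E s) \<in> ideal2 g f" using I by metis
    then show ?thesis by blast
  qed
  have uniq: "\<forall>s\<in>D. c s = 0" if "(\<Sum>s\<in>D. K2 (c s) * E s) \<in> ideal2 g f" for c
  proof -
    have t: "v (K2 (c s) * E s) = (if c s = 0 then \<infinity> else enat s)" if "s \<in> D" for s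
      using E[OF that] by (simp add: v_mult v_K)
    have dist: "s = s'" if "s \<in> D" "s' \<in> D" "v (K2 (c s) * E s) = v (K2 (c s') * E s')"
      "v (K2 (c s) * E s) \<noteq> \<infinity>" for s s'
      using that t[of s] t[of s'] by (simp split: if_splits)
    have "(\<forall>s\<in>D. v (K2 (c s) * E s) = \<infinity>) \<or>
        (\<exists>s\<in>D. v (\<Sum>s\<in>D. K2 (c s) * E s) = v (K2 (c s) * E s) \<and> v (K2 (c s) * E s) \<noteq> \<infinity>)"
      using v_sum_distinct[of D "\<lambda>s. K2 (c s) * E s", OF finD dist] by blast
    moreover have False if "s \<in> D" "v (\<Sum>s\<in>D. K2 (c s) * E s) = v (K2 (c s) * E s)"
      "v (K2 (c s) * E s) \<noteq> \<infinity>" for s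
    proof -
      have "enat s \<in> {\<infinity>} \<union> enat ` (+) m ` S"
        using that t[of s] v_I[OF \<open>(\<Sum>s\<in>D. K2 (c s) * E s) \<in> ideal2 g f\<close>] by (auto split: if_splits)
      then show False using \<open>s \<in> D\<close> by (auto simp: D_def)
    qed
    ultimately have "\<forall>s\<in>D. v (K2 (c s) * E s) = \<infinity>" by blast
    then show ?thesis using t by (simp split: if_splits)
  qed
  have sumB: "(\<Sum>b\<in>B. K2 (c b) * b) = (\<Sum>s\<in>D. K2 (c (E s)) * E s)" for c
    unfolding B_def by (rule sum.reindex_cong[OF injE]) auto
  have "quotient_basis (ideal2 g f) B"
    unfolding quotient_basis_def
  proof (intro conjI allI)
    show "finite B" using finD by (simp add: B_def)
    fix h
    obtain c where c: "h - (\<Sum>s\<in>D. K2 (c s) * E s) \<in> ideal2 g f" using ex by blast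
    define c' where "c' = (\<lambda>b. if b \<in> B then c (inv_into D E b) else 0)"
    have c': "c' (E s) = c s" if "s \<in> D" for s
      using that injE by (simp add: c'_def B_def)
    show "\<exists>!c. (\<forall>b. b \<notin> B \<longrightarrow> c b = 0) \<and> h - (\<Sum>b\<in>B. K2 (c b) * b) \<in> ideal2 g f"
    proof (rule ex1I[of _ c'])
      have "(\<Sum>s\<in>D. K2 (c' (E s)) * E s) = (\<Sum>s\<in>D. K2 (c s) * E s)"
        by (intro sum.cong) (simp_all add: c')
      then show "(\<forall>b. b \<notin> B \<longrightarrow> c' b = 0) \<and> h - (\<Sum>b\<in>B. K2 (c' b) * b) \<in> ideal2 g f"
        using c unfolding sumB by (simp add: c'_def)
      then have c'I: "h - (\<Sum>b\<in>B. K2 (c' b) * b) \<in> ideal2 g f" ..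
      fix d assume d: "(\<forall>b. b \<notin> B \<longrightarrow> d b = 0) \<and> h - (\<Sum>b\<in>B. K2 (d b) * b) \<in> ideal2 g f"
      have "(h - (\<Sum>b\<in>B. K2 (c' b) * b)) + (-1) * (h - (\<Sum>b\<in>B. K2 (d b) * b)) \<in> ideal2 g f"
        by (rule ideal2_add[OF c'I ideal2_mult[OF conjunct2[OF d]]])
      also have "(h - (\<Sum>b\<in>B. K2 (c' b) * b)) + (-1) * (h - (\<Sum>b\<in>B. K2 (d b) * b)) =
          (\<Sum>s\<in>D. K2 (d (E s) - c' (E s)) * E s)"
        unfolding sumB by (simp add: left_diff_distrib sum_subtractf flip: fps_const_sub)
      finally have "\<forall>s\<in>D. d (E s) = c' (E s)" using uniq by force
      moreover have "d b = c' b" if "b \<notin> B" for b using d that by (simp add: c'_def)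
      ultimately have "d b = c' b" for b by (cases "b \<in> B") (auto simp: B_def)
      then show "d = c'" by blast
    qed
  qed
  moreover have "card B = card D" using injE by (simp add: B_def card_image)
  ultimately show ?thesis by (auto simp: D_def)
qed

text \<open>Powers of x have different finite values, whereas all of (g, f) has infinite value, so
  arbitrarily many powers of x stay independent.\<close>

lemma no_quotient_basis:
  assumes f: "v f = \<infinity>"
  shows "\<not> quotient_basis (ideal2 g f) B"
proof
  assume B: "quotient_basis (ideal2 g f) B"
  define A where "A = (\<lambda>i. xx ^ i :: 'a fps2) ` {..card B}"
  have inj: "inj (\<lambda>i. xx ^ i :: 'a fps2)"
  proof (rule injI)
    fix i j assume "xx ^ i = (xx ^ j :: 'a fps2)"
    then have "enat (i * N) = enat (j * N)" by (metis v_x_power)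
    then show "i = j" using N_pos by simp
  qed
  have v_I: "v h = \<infinity>" if "h \<in> ideal2 g f" for h
  proof -
    from that obtain a b where "h = a * g + b * f" by (auto simp: ideal2_def)
    moreover have "v (a * g) = \<infinity>" "v (b * f) = \<infinity>" by (simp_all add: v_mult v_g f)
    ultimately show ?thesis by (simp add: v_add_inf)
  qed
  have "card A \<le> card B"
  proof (rule independent_mod_card_le[OF B])
    show "finite A" by (simp add: A_def)
    fix c assume "(\<Sum>a\<in>A. K2 (c a) * a) \<in> ideal2 g f"
    then have inf: "v (\<Sum>a\<in>A. K2 (c a) * a) = \<infinity>" by (rule v_I)
    have t: "v (K2 (c (xx ^ i)) * xx ^ i) = (if c (xx ^ i) = 0 then \<infinity> else enat (i * N))" for i
      by (simp add: v_mult v_K v_x_power)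
    have dist: "a = b" if "a \<in> A" "b \<in> A" "v (K2 (c a) * a) = v (K2 (c b) * b)"
      "v (K2 (c a) * a) \<noteq> \<infinity>" for a b
    proof -
      from that obtain i j where ij: "a = xx ^ i" "b = xx ^ j" by (auto simp: A_def)
      then have "i * N = j * N" using that t[of i] t[of j] by (auto split: if_splits)
      then show ?thesis using N_pos ij by simp
    qed
    have "\<forall>a\<in>A. v (K2 (c a) * a) = \<infinity>"
    proof (rule ccontr)
      assume "\<not> (\<forall>a\<in>A. v (K2 (c a) * a) = \<infinity>)"
      with v_sum_distinct[of A "\<lambda>a. K2 (c a) * a", OF \<open>finite A\<close> dist]
      obtain a where "v (\<Sum>a\<in>A. K2 (c a) * a) = v (K2 (c a) * a)" "v (K2 (c a) * a) \<noteq> \<infinity>" by blast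
      with inf show False by simp
    qed
    then have "v (K2 (c (xx ^ i)) * xx ^ i) = \<infinity>" if "i \<le> card B" for i
      using that by (auto simp: A_def)
    then have "c (xx ^ i) = 0" if "i \<le> card B" for i
      using that t[of i] by (metis enat.distinct(1))
    then show "\<forall>a\<in>A. c a = 0" by (auto simp: A_def)
  qed (auto intro: ideal2_add ideal2_mult ideal2_0)
  moreover have "card A = Suc (card B)"
    unfolding A_def using inj by (subst card_image) (auto intro: inj_on_subset)
  ultimately show False by simp
qed

text \<open>Both y-order and intersection number are gap counts, for N and for \<open>v f\<close>.
  Keeping N in the formula accounts for arcs that trace the branch several times.\<close>

theorem intersection_number_eq: "enat N * intersection_number g f = enat (yord g) * v f"
proof (cases "v f")
  case (enat m)
  from quotient_basis_exists[OF enat] obtain B where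
    B: "quotient_basis (ideal2 g f) B" "card B = card (S - (+) m ` S)" by blast
  have "intersection_number g f = enat (card (S - (+) m ` S))"
    unfolding intersection_number_def B(2)[symmetric]
    by (rule quotient_dim_eqI[OF B(1)]) (auto intro: ideal2_add ideal2_mult ideal2_0)
  moreover have "N * card (S - (+) m ` S) = rho * m"
    using card_diff_translate(2)[OF S_add S_0 S_I[OF enat] S_N N_pos finite_S_minus]
    by (simp add: card_S_minus_N)
  ultimately show ?thesis by (simp add: enat yord_g)
next
  case infinity
  then have "intersection_number g f = \<infinity>"
    using no_quotient_basis by (simp add: intersection_number_def quotient_dim_def top_enat_def)
  then show ?thesis using infinity N_pos rho_pos yord_g
    by (simp add: zero_enat_def)
qed

end

section \<open>Arcs and blow_up-ups\<close>

text \<open>The target K[[t]] consists of series in one variable. Viewed as series constant in y it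
  turns arcs into local homomorphisms, which yields existence and uniqueness. The constant arc at
  the origin is included.\<close>

definition arc :: "('a::field fps2 \<Rightarrow> 'a fps) \<Rightarrow> bool" where
  "arc \<phi> \<longleftrightarrow> (\<forall>f g. \<phi> (f + g) = \<phi> f + \<phi> g) \<and> (\<forall>f g. \<phi> (f * g) = \<phi> f * \<phi> g) \<and>
     (\<forall>c. \<phi> (K2 c) = fps_const c) \<and> \<phi> xx $ 0 = 0 \<and> \<phi> yy $ 0 = 0"

lemma arc_add: "arc \<phi> \<Longrightarrow> \<phi> (f + g) = \<phi> f + \<phi> g"
  and arc_mult: "arc \<phi> \<Longrightarrow> \<phi> (f * g) = \<phi> f * \<phi> g"
  and arc_K: "arc \<phi> \<Longrightarrow> \<phi> (K2 c) = fps_const c"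
  and arc_x: "arc \<phi> \<Longrightarrow> \<phi> xx $ 0 = 0"
  and arc_y: "arc \<phi> \<Longrightarrow> \<phi> yy $ 0 = 0"
  by (auto simp: arc_def)

lemma arc_iff_local_hom: "arc \<phi> \<longleftrightarrow> local_hom (\<lambda>f. fps_const (\<phi> f))"
  unfolding arc_def local_hom_def vanish_1_iff by (auto simp: fps_const_mult)

lemma arc_0: "arc \<phi> \<Longrightarrow> \<phi> 0 = 0"
  using arc_K[of \<phi> 0] by simp

lemma arc_1: "arc \<phi> \<Longrightarrow> \<phi> 1 = 1"
  using arc_K[of \<phi> 1] by simp

lemma arc_diff: "arc \<phi> \<Longrightarrow> \<phi> (f - g) = \<phi> f - \<phi> g"
  using arc_add[of \<phi> "f - g" g] by simp

lemma arc_power: "arc \<phi> \<Longrightarrow> \<phi> (f ^ k) = \<phi> f ^ k"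
  by (induction k) (auto simp: arc_1 arc_mult)

lemma arc_comp: "arc \<phi> \<Longrightarrow> local_hom \<Theta> \<Longrightarrow> arc (\<lambda>f. \<phi> (\<Theta> f))"
  using local_hom_comp[of "\<lambda>f. fps_const (\<phi> f)" \<Theta>] by (simp add: arc_iff_local_hom o_def)

lemma arc_of_local_hom: "local_hom \<Theta> \<Longrightarrow> arc (\<lambda>f. \<Theta> f $ 0)"
  by (simp add: local_hom_def arc_def vanish_1_iff)

lemma arc_exists:
  assumes "a $ 0 = 0" "b $ 0 = 0"
  shows "\<exists>\<phi>. arc \<phi> \<and> \<phi> xx = a \<and> \<phi> yy = b"
proof -
  from assms have "vanish (Suc 0) (fps_const a)" "vanish (Suc 0) (fps_const b)"
    by (simp_all add: vanish_1_iff)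
  from local_hom_exists[OF this] obtain \<Theta> where "local_hom \<Theta>" "\<Theta> xx = fps_const a" "\<Theta> yy = fps_const b"
    by blast
  then show ?thesis using arc_of_local_hom by (intro exI[of _ "\<lambda>f. \<Theta> f $ 0"]) simp
qed

lemma arc_unique:
  assumes "arc \<phi>" "arc \<psi>" "\<phi> xx = \<psi> xx" "\<phi> yy = \<psi> yy"
  shows "\<phi> = \<psi>"
proof
  fix f
  have "(\<lambda>f. fps_const (\<phi> f)) = (\<lambda>f. fps_const (\<psi> f))"
    using assms by (intro local_hom_unique) (simp_all add: arc_iff_local_hom)
  then have "fps_const (\<phi> f) = fps_const (\<psi> f)" by (rule fun_cong)
  then show "\<phi> f = \<psi> f" by simp
qed

lemma fps2_expand: "f = K2 (f $ 0 $ 0) + xx * fps_const (fps_shift 1 (f $ 0)) + yy * fps_shift 1 f"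
  for f :: "'a::field fps2"
proof -
  have "fps_const (f $ 0) = K2 (f $ 0 $ 0) + xx * fps_const (fps_shift 1 (f $ 0))"
    by (subst fps_expand_0[of "f $ 0"]) (simp only: fps_const_add fps_const_mult)
  then show ?thesis by (subst fps_expand_0[of f]) simp
qed

lemma arc_nth_0: "arc \<phi> \<Longrightarrow> \<phi> f $ 0 = f $ 0 $ 0"
  by (subst fps2_expand[of f]) (simp add: arc_add arc_mult arc_K arc_x arc_y)

lemma local_hom_nth_0: "local_hom \<Theta> \<Longrightarrow> \<Theta> f $ 0 $ 0 = f $ 0 $ 0"
  using arc_nth_0[OF arc_of_local_hom] .

definition ordt :: "'a::zero fps \<Rightarrow> enat" where
  "ordt a = (if a = 0 then \<infinity> else enat (subdegree a))"

lemma ordt_0 [simp]: "ordt 0 = \<infinity>"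
  by (simp add: ordt_def)

lemma ordt_eq_infinity_iff [simp]: "ordt a = \<infinity> \<longleftrightarrow> a = 0"
  by (simp add: ordt_def)

lemma ordt_mult: "ordt (a * b) = ordt a + ordt b" for a :: "'a::field fps"
  by (simp add: ordt_def)

lemma ordt_ge_iff: "enat n \<le> ordt a \<longleftrightarrow> (\<forall>i<n. a $ i = 0)"
  by (auto simp: ordt_def intro: subdegree_geI nth_less_subdegree_zero)

lemma ordt_add: "min (ordt a) (ordt b) \<le> ordt (a + b)" for a :: "'a::field fps"
proof (cases "min (ordt a) (ordt b)")
  case (enat n)
  then have "enat n \<le> ordt a" "enat n \<le> ordt b" by (metis min.cobounded1 min.cobounded2)+
  then show ?thesis unfolding enat ordt_ge_iff by simp
next
  case infinity
  then show ?thesis by (auto simp: min_def ordt_def split: if_splits)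
qed

lemma ordt_eq_enat: "ordt a = enat s \<longleftrightarrow> a \<noteq> 0 \<and> subdegree a = s"
  by (auto simp: ordt_def)

text \<open>The scalar demanded by \<open>v_res\<close> is the quotient of the two leading
  coefficients in t.\<close>

lemma semival_arc:
  assumes "arc \<phi>" "\<phi> xx \<noteq> 0"
  shows "semival (\<lambda>f. ordt (\<phi> f)) (subdegree (\<phi> xx))"
proof
  show "ordt (\<phi> (f * h)) = ordt (\<phi> f) + ordt (\<phi> h)" for f h
    using assms by (simp add: arc_mult ordt_mult)
  show "min (ordt (\<phi> f)) (ordt (\<phi> h)) \<le> ordt (\<phi> (f + h))" for f h
    using assms by (simp add: arc_add ordt_add)
  show "ordt (\<phi> 0) = \<infinity>" using assms by (simp add: arc_0)
  show "ordt (\<phi> (K2 c)) = 0" if "c \<noteq> 0" for c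
    using assms that by (simp add: arc_K ordt_def zero_enat_def)
  show "ordt (\<phi> xx) = enat (subdegree (\<phi> xx))" using assms by (simp add: ordt_def)
  show "0 < subdegree (\<phi> xx)" using assms arc_x by (simp add: subdegree_eq_0_iff zero_less_iff_neq_zero)
  show "0 < ordt (\<phi> yy)"
    using arc_y[OF assms(1)] ileI1[of 0 "ordt (\<phi> yy)"] 
    by (auto simp: ordt_def subdegree_eq_0_iff zero_less_iff_neq_zero zero_enat_def)
  show "\<exists>c. enat s < ordt (\<phi> (f - K2 c * h))"
    if f: "ordt (\<phi> f) = enat s" and h: "ordt (\<phi> h) = enat s" for f h s
  proof -
    define c where "c = \<phi> f $ s / \<phi> h $ s"
    have nz: "\<phi> h $ s \<noteq> 0" using h by (auto simp: ordt_eq_enat)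
    have "\<phi> f $ i = 0 \<and> \<phi> h $ i = 0" if "i < s" for i
      using f h that nth_less_subdegree_zero[of i "\<phi> f"] nth_less_subdegree_zero[of i "\<phi> h"]
      by (simp add: ordt_eq_enat)
    then have "\<forall>i<Suc s. (\<phi> f - fps_const c * \<phi> h) $ i = 0"
      using nz by (simp add: less_Suc_eq c_def)
    then have "enat (Suc s) \<le> ordt (\<phi> (f - K2 c * h))"
      unfolding ordt_ge_iff using assms by (simp add: arc_diff arc_mult arc_K)
    then show ?thesis by (metis Suc_ile_eq)
  qed
qed

lemma arc_branch:
  assumes "arc \<phi>" "\<phi> xx \<noteq> 0" "irreducible g" "at_x0 g \<noteq> 0" "\<phi> g = 0"
  shows "enat (subdegree (\<phi> xx)) * intersection_number g f = enat (yord g) * ordt (\<phi> f)"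
    and "\<phi> f = 0 \<longleftrightarrow> g dvd f"
proof -
  interpret semival "\<lambda>f. ordt (\<phi> f)" "subdegree (\<phi> xx)" using assms by (intro semival_arc)
  interpret semival_branch "\<lambda>f. ordt (\<phi> f)" "subdegree (\<phi> xx)" g
    by unfold_locales (use assms in auto)
  show "enat (subdegree (\<phi> xx)) * intersection_number g f = enat (yord g) * ordt (\<phi> f)"
    by (rule intersection_number_eq)
  show "\<phi> f = 0 \<longleftrightarrow> g dvd f" using v_inf_iff[of f] by simp
qed

section \<open>Multiplicity, shears and blow-ups\<close>

lemma local_hom_vanish:
  assumes "local_hom \<Theta>" "vanish m f"
  shows "vanish m (\<Theta> f)"
proof -
  from vanish_decomposition[OF assms(2)] obtain h where h: "f = (\<Sum>j\<le>m. xx ^ (m - j) * yy ^ j * h j)" by blast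
  have "vanish m (\<Theta> xx ^ (m - j) * \<Theta> yy ^ j * \<Theta> (h j))" if "j \<le> m" for j
    using vanish_mult[OF vanish_mult[OF vanish_power[OF local_hom_x[OF assms(1)], of "m - j"]
      vanish_power[OF local_hom_y[OF assms(1)], of j]] vanish_0, of "\<Theta> (h j)"] that by simp
  then show ?thesis
    by (subst h) (auto simp: local_hom_sum[OF assms(1)] local_hom_mult[OF assms(1)] local_hom_power[OF assms(1)]
        intro!: vanish_sum)
qed

lemma fps2_order_eq_iff:
  assumes "f \<noteq> 0"
  shows "fps2_order f = m \<longleftrightarrow> vanish m f \<and> \<not> vanish (Suc m) f"
proof -
  define Q where "Q = (\<lambda>n. \<exists>i j. i + j = n \<and> f $ j $ i \<noteq> 0)"
  from assms have "\<exists>n. Q n" unfolding Q_def by (metis fps_ext fps_zero_nth)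
  then have Q: "Q (Least Q)" "\<And>n. n < Least Q \<Longrightarrow> \<not> Q n" by (auto intro: LeastI dest: not_less_Least)
  have ord: "fps2_order f = Least Q" by (simp add: fps2_order_def Q_def)
  have v: "vanish k f \<longleftrightarrow> (\<forall>n<k. \<not> Q n)" for k by (auto simp: vanish_def Q_def)
  show ?thesis
    unfolding ord v using Q by (metis less_Suc_eq linorder_neqE_nat)
qed

lemma fps2_order_vanish: "f \<noteq> 0 \<Longrightarrow> vanish (fps2_order f) f"
  using fps2_order_eq_iff by blast

lemma fps2_order_eqI: "vanish m f \<Longrightarrow> \<not> vanish (Suc m) f \<Longrightarrow> fps2_order f = m"
  by (cases "f = 0") (auto simp: fps2_order_eq_iff)

lemma vanish_imp_at_x0: "vanish m f \<Longrightarrow> i < m \<Longrightarrow> at_x0 f $ i = 0"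
  by (simp add: vanish_def)

lemma fps2_order_le_yord:
  assumes "at_x0 f \<noteq> 0"
  shows "fps2_order f \<le> yord f"
proof -
  from assms have "f \<noteq> 0" by auto
  from vanish_imp_at_x0[OF fps2_order_vanish[OF this]] assms show ?thesis by (intro subdegree_geI)
qed

definition local_subst :: "'a::field fps2 \<Rightarrow> 'a fps2 \<Rightarrow> 'a fps2 \<Rightarrow> 'a fps2" where
  "local_subst A B = (SOME \<Theta>. local_hom \<Theta> \<and> \<Theta> xx = A \<and> \<Theta> yy = B)"

lemma local_subst:
  assumes "vanish (Suc 0) A" "vanish (Suc 0) B"
  shows "local_hom (local_subst A B)" "local_subst A B xx = A" "local_subst A B yy = B"
  using someI_ex[OF local_hom_exists[OF assms]] by (simp_all add: local_subst_def)

text \<open>Restricting \<open>shear c f\<close> to x = 0 amounts to restricting f to the line x = c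
  y, so a generic c makes x = 0 transversal.\<close>

abbreviation shear :: "'a::field \<Rightarrow> 'a fps2 \<Rightarrow> 'a fps2" where
  "shear c \<equiv> local_subst (xx + K2 c * yy) yy"

text \<open>The chart of the blow-up of the origin centred at the tangent direction \<open>y = c x\<close>.\<close>

abbreviation blow_up :: "'a::field \<Rightarrow> 'a fps2 \<Rightarrow> 'a fps2" where
  "blow_up c \<equiv> local_subst xx (xx * (yy + K2 c))"

lemma local_hom_shear: "local_hom (shear c)" and shear_x: "shear c xx = xx + K2 c * yy" and shear_y: "shear c yy = yy"
  by (rule local_subst; simp add: vanish_1_iff)+

lemma local_hom_blow_up: "local_hom (blow_up c)" and blow_up_x: "blow_up c xx = xx" and blow_up_y: "blow_up c yy = xx * (yy + K2 c)"
  by (rule local_subst; simp add: vanish_1_iff)+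

lemma at_x0_local_hom:
  assumes "local_hom \<Theta>" "at_x0 (\<Theta> xx) = 0" "at_x0 (\<Theta> yy) = 0"
  shows "at_x0 (\<Theta> f) = fps_const (f $ 0 $ 0)"
  by (subst fps2_expand[of f]) (simp add: local_hom_add[OF assms(1)] local_hom_mult[OF assms(1)] local_hom_K[OF assms(1)] assms)

text \<open>On the exceptional line x = 0 the quotient G is the degree m part of g evaluated at (1,
  y + c); the higher terms of g keep a factor x.\<close>

lemma blow_up_vanish:
  assumes "vanish m g"
  shows "\<exists>G. blow_up c g = xx ^ m * G \<and>
    at_x0 G = (\<Sum>j\<le>m. fps_const (g $ j $ (m - j)) * (fps_X + fps_const c) ^ j)"
proof -
  from vanish_decomposition[OF assms] obtain h where h: "g = (\<Sum>j\<le>m. xx ^ (m - j) * yy ^ j * h j)"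
    and h0: "\<forall>j\<le>m. h j $ 0 $ 0 = g $ j $ (m - j)" by blast
  define G where "G = (\<Sum>j\<le>m. (yy + K2 c) ^ j * blow_up c (h j))"
  have "xx ^ (m - j) * (xx * (yy + K2 c)) ^ j * b = xx ^ m * ((yy + K2 c) ^ j * b)"
    if "j \<le> m" for j and b :: "'a fps2"
  proof -
    have "xx ^ m = (xx ^ (m - j) * xx ^ j :: 'a fps2)" using that by (simp flip: power_add)
    then show ?thesis by (simp add: power_mult_distrib mult.assoc)
  qed
  note eq = this
  have "blow_up c g = (\<Sum>j\<le>m. xx ^ (m - j) * (xx * (yy + K2 c)) ^ j * blow_up c (h j))"
    by (subst h) (simp only: local_hom_sum[OF local_hom_blow_up] local_hom_mult[OF local_hom_blow_up] local_hom_power[OF local_hom_blow_up] blow_up_x blow_up_y)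
  also have "\<dots> = xx ^ m * G"
    unfolding G_def sum_distrib_left by (intro sum.cong refl eq) simp
  finally have "blow_up c g = xx ^ m * G" .
  moreover have "at_x0 G = (\<Sum>j\<le>m. fps_const (g $ j $ (m - j)) * (fps_X + fps_const c) ^ j)"
    using h0 by (simp add: G_def at_x0_sum at_x0_local_hom[OF local_hom_blow_up] blow_up_x blow_up_y mult.commute)
  ultimately show ?thesis by blast
qed

text \<open>The right-hand side is the degree m part of f evaluated at (c, 1).\<close>

lemma shear_nth:
  assumes "vanish m f"
  shows "at_x0 (shear c f) $ m = (\<Sum>j\<le>m. f $ j $ (m - j) * c ^ (m - j))"
proof -
  from vanish_decomposition[OF assms] obtain h where h: "f = (\<Sum>j\<le>m. xx ^ (m - j) * yy ^ j * h j)"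
    and h0: "\<forall>j\<le>m. h j $ 0 $ 0 = f $ j $ (m - j)" by blast
  have "((fps_const c * fps_X) ^ (m - j) * fps_X ^ j * B) $ m = f $ j $ (m - j) * c ^ (m - j)"
    if "j \<le> m" "B $ 0 = f $ j $ (m - j)" for j and B :: "'a fps"
  proof -
    have "fps_X ^ m = (fps_X ^ (m - j) * fps_X ^ j :: 'a fps)" using that by (simp flip: power_add)
    then have "(fps_const c * fps_X) ^ (m - j) * fps_X ^ j * B = fps_const (c ^ (m - j)) * (fps_X ^ m * B)"
      by (simp only: power_mult_distrib mult.assoc fps_const_power)
    then show ?thesis unfolding \<open>(fps_const c * fps_X) ^ (m - j) * fps_X ^ j * B = _\<close>
      using that by (simp add: fps_X_power_mult_nth)
  qed
  note eq = this
  have "at_x0 (shear c f) = (\<Sum>j\<le>m. (fps_const c * fps_X) ^ (m - j) * fps_X ^ j * at_x0 (shear c (h j)))"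
    by (subst h) (simp add: local_hom_sum[OF local_hom_shear] local_hom_mult[OF local_hom_shear] local_hom_power[OF local_hom_shear]
        shear_x shear_y at_x0_sum)
  then have "at_x0 (shear c f) $ m =
      (\<Sum>j\<le>m. ((fps_const c * fps_X) ^ (m - j) * fps_X ^ j * at_x0 (shear c (h j))) $ m)"
    by (simp only: fps_sum_nth)
  also have "\<dots> = (\<Sum>j\<le>m. f $ j $ (m - j) * c ^ (m - j))"
    using h0 by (intro sum.cong refl eq) (simp_all add: local_hom_nth_0[OF local_hom_shear])
  finally show ?thesis .
qed

text \<open>The field is infinite: otherwise 1 plus the product of all X - a would have positive
  degree and no root.\<close>

lemma alg_closed_nonroot:
  fixes p :: "'a::alg_closed_field poly"
  assumes "p \<noteq> 0"
  shows "\<exists>c. poly p c \<noteq> 0"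
proof (rule ccontr)
  assume "\<nexists>c. poly p c \<noteq> 0"
  then have "UNIV = {c. poly p c = 0}" by blast
  then have fin: "finite (UNIV :: 'a set)" using poly_roots_finite[OF assms] by simp
  define q where "q = (\<Prod>a\<in>(UNIV :: 'a set). [:- a, 1:])"
  have "degree q = card (UNIV :: 'a set)"
    by (simp add: q_def degree_prod_eq_sum_degree)
  moreover have "0 < card (UNIV :: 'a set)" using fin by (simp add: card_gt_0_iff)
  ultimately have "degree (q + 1) > 0" by (simp add: degree_add_eq_left)
  then obtain c where "poly (q + 1) c = 0" using alg_closed_imp_poly_has_root by blast
  moreover have "poly q c = 0" unfolding q_def poly_prod using fin by (intro prod_zero) auto
  ultimately show False by simp
qed

lemma order_poly:
  fixes f :: "'a::field fps2"
  assumes "f \<noteq> 0" "fps2_order f = m"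
  shows "\<exists>p. p \<noteq> 0 \<and> (\<forall>c. at_x0 (shear c f) $ m = poly p c)"
proof -
  define p where "p = (\<Sum>j\<le>m. monom (f $ j $ (m - j)) (m - j))"
  have van: "vanish m f" "\<not> vanish (Suc m) f" using assms fps2_order_eq_iff by blast+
  then obtain i j where ij: "i + j = m" "f $ j $ i \<noteq> 0" by (auto simp: vanish_def less_Suc_eq)
  have "coeff p i = (\<Sum>j'\<le>m. if j' = j then f $ j' $ (m - j') else 0)"
    unfolding p_def coeff_sum using ij by (intro sum.cong) auto
  also have "\<dots> = f $ j $ i" using ij by (simp add: sum.delta') (metis add_diff_cancel_right' le_add2)
  finally have "p \<noteq> 0" using ij by auto
  moreover have "at_x0 (shear c f) $ m = poly p c" for c
    unfolding shear_nth[OF van(1)] p_def by (simp add: poly_sum poly_monom)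
  ultimately show ?thesis by blast
qed

lemma shear_transversal:
  assumes "f \<noteq> 0" "at_x0 (shear c f) $ fps2_order f \<noteq> 0"
  shows "at_x0 (shear c f) \<noteq> 0" "yord (shear c f) = fps2_order f" "fps2_order (shear c f) = fps2_order f"
proof -
  have v: "vanish (fps2_order f) (shear c f)"
    using assms by (intro local_hom_vanish[OF local_hom_shear] fps2_order_vanish)
  show nz: "at_x0 (shear c f) \<noteq> 0" using assms(2) by (metis fps_zero_nth)
  show "yord (shear c f) = fps2_order f"
    using assms(2) vanish_imp_at_x0[OF v] by (intro subdegreeI) auto
  have "\<not> vanish (Suc (fps2_order f)) (shear c f)"
    using vanish_imp_at_x0[of _ "shear c f" "fps2_order f"] assms(2) by blast
  then show "fps2_order (shear c f) = fps2_order f"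
    using v by (intro fps2_order_eqI)
qed

text \<open>The initial forms of f and g give two nonzero polynomials in c, and these have a common
  non-root. Common coordinates make it possible to compare a branch with an arbitrary
  competitor.\<close>

lemma shear_transversal2:
  fixes f g :: "'a::alg_closed_field fps2"
  assumes "f \<noteq> 0" "g \<noteq> 0"
  shows "\<exists>c. at_x0 (shear c f) $ fps2_order f \<noteq> 0 \<and> at_x0 (shear c g) $ fps2_order g \<noteq> 0"
proof -
  obtain p q where p: "p \<noteq> 0" "\<And>c. at_x0 (shear c f) $ fps2_order f = poly p c"
    and q: "q \<noteq> 0" "\<And>c. at_x0 (shear c g) $ fps2_order g = poly q c"
    using order_poly[OF assms(1) refl] order_poly[OF assms(2) refl] by blast
  from p(1) q(1) alg_closed_nonroot[of "p * q"] obtain c where "poly (p * q) c \<noteq> 0" by auto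
  then show ?thesis using p(2) q(2) by auto
qed

lemma arc_unit: "arc \<phi> \<Longrightarrow> f $ 0 $ 0 \<noteq> 0 \<Longrightarrow> \<phi> f \<noteq> 0"
  by (metis arc_nth_0 fps_zero_nth)

text \<open>If x went to 0, then g would go to a power of \<open>\<phi> yy\<close> times a unit,
  which is nonzero.\<close>

lemma arc_x_nonzero:
  assumes "arc \<phi>" "at_x0 g \<noteq> 0" "\<phi> g = 0" "\<phi> xx \<noteq> 0 \<or> \<phi> yy \<noteq> 0"
  shows "\<phi> xx \<noteq> 0"
proof
  assume x: "\<phi> xx = 0"
  define w where "w = fps_shift (yord g) (at_x0 g)"
  have w: "at_x0 g = fps_X ^ yord g * w" "w $ 0 \<noteq> 0"
    unfolding w_def using assms(2) by (auto intro: fps_X_power_shift simp del: at_x0_nth)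
  then have "at_x0 (g - yy ^ yord g * yser w) = 0" by simp
  then obtain z where "g - yy ^ yord g * yser w = xx * z" using at_x0_eq_0_iff by blast
  then have "\<phi> g - \<phi> yy ^ yord g * \<phi> (yser w) = \<phi> xx * \<phi> z"
    using assms(1) by (metis arc_diff arc_mult arc_power)
  then have "\<phi> yy ^ yord g * \<phi> (yser w) = 0" using x assms by simp
  moreover have "\<phi> (yser w) \<noteq> 0" using w by (intro arc_unit assms) (simp add: yser_def)
  ultimately show False using x assms by auto
qed

section \<open>Existence of nonconstant arcs on a curve\<close>

lemma X_plus_power_nth: "j \<le> m \<Longrightarrow> ((fps_X + fps_const c) ^ j) $ m = (if j = m then 1 else 0)"
  for c :: "'a::comm_ring_1"
proof (induction j arbitrary: m)
  case (Suc j)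
  then have "((fps_X + fps_const c) ^ j) $ (m - 1) = (if Suc j = m then 1 else 0)"
    "((fps_X + fps_const c) ^ j) $ m = 0" by auto
  then show ?case using Suc.prems by (simp add: algebra_simps)
qed auto

definition nontrivial_zero :: "'a::field fps2 \<Rightarrow> ('a fps2 \<Rightarrow> 'a fps) \<Rightarrow> bool" where
  "nontrivial_zero g \<phi> \<longleftrightarrow> arc \<phi> \<and> (\<phi> xx \<noteq> 0 \<or> \<phi> yy \<noteq> 0) \<and> \<phi> g = 0"

lemma nontrivial_zero_blow_up:
  assumes "nontrivial_zero G \<psi>" "at_x0 G \<noteq> 0" "blow_up c g = xx ^ m * G"
  shows "\<exists>\<phi>. nontrivial_zero g \<phi>"
proof -
  have psi: "arc \<psi>" "\<psi> G = 0" "\<psi> xx \<noteq> 0 \<or> \<psi> yy \<noteq> 0" using assms by (auto simp: nontrivial_zero_def)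
  then have "\<psi> xx \<noteq> 0" using arc_x_nonzero assms by blast
  then have "nontrivial_zero g (\<lambda>f. \<psi> (blow_up c f))"
    unfolding nontrivial_zero_def using psi arc_comp[OF _ local_hom_blow_up]
    by (simp add: blow_up_x assms(3) arc_mult)
  then show ?thesis by blast
qed

text \<open>A counterexample remains one after blowing up a tangent direction, and by induction on
  the multiplicity its multiplicity cannot drop. The infinite chain of blow-ups arising in this way
  yields an arc after all.\<close>

lemma exists_nontrivial_zero:
  fixes g :: "'a::alg_closed_field fps2"
  assumes "g \<noteq> 0" "g $ 0 $ 0 = 0"
  shows "\<exists>\<phi>. nontrivial_zero g \<phi>"
  using assms
proof (induction "fps2_order g" arbitrary: g rule: less_induct)
  case less
  define m where "m = fps2_order g"
  have "m \<noteq> 0"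
  proof
    assume "m = 0"
    with less.prems fps2_order_eq_iff[of g 0] show False by (simp add: m_def vanish_1_iff)
  qed
  \<comment> \<open>Counterexamples of multiplicity m for which x = 0 is transversal. This class is
    stable under a suitable blow-up and turns out to be empty.\<close>
  define T where "T = (\<lambda>g :: 'a fps2. fps2_order g = m \<and> at_x0 g \<noteq> 0 \<and> yord g = m \<and> \<not> (\<exists>\<phi>. nontrivial_zero g \<phi>))"
  have step: "\<exists>c G. blow_up c g = xx ^ m * G \<and> T G" if T: "T g" for g
  proof -
    from T have g: "g \<noteq> 0" "fps2_order g = m" "at_x0 g $ m \<noteq> 0"
      unfolding T_def using nth_subdegree_nonzero[of "at_x0 g"] by auto
    then have van: "vanish m g" using fps2_order_vanish by blast
    \<comment> \<open>A tangent direction: a root of the initial form at (1, y), whose degree is m >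
      0 since y^m occurs in it.\<close>
    obtain c where c: "(\<Sum>j\<le>m. g $ j $ (m - j) * c ^ j) = 0"
      using alg_closed[of m "\<lambda>j. g $ j $ (m - j)"] g \<open>m \<noteq> 0\<close> by auto
    from blow_up_vanish[OF van, of c] obtain G where G: "blow_up c g = xx ^ m * G"
      and x0G: "at_x0 G = (\<Sum>j\<le>m. fps_const (g $ j $ (m - j)) * (fps_X + fps_const c) ^ j)" by blast
    have "at_x0 G $ m = (\<Sum>j\<le>m. if j = m then g $ j $ (m - j) else 0)"
      unfolding x0G fps_sum_nth fps_mult_left_const_nth by (intro sum.cong) (auto simp: X_plus_power_nth)
    also have "\<dots> = g $ m $ 0" by simp
    finally have Gm: "at_x0 G $ m \<noteq> 0" using g by simp
    have "G $ 0 $ 0 = at_x0 G $ 0" by simp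
    also have "\<dots> = 0" using c unfolding x0G fps_sum_nth by (simp add: fps_power_zeroth)
    finally have G0: "G $ 0 $ 0 = 0" .
    from Gm have nz: "at_x0 G \<noteq> 0" by (metis fps_zero_nth)
    then have nz: "at_x0 G \<noteq> 0" "G \<noteq> 0" by auto
    have le: "fps2_order G \<le> yord G" "yord G \<le> m"
      using fps2_order_le_yord[OF nz(1)] Gm by (auto intro: subdegree_leI simp del: at_x0_nth)
    have noz: "\<not> (\<exists>\<phi>. nontrivial_zero G \<phi>)"
      using nontrivial_zero_blow_up[OF _ nz(1) G] T unfolding T_def by blast
    with less.hyps[of G] nz G0 have "\<not> fps2_order G < m" unfolding m_def by blast
    with le nz noz have "T G" by (simp add: T_def)
    with G show ?thesis by blast
  qed
  have no: "\<not> T g" for g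
  proof
    assume Tg: "T g"
    define cf where "cf = (\<lambda>g. SOME c. \<exists>G. blow_up c g = xx ^ m * G \<and> T G)"
    define Gf where "Gf = (\<lambda>g. SOME G. blow_up (cf g) g = xx ^ m * G \<and> T G)"
    have cG: "blow_up (cf g) g = xx ^ m * Gf g \<and> T (Gf g)" if "T g" for g
      unfolding Gf_def by (rule someI_ex) (unfold cf_def, rule someI_ex, rule step[OF that])
    define gs where "gs = (\<lambda>i. (Gf ^^ i) g)"
    have Tgs: "T (gs i)" for i by (induction i) (use Tg cG in \<open>auto simp: gs_def\<close>)
    have gs: "blow_up (cf (gs i)) (gs i) = xx ^ m * gs (Suc i)" for i
      using cG[OF Tgs[of i]] by (simp add: gs_def)
    \<comment> \<open>If the multiplicity never drops, the centres of the blow-ups assemble to a smooth arc.\<close>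
    define B where "B = (\<lambda>k. Abs_fps (\<lambda>n. if n = 0 then 0 else cf (gs (k + n - 1))))"
    have B: "B k = fps_X * (B (Suc k) + fps_const (cf (gs k)))" for k
    proof (rule fps_ext)
      fix n
      show "B k $ n = (fps_X * (B (Suc k) + fps_const (cf (gs k)))) $ n"
        by (cases n; cases "n - 1") (simp_all add: B_def)
    qed
    have "\<exists>\<phi>. arc \<phi> \<and> \<phi> xx = fps_X \<and> \<phi> yy = B k" for k
      by (rule arc_exists) (simp_all add: B_def)
    then have "\<forall>k. \<exists>\<phi>. arc \<phi> \<and> \<phi> xx = fps_X \<and> \<phi> yy = B k" ..
    from choice[OF this] obtain \<phi> where "\<forall>k. arc (\<phi> k) \<and> \<phi> k xx = fps_X \<and> \<phi> k yy = B k" ..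
    then have \<phi>: "\<And>k. arc (\<phi> k)" "\<And>k. \<phi> k xx = fps_X" "\<And>k. \<phi> k yy = B k" by auto
    have eq: "\<phi> k = (\<lambda>f. \<phi> (Suc k) (blow_up (cf (gs k)) f))" for k
    proof (rule arc_unique[OF \<phi>(1) arc_comp[OF \<phi>(1) local_hom_blow_up]])
      show "\<phi> k xx = \<phi> (Suc k) (blow_up (cf (gs k)) xx)" by (simp add: blow_up_x \<phi>)
      show "\<phi> k yy = \<phi> (Suc k) (blow_up (cf (gs k)) yy)"
        by (simp add: blow_up_y \<phi> arc_mult[OF \<phi>(1)] arc_add[OF \<phi>(1)] arc_K[OF \<phi>(1)] flip: B)
    qed
    have rec: "\<phi> k (gs k) = fps_X ^ m * \<phi> (Suc k) (gs (Suc k))" for k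
      using fun_cong[OF eq[of k], of "gs k"] gs[of k]
      by (simp add: arc_mult[OF \<phi>(1)] arc_power[OF \<phi>(1)] \<phi>)
    \<comment> \<open>Every application of \<open>rec\<close> pulls out t^m with m > 0, so the
      coefficient at i reduces to one of smaller index at stage k + 1.\<close>
    have "\<phi> k (gs k) $ i = 0" for k i
    proof (induction i arbitrary: k rule: less_induct)
      case (less i)
      then show ?case by (subst rec) (use \<open>m \<noteq> 0\<close> in \<open>simp add: fps_X_power_mult_nth\<close>)
    qed
    then have "\<phi> 0 (gs 0) = 0" by (simp add: fps_eq_iff)
    then have "nontrivial_zero g (\<phi> 0)" using \<phi> by (simp add: nontrivial_zero_def gs_def)
    with Tg show False unfolding T_def by blast
  qed
  from shear_transversal2[OF less.prems(1) less.prems(1)] obtain c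
    where "at_x0 (shear c g) $ fps2_order g \<noteq> 0" by blast
  from shear_transversal[OF less.prems(1) this] no[of "shear c g"] obtain \<psi>
    where \<psi>: "arc \<psi>" "\<psi> xx \<noteq> 0 \<or> \<psi> yy \<noteq> 0" "\<psi> (shear c g) = 0"
    unfolding T_def m_def nontrivial_zero_def by blast
  have "nontrivial_zero g (\<lambda>f. \<psi> (shear c f))"
    unfolding nontrivial_zero_def using \<psi> arc_comp[OF \<psi>(1) local_hom_shear]
    by (auto simp: shear_x shear_y arc_add[OF \<psi>(1)] arc_mult[OF \<psi>(1)])
  then show ?case by blast
qed

lemma exists_arc_zero:
  fixes g :: "'a::alg_closed_field fps2"
  assumes "at_x0 g \<noteq> 0" "g $ 0 $ 0 = 0"
  shows "\<exists>\<phi>. arc \<phi> \<and> \<phi> xx \<noteq> 0 \<and> \<phi> g = 0"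
proof -
  from assms have "g \<noteq> 0" by auto
  from exists_nontrivial_zero[OF this assms(2)] arc_x_nonzero[OF _ assms(1)]
  show ?thesis unfolding nontrivial_zero_def by blast
qed

section \<open>The ultrametric inequality\<close>

lemma enat_mult_cancel_le: "0 < M \<Longrightarrow> enat M * a \<le> enat M * b \<longleftrightarrow> a \<le> b"
  by (cases a; cases b) (auto simp: zero_enat_def)

lemma enat_mult_cancel_eq: "0 < M \<Longrightarrow> enat M * a = enat M * b \<longleftrightarrow> a = b"
  by (cases a; cases b) (auto simp: zero_enat_def)

lemma enat_mult_min: "enat M * min a b = min (enat M * a) (enat M * b)"
  by (cases "M = 0"; cases a; cases b) (auto simp: min_def zero_enat_def)

text \<open>As \<open>enat\<close> has no division, proportionality is stated crosswise and positive
  finite factors are cancelled. This passes the axioms from the order along an arc to the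
  intersection number, where the choice of the arc has disappeared.\<close>

lemma semival_scale:
  assumes w: "semival w M" and n: "0 < n" and k: "0 < k"
    and I: "\<And>f. enat k * I f = enat n * w f" and x: "k * N = n * M"
  shows "semival I N"
proof -
  interpret w: semival w M by (rule w)
  show ?thesis
  proof
    fix f h
    have "enat k * I (f * h) = enat k * (I f + I h)"
      unfolding I w.v_mult distrib_left by (simp add: I)
    then show "I (f * h) = I f + I h" using enat_mult_cancel_eq[OF k] by blast
    have "enat k * min (I f) (I h) \<le> enat k * I (f + h)"
      unfolding enat_mult_min I unfolding enat_mult_min[symmetric] enat_mult_cancel_le[OF n]
      by (rule w.v_add)
    then show "min (I f) (I h) \<le> I (f + h)" using enat_mult_cancel_le[OF k] by blast
  next
    have "enat k * I 0 = \<infinity>" using n by (simp add: I zero_enat_def)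
    then show "I 0 = \<infinity>" by (cases "I 0") auto
  next
    fix c :: 'a assume "c \<noteq> 0"
    then have "enat k * I (K2 c) = enat k * 0" by (simp add: I w.v_K)
    then show "I (K2 c) = 0" using enat_mult_cancel_eq[OF k] by blast
  next
    have "enat k * I xx = enat k * enat N" by (simp add: I w.v_x x)
    then show "I xx = enat N" using enat_mult_cancel_eq[OF k] by blast
  next
    show "0 < N" using x n k w.N_pos by (metis mult_is_0 neq0_conv)
  next
    have "\<not> enat n * w yy \<le> enat n * 0" unfolding enat_mult_cancel_le[OF n] using w.v_y by simp
    then have "\<not> enat k * I yy \<le> enat k * 0" by (simp add: I)
    then show "0 < I yy" unfolding enat_mult_cancel_le[OF k] by simp
  next
    fix f h s assume f: "I f = enat s" and h: "I h = enat s"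
    have "enat n * w f = enat n * w h" using I[of f] I[of h] f h by simp
    then have eq: "w f = w h" using enat_mult_cancel_eq[OF n] by blast
    have "w f \<noteq> \<infinity>"
    proof
      assume "w f = \<infinity>"
      then have "enat k * I f = \<infinity>" using I[of f] n by (simp add: zero_enat_def)
      with f show False by simp
    qed
    then obtain t where t: "w f = enat t" by (cases "w f") auto
    from w.v_res[OF t] t eq obtain c where "enat t < w (f - K2 c * h)" by auto
    then have "\<not> enat n * w (f - K2 c * h) \<le> enat n * w f"
      unfolding enat_mult_cancel_le[OF n] using t by simp
    then have "\<not> enat k * I (f - K2 c * h) \<le> enat k * I f" by (simp add: I)
    then have "I f < I (f - K2 c * h)" unfolding enat_mult_cancel_le[OF k] by simp
    then show "\<exists>c. enat s < I (f - K2 c * h)" using f by metis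
  qed
qed

lemma yord_pos: "irreducible g \<Longrightarrow> at_x0 g \<noteq> 0 \<Longrightarrow> 0 < yord g"
  using irreducible_not_unit[of g] unit_iff_yord[of g] by fastforce

lemma semival_branch_intersection:
  fixes g :: "'a::alg_closed_field fps2"
  assumes g: "irreducible g" "at_x0 g \<noteq> 0"
  shows "semival_branch (intersection_number g) (yord g) g"
proof -
  from exists_arc_zero[OF g(2) irreducible_not_unit2[OF g(1)]] obtain \<phi>
    where \<phi>: "arc \<phi>" "\<phi> xx \<noteq> 0" "\<phi> g = 0" by blast
  have M: "0 < subdegree (\<phi> xx)"
    using \<phi> arc_x[OF \<phi>(1)] by (simp add: subdegree_eq_0_iff zero_less_iff_neq_zero)
  note I = arc_branch(1)[OF \<phi>(1,2) g \<phi>(3)]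
  have "semival (intersection_number g) (yord g)"
    by (rule semival_scale[OF semival_arc[OF \<phi>(1,2)] yord_pos[OF g] M I]) simp
  moreover have "enat (subdegree (\<phi> xx)) * intersection_number g g = \<infinity>"
    using I[of g] \<phi>(3) yord_pos[OF g] by (simp add: zero_enat_def)
  then have "intersection_number g g = \<infinity>" by (cases "intersection_number g g") auto
  ultimately show ?thesis
    unfolding semival_branch_def semival_branch_axioms_def using g by blast
qed

text \<open>The substitution \<open>x = a(t)\<close>; the result is a series over \<open>K[[t]]\<close>, where \<open>t\<close> is again called \<open>x\<close>.\<close>

abbreviation base_change :: "'a::field fps \<Rightarrow> 'a fps2 \<Rightarrow> 'a fps2" where
  "base_change a \<equiv> local_subst (fps_const a) yy"

section \<open>Base change and splitting into linear factors\<close>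

lemma base_change:
  assumes "a $ 0 = 0"
  shows "local_hom (base_change a)" "base_change a xx = fps_const a" "base_change a yy = yy"
  by (rule local_subst; use assms in \<open>simp add: vanish_1_iff\<close>)+

lemma at_x0_base_change:
  assumes "a $ 0 = 0"
  shows "at_x0 (base_change a f) = at_x0 f"
proof -
  have "arc (at_x0 :: 'a fps2 \<Rightarrow> 'a fps)" by (simp add: arc_def)
  then have "(\<lambda>f. at_x0 (base_change a f)) = at_x0"
  proof (intro arc_unique[OF arc_comp[OF _ base_change(1)[OF assms]]])
    show "at_x0 (base_change a xx) = at_x0 xx" using assms by (simp add: base_change fps_eq_iff)
  qed (simp_all add: base_change[OF assms])
  then show ?thesis by (rule fun_cong)
qed

lemma local_hom_const_nth: "local_hom (\<lambda>f. fps_const (f $ 0))"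
  by (simp add: local_hom_def vanish_1_iff fps_const_mult)

lemma arc_const:
  assumes "arc \<psi>" "\<psi> xx = fps_X"
  shows "\<psi> (fps_const C) = C"
proof -
  have "arc (\<lambda>f :: 'a fps2. f $ 0)" by (simp add: arc_def)
  then have "(\<lambda>f. \<psi> (fps_const (f $ 0))) = (\<lambda>f. f $ 0)"
    using assms by (intro arc_unique[OF arc_comp[OF assms(1) local_hom_const_nth]]) (simp_all add: arc_0)
  from fun_cong[OF this, of "fps_const C"] show ?thesis by simp
qed

text \<open>Setting y = 0 commutes with the base change, because both composites agree on x and
  y.\<close>

lemma base_change_const:
  assumes "a $ 0 = 0"
  shows "base_change a (fps_const C) = fps_const (base_change a (fps_const C) $ 0)"
proof -
  note comm = local_hom_unique[OF local_hom_comp[OF base_change(1)[OF assms] local_hom_const_nth] local_hom_comp[OF local_hom_const_nth base_change(1)[OF assms]]]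
  have "base_change a \<circ> (\<lambda>f. fps_const (f $ 0)) = (\<lambda>f. fps_const (f $ 0)) \<circ> base_change a"
    by (rule comm) (simp_all add: base_change[OF assms] local_hom_0[OF base_change(1)[OF assms]])
  from fun_cong[OF this, of "fps_const C"] show ?thesis by simp
qed

lemma base_change_const_nonzero:
  assumes "a $ 0 = 0" "a \<noteq> 0" "C \<noteq> 0"
  shows "base_change a (fps_const C) $ 0 \<noteq> 0"
proof -
  define w where "w = fps_shift (subdegree C) C"
  have w: "C = fps_X ^ subdegree C * w" "w $ 0 \<noteq> 0"
    unfolding w_def using assms(3) by (auto intro: fps_X_power_shift)
  have "base_change a (fps_const w) $ 0 $ 0 \<noteq> 0" using w by (simp add: local_hom_nth_0[OF base_change(1)[OF assms(1)]])
  then have "base_change a (fps_const w) \<noteq> 0" by auto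
  moreover have "base_change a (fps_const C) = fps_const a ^ subdegree C * base_change a (fps_const w)"
    by (subst w(1), simp only: fps_const_mult[symmetric] fps_const_power[symmetric]
        local_hom_mult[OF base_change(1)[OF assms(1)]] local_hom_power[OF base_change(1)[OF assms(1)]] base_change[OF assms(1)])
  ultimately have "base_change a (fps_const C) \<noteq> 0" using assms(2) by simp
  then show ?thesis using base_change_const[OF assms(1), of C] by auto
qed

lemma base_change_comp:
  assumes "a $ 0 = 0" "b $ 0 = 0"
  shows "base_change b (base_change a f) = base_change (base_change b (fps_const a) $ 0) f"
proof -
  define c where "c = base_change b (fps_const a) $ 0"
  have c: "base_change b (fps_const a) = fps_const c" unfolding c_def by (rule base_change_const[OF assms(2)])
  have "c $ 0 = 0" using assms by (simp add: c_def local_hom_nth_0[OF base_change(1)[OF assms(2)]])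
  then have "base_change b \<circ> base_change a = base_change c"
    using assms c by (intro local_hom_unique[OF local_hom_comp[OF base_change(1) base_change(1)] base_change(1)]) (simp_all add: base_change)
  from fun_cong[OF this, of f] show ?thesis by (simp add: c_def)
qed

text \<open>The list contains the roots y = \<alpha>(t) of f after x = a(t), with multiplicity, so
  that inseparable equations are covered; U is a unit.\<close>

definition splits :: "'a::field fps \<Rightarrow> 'a fps2 \<Rightarrow> 'a fps list \<Rightarrow> bool" where
  "splits a f as \<longleftrightarrow> (\<forall>\<alpha>\<in>set as. \<alpha> $ 0 = 0) \<and>
     (\<exists>U. U $ 0 $ 0 \<noteq> 0 \<and> base_change a f = U * prod_list (map (\<lambda>\<alpha>. yy - fps_const \<alpha>) as))"

lemma splits_base_change:
  assumes "a $ 0 = 0" "b $ 0 = 0" "splits a f as"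
  shows "splits (base_change b (fps_const a) $ 0) f (map (\<lambda>\<alpha>. base_change b (fps_const \<alpha>) $ 0) as)"
proof -
  note l = base_change(1)[OF assms(2)]
  from assms(3) obtain U where U: "U $ 0 $ 0 \<noteq> 0" "base_change a f = U * prod_list (map (\<lambda>\<alpha>. yy - fps_const \<alpha>) as)"
    by (auto simp: splits_def)
  have p: "base_change b (prod_list (map (\<lambda>\<alpha>. yy - fps_const \<alpha>) as)) =
      prod_list (map (\<lambda>\<alpha>. yy - fps_const (base_change b (fps_const \<alpha>) $ 0)) as)" for as
    by (induction as) (simp_all add: local_hom_1[OF l] local_hom_mult[OF l] local_hom_diff[OF l] base_change[OF assms(2)] base_change_const[OF assms(2), symmetric])
  have "base_change (base_change b (fps_const a) $ 0) f = base_change b U * prod_list (map (\<lambda>\<alpha>. yy - fps_const \<alpha>) (map (\<lambda>\<alpha>. base_change b (fps_const \<alpha>) $ 0) as))"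
    unfolding base_change_comp[OF assms(1,2), symmetric] U(2) local_hom_mult[OF l] p by (simp add: o_def)
  moreover have "base_change b U $ 0 $ 0 \<noteq> 0" using U by (simp add: local_hom_nth_0[OF l])
  moreover have "\<forall>\<alpha>\<in>set (map (\<lambda>\<alpha>. base_change b (fps_const \<alpha>) $ 0) as). \<alpha> $ 0 = 0"
    using assms(3) by (simp add: splits_def local_hom_nth_0[OF l])
  ultimately show ?thesis unfolding splits_def by blast
qed

text \<open>Let an arc (a1, b1) kill f. After x = a1, division by y - b1 leaves a remainder in
  K[[t]], and the arc x = t, y = b1 shows it to be 0. The cofactor has smaller y-order and splits
  after a further base change, under which y - b1 remains linear.\<close>

lemma splits_exists:
  fixes f :: "'a::alg_closed_field fps2"
  assumes "at_x0 f \<noteq> 0"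
  shows "\<exists>a as. a $ 0 = 0 \<and> a \<noteq> 0 \<and> splits a f as"
  using assms
proof (induction "yord f" arbitrary: f)
  case 0
  then have "f $ 0 $ 0 \<noteq> 0" using unit_iff_yord[of f] fps2_unit_iff[of f] by auto
  then have "splits fps_X f []"
    unfolding splits_def by (auto simp: local_hom_nth_0[OF base_change(1)] intro!: exI[of _ "base_change fps_X f"])
  then show ?case by (intro exI[of _ fps_X]) auto
next
  case (Suc n)
  then have "f $ 0 $ 0 = 0" using unit_iff_yord[of f] fps2_unit_iff[of f] by auto
  from exists_arc_zero[OF Suc.prems this] obtain \<phi> where \<phi>: "arc \<phi>" "\<phi> xx \<noteq> 0" "\<phi> f = 0" by blast
  define a1 where "a1 = \<phi> xx"
  define b1 where "b1 = \<phi> yy"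
  have ab0: "a1 $ 0 = 0" "b1 $ 0 = 0" using \<phi> by (simp_all add: a1_def b1_def arc_x arc_y)
  obtain \<psi> where \<psi>: "arc \<psi>" "\<psi> xx = fps_X" "\<psi> yy = b1" using arc_exists[of fps_X b1] ab0 by auto
  have "(\<lambda>f. \<psi> (base_change a1 f)) = \<phi>"
    using \<psi> \<phi> ab0
    by (intro arc_unique[OF arc_comp[OF \<psi>(1) base_change(1)] \<phi>(1)]) (simp_all add: base_change arc_const a1_def b1_def)
  from fun_cong[OF this, of f] have z: "\<psi> (base_change a1 f) = 0" using \<phi> by simp
  define u where "u = yy - fps_const b1"
  have x0u: "at_x0 u = fps_X" using ab0 by (simp add: u_def fps_eq_iff)
  have "\<exists>C \<kappa>. base_change a1 f = (\<Sum>j<Suc 0. fps_const (C j) * (\<lambda>_. 1) j) + \<kappa> * u"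
    by (rule weierstrass_division[of "Suc 0" "\<lambda>_. 1" u "base_change a1 f"]) (simp_all add: x0u)
  then obtain C \<kappa> where C\<kappa>: "base_change a1 f = fps_const C + \<kappa> * u" by auto
  have "\<psi> (base_change a1 f) = C"
    unfolding C\<kappa> using \<psi> by (simp add: u_def arc_add arc_mult arc_diff arc_const)
  with z C\<kappa> have F: "base_change a1 f = \<kappa> * u" by simp
  then have x0F: "at_x0 f = at_x0 \<kappa> * fps_X" using at_x0_base_change[OF ab0(1), of f] x0u by simp
  with Suc.prems have at_x0\<kappa>: "at_x0 \<kappa> \<noteq> 0" by auto
  with x0F have "yord f = Suc (yord \<kappa>)" by simp
  with Suc.hyps(2) have "n = yord \<kappa>" by simp
  from Suc.hyps(1)[OF this at_x0\<kappa>] obtain a2 as where a2: "a2 $ 0 = 0" "a2 \<noteq> 0" "splits a2 \<kappa> as"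
    by blast
  note l = base_change(1)[OF a2(1)]
  define a where "a = base_change a2 (fps_const a1) $ 0"
  define \<beta> where "\<beta> = base_change a2 (fps_const b1) $ 0"
  have "a $ 0 = 0" "\<beta> $ 0 = 0" using ab0 by (simp_all add: a_def \<beta>_def local_hom_nth_0[OF l])
  have "a \<noteq> 0" unfolding a_def using a2 \<phi> by (intro base_change_const_nonzero) (simp_all add: a1_def)
  from a2(3) obtain U where U: "U $ 0 $ 0 \<noteq> 0" "base_change a2 \<kappa> = U * prod_list (map (\<lambda>\<alpha>. yy - fps_const \<alpha>) as)"
    by (auto simp: splits_def)
  have "base_change a f = base_change a2 (base_change a1 f)" unfolding a_def by (rule base_change_comp[OF ab0(1) a2(1), symmetric])
  also have "\<dots> = base_change a2 \<kappa> * (yy - fps_const \<beta>)"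
    unfolding F u_def local_hom_mult[OF l] local_hom_diff[OF l] \<beta>_def base_change_const[OF a2(1), symmetric] base_change(3)[OF a2(1)] ..
  also have "\<dots> = U * prod_list (map (\<lambda>\<alpha>. yy - fps_const \<alpha>) (\<beta> # as))"
    unfolding U by (simp add: mult.assoc mult.commute)
  finally have "splits a f (\<beta> # as)"
    unfolding splits_def using U(1) a2(3) \<open>\<beta> $ 0 = 0\<close> by (auto simp: splits_def)
  with \<open>a $ 0 = 0\<close> \<open>a \<noteq> 0\<close> show ?case by blast
qed

lemma splits_exists_list:
  fixes fs :: "'a::alg_closed_field fps2 list"
  assumes "\<forall>f\<in>set fs. at_x0 f \<noteq> 0"
  shows "\<exists>a. a $ 0 = 0 \<and> a \<noteq> 0 \<and> (\<forall>f\<in>set fs. \<exists>as. splits a f as)"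
  using assms
proof (induction fs)
  case Nil
  show ?case by (intro exI[of _ fps_X]) simp
next
  case (Cons f fs)
  then obtain a where a: "a $ 0 = 0" "a \<noteq> 0" "\<forall>f\<in>set fs. \<exists>as. splits a f as" by auto
  have "at_x0 (base_change a f) \<noteq> 0" using Cons.prems a by (simp add: at_x0_base_change)
  from splits_exists[OF this] obtain b bs where b: "b $ 0 = 0" "b \<noteq> 0" "splits b (base_change a f) bs" by blast
  define c where "c = base_change b (fps_const a) $ 0"
  have "splits c f bs" using b(3) unfolding splits_def c_def base_change_comp[OF a(1) b(1)] .
  moreover have "\<forall>f\<in>set fs. \<exists>as. splits c f as"
    using a(3) splits_base_change[OF a(1) b(1)] unfolding c_def by blast
  moreover have "c $ 0 = 0" using a b by (simp add: c_def local_hom_nth_0[OF base_change(1)])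
  moreover have "c \<noteq> 0" unfolding c_def using a b by (intro base_change_const_nonzero)
  ultimately show ?case by auto
qed

lemma ordt_arc_splits:
  assumes "splits a f as" "arc \<psi>" "\<psi> xx = fps_X" "\<psi> yy = \<beta>"
  shows "ordt (\<psi> (base_change a f)) = (\<Sum>\<alpha>\<leftarrow>as. ordt (\<beta> - \<alpha>))"
proof -
  from assms(1) obtain U where U: "U $ 0 $ 0 \<noteq> 0" "base_change a f = U * prod_list (map (\<lambda>\<alpha>. yy - fps_const \<alpha>) as)"
    by (auto simp: splits_def)
  have "ordt (\<psi> (prod_list (map (\<lambda>\<alpha>. yy - fps_const \<alpha>) as))) = (\<Sum>\<alpha>\<leftarrow>as. ordt (\<beta> - \<alpha>))" for as
    by (induction as) (use assms in \<open>simp_all add: arc_1 arc_mult arc_diff arc_const ordt_mult\<close>,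
      simp add: ordt_def zero_enat_def)
  moreover have "\<psi> U $ 0 \<noteq> 0" using U assms by (simp add: arc_nth_0)
  then have "ordt (\<psi> U) = 0" by (auto simp: ordt_def zero_enat_def)
  ultimately show ?thesis using assms U by (simp add: arc_mult ordt_mult)
qed

text \<open>A single root \<beta> of g already gives an arc (a, \<beta>) that kills g, so the sum on
  the right is the same for every root.\<close>

lemma intersection_number_roots:
  assumes a: "a $ 0 = 0" "a \<noteq> 0" and g: "irreducible g" "at_x0 g \<noteq> 0"
    and sg: "splits a g bs" and sf: "splits a f as" and \<beta>: "\<beta> \<in> set bs"
  shows "enat (subdegree a) * intersection_number g f = enat (yord g) * (\<Sum>\<alpha>\<leftarrow>as. ordt (\<beta> - \<alpha>))"
proof -
  have "\<beta> $ 0 = 0" using sg \<beta> by (simp add: splits_def)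
  then obtain \<psi> where \<psi>: "arc \<psi>" "\<psi> xx = fps_X" "\<psi> yy = \<beta>" using arc_exists[of fps_X \<beta>] by auto
  have \<phi>: "arc (\<lambda>f. \<psi> (base_change a f))" "\<psi> (base_change a xx) = a"
    using arc_comp[OF \<psi>(1) base_change(1)[OF a(1)]] \<psi> a by (simp_all add: base_change arc_const)
  have "(\<Sum>\<alpha>\<leftarrow>bs. ordt (\<beta> - \<alpha>)) = \<infinity>"
    using \<beta> by (induction bs) auto
  then have "\<psi> (base_change a g) = 0" using ordt_arc_splits[OF sg \<psi>] by simp
  from arc_branch(1)[OF \<phi>(1) _ g this, of f] show ?thesis
    using \<phi>(2) a ordt_arc_splits[OF sf \<psi>] by simp
qed

lemma splits_nonempty:
  assumes "a $ 0 = 0" "splits a g bs" "g $ 0 $ 0 = 0"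
  shows "bs \<noteq> []"
  using assms local_hom_nth_0[OF base_change(1)[OF assms(1)], of g] by (auto simp: splits_def)

lemma ordt_minus: "ordt (a - b) = ordt (b - a)" for a :: "'a::field fps"
  by (metis minus_diff_eq ordt_def subdegree_uminus neg_equal_0_iff_equal)

lemma list_argmax:
  fixes d :: "'b \<Rightarrow> 'c::linorder"
  assumes "as \<noteq> []"
  obtains \<alpha> where "\<alpha> \<in> set as" "\<And>x. x \<in> set as \<Longrightarrow> d x \<le> d \<alpha>"
proof -
  have "Max (d ` set as) \<in> d ` set as" using assms by (intro Max_in) auto
  then obtain \<alpha> where "\<alpha> \<in> set as" "d \<alpha> = Max (d ` set as)" by auto
  then show thesis using that[of \<alpha>] by simp
qed

text \<open>Fix a root \<beta> of g. If some root \<delta> of h is at least as near to \<beta> as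
  every root of f, then every root of f is at least as near to \<delta> as to \<beta>, and (f, g) is
  bounded termwise by (f, h). Otherwise a root of f plays this role against the roots of h.\<close>

theorem intersection_number_ultrametric:
  fixes f g h :: "'a::alg_closed_field fps2"
  assumes f: "irreducible f" "at_x0 f \<noteq> 0" and g: "irreducible g" "at_x0 g \<noteq> 0"
    and h: "irreducible h" "at_x0 h \<noteq> 0"
  shows "min (enat (yord h) * intersection_number f g) (enat (yord f) * intersection_number g h)
    \<le> enat (yord g) * intersection_number f h"
proof -
  obtain a where a: "a $ 0 = 0" "a \<noteq> 0" "\<forall>f\<in>set [f, g, h]. \<exists>as. splits a f as"
    using splits_exists_list[of "[f, g, h]"] assms by auto
  then obtain as bs ds where s: "splits a f as" "splits a g bs" "splits a h ds" by auto
  have A: "0 < subdegree a" using a by (simp add: subdegree_eq_0_iff zero_less_iff_neq_zero)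
  have ne: "as \<noteq> []" "bs \<noteq> []" "ds \<noteq> []"
    using s splits_nonempty[OF a(1)] irreducible_not_unit2 assms by blast+
  then obtain \<beta> where \<beta>: "\<beta> \<in> set bs" by (meson list.set_sel(1))
  obtain \<alpha> where \<alpha>: "\<alpha> \<in> set as" "\<And>x. x \<in> set as \<Longrightarrow> ordt (\<beta> - x) \<le> ordt (\<beta> - \<alpha>)"
    using list_argmax[OF ne(1), of "\<lambda>x. ordt (\<beta> - x)"] by blast
  obtain \<delta> where \<delta>: "\<delta> \<in> set ds" "\<And>x. x \<in> set ds \<Longrightarrow> ordt (\<beta> - x) \<le> ordt (\<beta> - \<delta>)"
    using list_argmax[OF ne(3), of "\<lambda>x. ordt (\<beta> - x)"] by blast
  have key: "enat (yord h) * intersection_number g f \<le> enat (yord g) * intersection_number h f"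
    if h: "irreducible h" "at_x0 h \<noteq> 0" "splits a h ds" "splits a f as" "\<delta> \<in> set ds"
      and max: "\<And>x. x \<in> set as \<Longrightarrow> ordt (\<beta> - x) \<le> ordt (\<beta> - \<delta>)" for f h as ds \<delta>
  proof -
    have "ordt (\<beta> - x) \<le> ordt (\<delta> - x)" if "x \<in> set as" for x
    proof -
      have "ordt (\<beta> - x) \<le> min (ordt (\<delta> - \<beta>)) (ordt (\<beta> - x))"
        using max[OF that] ordt_minus[of \<delta> \<beta>] by simp
      also have "\<dots> \<le> ordt (\<delta> - x)" using ordt_add[of "\<delta> - \<beta>" "\<beta> - x"] by simp
      finally show ?thesis .
    qed
    then have le: "(\<Sum>x\<leftarrow>as. ordt (\<beta> - x)) \<le> (\<Sum>x\<leftarrow>as. ordt (\<delta> - x))"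
      by (intro sum_list_mono)
    have "enat (subdegree a) * (enat (yord h) * intersection_number g f) =
        enat (yord h) * (enat (yord g) * (\<Sum>x\<leftarrow>as. ordt (\<beta> - x)))"
      unfolding intersection_number_roots[OF a(1,2) g s(2) h(4) \<beta>, symmetric] by (simp only: ac_simps)
    also have "\<dots> \<le> enat (yord h) * (enat (yord g) * (\<Sum>x\<leftarrow>as. ordt (\<delta> - x)))"
      using le by (intro mult_left_mono) auto
    also have "\<dots> = enat (subdegree a) * (enat (yord g) * intersection_number h f)"
      using intersection_number_roots[OF a(1,2) h(1,2) h(3) h(4) h(5)]
      by (metis mult.left_commute)
    finally show ?thesis using enat_mult_cancel_le[OF A] by blast
  qed
  show ?thesis
  proof (cases "ordt (\<beta> - \<alpha>) \<le> ordt (\<beta> - \<delta>)")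
    case True
    then have "ordt (\<beta> - x) \<le> ordt (\<beta> - \<delta>)" if "x \<in> set as" for x
      using \<alpha>(2)[OF that] by simp
    from key[OF h s(3,1) \<delta>(1) this] show ?thesis
      using intersection_number_commute[of f g] intersection_number_commute[of f h]
      by (simp add: min.coboundedI1)
  next
    case False
    then have "ordt (\<beta> - x) \<le> ordt (\<beta> - \<alpha>)" if "x \<in> set ds" for x
      using \<delta>(2)[OF that] by simp
    from key[OF f s(1,3) \<alpha>(1) this] show ?thesis
      by (simp add: min.coboundedI2)
  qed
qed

section \<open>Combinatorics of Apery sequences\<close>

lemma nat_span_0: "nat_span v 0 = {0}"
  by (auto simp: nat_span_def)

lemma nat_span_Suc: "nat_span v (Suc k) = {y + c * v k |y c. y \<in> nat_span v k}"
proof (intro equalityI subsetI)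
  fix x assume "x \<in> nat_span v (Suc k)"
  then show "x \<in> {y + c * v k |y c. y \<in> nat_span v k}" by (auto simp: nat_span_def)
next
  fix x assume "x \<in> {y + c * v k |y c. y \<in> nat_span v k}"
  then obtain c d where x: "x = (\<Sum>i<k. c i * v i) + d * v k" by (auto simp: nat_span_def)
  have "x = (\<Sum>i<Suc k. (c(k := d)) i * v i)" by (simp add: x)
  then show "x \<in> nat_span v (Suc k)" unfolding nat_span_def by blast
qed

lemma nat_span_add: "x \<in> nat_span v k \<Longrightarrow> y \<in> nat_span v k \<Longrightarrow> x + y \<in> nat_span v k"
proof -
  assume "x \<in> nat_span v k" "y \<in> nat_span v k"
  then obtain c d where "x = (\<Sum>i<k. c i * v i)" "y = (\<Sum>i<k. d i * v i)"
    by (auto simp: nat_span_def)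
  then have "x + y = (\<Sum>i<k. (c i + d i) * v i)" by (simp add: algebra_simps sum.distrib)
  then show ?thesis unfolding nat_span_def by (intro CollectI exI[of _ "\<lambda>i. c i + d i"]) simp
qed

lemma nat_span_SucI: "x \<in> nat_span v k \<Longrightarrow> x + c * v k \<in> nat_span v (Suc k)"
  by (auto simp: nat_span_Suc)

lemma nat_span_mono: "k \<le> l \<Longrightarrow> nat_span v k \<subseteq> nat_span v l"
proof (induction l rule: dec_induct)
  case (step l)
  have "x \<in> nat_span v (Suc l)" if "x \<in> nat_span v l" for x
    using nat_span_SucI[OF that, of 0] by simp
  with step show ?case by blast
qed simp

lemma gens_gcd_0: "gens_gcd v 0 = v 0"
  by (simp add: gens_gcd_def)

lemma gens_gcd_Suc: "gens_gcd v (Suc k) = gcd (gens_gcd v k) (v (Suc k))"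
  by (simp add: gens_gcd_def atLeast0_atMost_Suc gcd.commute)

lemma gens_gcd_dvd_span: "x \<in> nat_span v (Suc k) \<Longrightarrow> gens_gcd v k dvd x"
proof -
  have d: "gens_gcd v k dvd v i" if "i < Suc k" for i
    using that unfolding gens_gcd_def by (intro Gcd_dvd) auto
  assume "x \<in> nat_span v (Suc k)"
  then obtain c where c: "x = (\<Sum>i<Suc k. c i * v i)" unfolding nat_span_def by blast
  show ?thesis unfolding c by (intro dvd_sum dvd_mult d) simp
qed

text \<open>The a_j form the Apery set of S with respect to n = v_0, in increasing order.
  Superadditivity in the index is special: it fails for the semigroup generated by 3, 4, 5.\<close>

locale apery_sequence =
  fixes n :: nat and a :: "nat \<Rightarrow> nat" and S :: "nat set" and g :: nat and v :: "nat \<Rightarrow> nat"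
  assumes n_pos: "0 < n" and a_0: "a 0 = 0"
    and a_mono: "i < j \<Longrightarrow> j < n \<Longrightarrow> a i < a j"
    and a_super: "i + j < n \<Longrightarrow> a i + a j \<le> a (i + j)"
    and a_inj: "i < n \<Longrightarrow> j < n \<Longrightarrow> a i mod n = a j mod n \<Longrightarrow> i = j"
    and S_eq: "S = (\<Union>j<n. range (\<lambda>k. a j + k * n))"
    and gens: "minimal_generators S g v"
    and v_0: "v 0 = n"
begin

definition U :: "nat \<Rightarrow> nat set" where
  "U b = (\<Union>j<b. range (\<lambda>k. a j + k * n))"

lemma U_I: "j < b \<Longrightarrow> a j + k * n \<in> U b"
  by (auto simp: U_def)

lemma a_mono_le: "i \<le> j \<Longrightarrow> j < n \<Longrightarrow> a i \<le> a j"
  using a_mono[of i j] by (cases "i = j") auto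

lemma S_span: "S = nat_span v (Suc g)"
  using gens by (simp add: minimal_generators_def)

lemma S_add: "s \<in> S \<Longrightarrow> t \<in> S \<Longrightarrow> s + t \<in> S"
  unfolding S_span by (rule nat_span_add)

lemma a_in_S: "j < n \<Longrightarrow> a j \<in> S"
  unfolding S_eq using U_I[of j n 0] by (simp add: U_def)

lemma a_notin_U: "b < n \<Longrightarrow> a b \<notin> U b"
proof
  assume b: "b < n" "a b \<in> U b"
  then obtain j k where jk: "j < b" "a b = a j + k * n" by (auto simp: U_def)
  then have "a b mod n = a j mod n" by simp
  with a_inj[of b j] b jk show False by simp
qed

lemma span_le_v: "k \<le> g \<Longrightarrow> s \<in> S \<Longrightarrow> s \<notin> nat_span v k \<Longrightarrow> v k \<le> s"
  and v_notin_span: "k \<le> g \<Longrightarrow> v k \<notin> nat_span v k"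
  and v_in_S: "k \<le> g \<Longrightarrow> v k \<in> S"
  using gens unfolding minimal_generators_def by blast+

text \<open>The residues of the a_j with j < b are b different multiples of e below n = b e, hence
  all of them. So an element of S divisible by e has a residue that is already taken, and its index
  is below b.\<close>

lemma U_eq_multiples:
  assumes be: "b * e = n" and dvd: "\<And>j. j < b \<Longrightarrow> e dvd a j"
  shows "U b = {s \<in> S. e dvd s}"
proof (intro equalityI subsetI)
  have bn: "b \<le> n" using be n_pos by (metis dvd_imp_le dvd_triv_left)
  have en: "e dvd n" using be by auto
  fix s assume "s \<in> U b"
  then obtain j k where jk: "j < b" "s = a j + k * n" by (auto simp: U_def)
  then have "s \<in> S" using bn U_I[of j n k] unfolding S_eq U_def by simp
  moreover have "e dvd s" using jk dvd en by simp
  ultimately show "s \<in> {s \<in> S. e dvd s}" by simp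
next
  have bn: "b \<le> n" using be n_pos by (metis dvd_imp_le dvd_triv_left)
  have en: "e dvd n" using be by auto
  fix s assume "s \<in> {s \<in> S. e dvd s}"
  then obtain i k where i: "i < n" "s = a i + k * n" "e dvd s" by (auto simp: S_eq)
  then have ei: "e dvd a i" using en by (metis dvd_add_left_iff dvd_mult)
  define R where "R = (\<lambda>q. q * e) ` {..<b}"
  have "(\<lambda>j. a j mod n) ` {..<b} \<subseteq> R"
  proof
    fix m assume "m \<in> (\<lambda>j. a j mod n) ` {..<b}"
    then obtain j where "j < b" "m = a j mod n" by auto
    then have "e dvd m" "m < n" using dvd en n_pos by (auto simp: dvd_mod_iff)
    then obtain q where q: "m = q * e" by (metis dvdE mult.commute)
    with \<open>m < n\<close> be have "q < b" by (metis mult_less_cancel2)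
    with q show "m \<in> R" by (auto simp: R_def)
  qed
  moreover have "card R \<le> card ((\<lambda>j. a j mod n) ` {..<b})"
  proof -
    have "inj_on (\<lambda>j. a j mod n) {..<b}"
    proof (rule inj_onI)
      fix i j assume "i \<in> {..<b}" "j \<in> {..<b}" and eq: "a i mod n = a j mod n"
      with bn have "i < n" "j < n" by auto
      then show "i = j" using eq by (rule a_inj)
    qed
    then have "card ((\<lambda>j. a j mod n) ` {..<b}) = b" by (simp add: card_image)
    moreover have "card R \<le> card {..<b}" unfolding R_def by (rule card_image_le) simp
    ultimately show ?thesis by simp
  qed
  ultimately have R: "(\<lambda>j. a j mod n) ` {..<b} = R"
    by (intro card_seteq) (simp_all add: R_def)
  have "e dvd a i mod n" "a i mod n < n" using ei en n_pos by (auto simp: dvd_mod_iff)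
  then obtain q where q: "a i mod n = q * e" by (metis dvdE mult.commute)
  with \<open>a i mod n < n\<close> be have "q < b" by (metis mult_less_cancel2)
  then have "a i mod n \<in> R" using q by (auto simp: R_def)
  then obtain j where "j < b" "a i mod n = a j mod n" unfolding R[symmetric] by auto
  with a_inj[of i j] i bn have "i < b" by auto
  with i show "s \<in> U b" by (simp add: U_I)
qed

section \<open>Generators in terms of the Apery sequence\<close>

definition block :: "nat \<Rightarrow> nat" where
  "block k = n div gens_gcd v k"

text \<open>The invariant of the induction on k: v_0, ..., v_k generate exactly the part of S over
  the indices below n / e_k.\<close>

definition block_inv :: "nat \<Rightarrow> bool" where
  "block_inv k \<longleftrightarrow> block k * gens_gcd v k = n \<and> (\<forall>j<block k. gens_gcd v k dvd a j) \<and>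
     nat_span v (Suc k) = U (block k)"

lemma block_mult: "block k * gens_gcd v k = n"
proof -
  have "gens_gcd v k dvd n" unfolding gens_gcd_def v_0[symmetric] by (intro Gcd_dvd) auto
  then show ?thesis by (simp add: block_def)
qed

lemma gens_gcd_pos: "0 < gens_gcd v k"
  using block_mult[of k] n_pos by (metis mult_0_right neq0_conv)

lemma block_pos: "0 < block k"
  using block_mult[of k] n_pos by (metis mult_0 neq0_conv)

lemma block_le: "block k \<le> n"
  by (simp add: block_def)

text \<open>Minimality of v_(k+1) selects the least element of S outside \<open>U (block k)\<close>,
  and by monotonicity this is the first a_j left out.\<close>

lemma block_inv_v:
  assumes "block_inv k" "Suc k \<le> g"
  shows "block k < n" "v (Suc k) = a (block k)"
proof -
  have span: "nat_span v (Suc k) = U (block k)" using assms by (simp add: block_inv_def)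
  show b: "block k < n"
  proof (rule ccontr)
    assume "\<not> block k < n"
    then have "block k = n" using block_le[of k] by simp
    then have "U (block k) = S" by (simp add: U_def S_eq)
    with v_in_S[OF assms(2)] v_notin_span[OF assms(2)] span show False by simp
  qed
  show "v (Suc k) = a (block k)"
  proof (rule antisym)
    show "v (Suc k) \<le> a (block k)"
      using span_le_v[OF assms(2) a_in_S[OF b]] a_notin_U[OF b] span by simp
    have "v (Suc k) \<in> S" "v (Suc k) \<notin> U (block k)"
      using v_in_S[OF assms(2)] v_notin_span[OF assms(2)] span by auto
    then obtain i t where i: "i < n" "v (Suc k) = a i + t * n" by (auto simp: S_eq)
    then have "block k \<le> i" using \<open>v (Suc k) \<notin> U (block k)\<close> U_I[of i "block k" t] by (metis not_le)
    then show "a (block k) \<le> v (Suc k)" using a_mono_le[of "block k" i] i by simp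
  qed
qed

lemma a_mult: "c * b < n \<Longrightarrow> c * a b \<le> a (c * b)"
proof (induction c)
  case (Suc c)
  then have "c * a b \<le> a (c * b)" by simp
  with a_super[of b "c * b"] Suc.prems show ?case by simp
qed simp

lemma block_Suc: "block (Suc k) = (gens_gcd v k div gens_gcd v (Suc k)) * block k"
proof -
  have "gens_gcd v (Suc k) dvd gens_gcd v k" by (simp add: gens_gcd_Suc)
  then have "(gens_gcd v k div gens_gcd v (Suc k)) * block k * gens_gcd v (Suc k) = n"
    using block_mult[of k] by (metis dvd_div_mult_self mult.assoc mult.commute)
  then show ?thesis using block_mult[of "Suc k"] gens_gcd_pos[of "Suc k"]
    by (metis mult_right_cancel neq0_conv)
qed

lemma block_mono: "i \<le> k \<Longrightarrow> block i \<le> block k"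
proof (induction k rule: dec_induct)
  case (step k)
  have "0 < block (Suc k)" by (rule block_pos)
  then have "block k \<le> block (Suc k)" unfolding block_Suc by (cases "gens_gcd v k div gens_gcd v (Suc k)") auto
  with step show ?case by simp
qed simp

text \<open>Superadditivity gives one inequality. If it were strict, then c v_(k+1) + a_j, being in
  S, would have a smaller index with digits c', j', to which the induction applies. Comparing modulo
  e_k gives r | c - c', so c = c' and then j = j', a contradiction.\<close>

lemma block_inv_a:
  assumes "block_inv k" "Suc k \<le> g" and r: "r = gens_gcd v k div gens_gcd v (Suc k)"
  shows "c < r \<Longrightarrow> j < block k \<Longrightarrow> a (c * block k + j) = c * v (Suc k) + a j"
proof (induction "c * block k + j" arbitrary: c j rule: less_induct)
  case less
  define b where "b = block k"
  define e where "e = gens_gcd v k"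
  define e' where "e' = gens_gcd v (Suc k)"
  define w where "w = v (Suc k)"
  have w: "w = a b" using block_inv_v[OF assms(1,2)] by (simp add: w_def b_def)
  have e': "e' = gcd e w" by (simp add: e'_def e_def w_def gens_gcd_Suc)
  have e'pos: "0 < e'" unfolding e'_def by (rule gens_gcd_pos)
  have en: "e dvd n" using block_mult[of k] by (metis e_def dvd_triv_right)
  have ed: "e dvd a j" if "j < b" for j using assms(1) that by (simp add: block_inv_def e_def b_def)
  have rb: "r * b \<le> n" using block_Suc[of k] block_le[of "Suc k"] by (simp add: r b_def)
  have lt: "c * b + j < n"
  proof -
    have "c * b + j < Suc c * b" using less.prems by (simp add: b_def)
    also have "\<dots> \<le> r * b" using less.prems by (intro mult_le_mono1) simp
    finally show ?thesis using rb by simp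
  qed
  show ?case
  proof (rule antisym)
    have "c * a b + a j \<le> a (c * b) + a j" using a_mult[of c b] lt by simp
    also have "\<dots> \<le> a (c * b + j)" using lt by (rule a_super)
    finally show "c * v (Suc k) + a j \<le> a (c * block k + j)" using w by (simp add: w_def b_def)
    show "a (c * block k + j) \<le> c * v (Suc k) + a j"
    proof (rule ccontr)
      assume "\<not> a (c * block k + j) \<le> c * v (Suc k) + a j"
      then have gt: "c * w + a j < a (c * b + j)" by (simp add: w_def b_def)
      have "c * w \<in> S" for c
      proof (induction c)
        case 0
        then show ?case using a_in_S[OF n_pos] a_0 by simp
      next
        case (Suc c)
        with S_add v_in_S[OF assms(2)] show ?case by (simp add: w_def)
      qed
      moreover have "a j \<in> S" using a_in_S lt by simp
      ultimately have "c * w + a j \<in> S" by (rule S_add)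
      then obtain i t where i: "i < n" "c * w + a j = a i + t * n" by (auto simp: S_eq)
      then have "a i < a (c * b + j)" using gt by simp
      then have il: "i < c * b + j" using a_mono_le[of "c * b + j" i] i(1) by (meson not_le)
      define c' where "c' = i div b"
      define j' where "j' = i mod b"
      have bpos: "0 < b" unfolding b_def by (rule block_pos)
      have i': "i = c' * b + j'" "j' < b" using bpos by (simp_all add: c'_def j'_def)
      have "c' * b < Suc c * b" using il i' less.prems by (simp add: b_def)
      then have c'c: "c' \<le> c" using bpos by (simp only: mult_less_cancel2) simp
      have ai: "a i = c' * w + a j'"
        using less.hyps[of c' j'] il i' c'c less.prems by (simp add: b_def w_def)
      have eq: "(c - c') * w + a j = a j' + t * n"
        using i(2) ai c'c by (simp add: diff_mult_distrib)
      have "c' * w \<le> c * w" using c'c by (rule mult_le_mono1)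
      have "e dvd (c - c') * w + a j" unfolding eq using en ed[OF i'(2)] by simp
      then have "e dvd (c - c') * w" using ed[of j] less.prems by (simp add: b_def dvd_add_left_iff)
      then have "e div e' dvd (c - c') * (w div e')"
      proof -
        assume *: "e dvd (c - c') * w"
        have "e = (e div e') * e'" "(c - c') * w = (c - c') * (w div e') * e'"
          by (simp_all add: e' mult.assoc)
        with * e'pos show ?thesis by (metis dvd_times_right_cancel_iff neq0_conv)
      qed
      moreover have "coprime (e div e') (w div e')"
        unfolding e' using e'pos e' by (intro div_gcd_coprime) auto
      ultimately have "r dvd c - c'" unfolding r e_def[symmetric] e'_def[symmetric]
        by (simp add: coprime_dvd_mult_left_iff)
      moreover have "c - c' < r" using less.prems by simp
      ultimately have "c = c'" using c'c by (metis diff_is_0_eq' diff_diff_cancel dvd_imp_le le_antisym not_less zero_less_iff_neq_zero diff_zero)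
      with eq have "a j mod n = a j' mod n" by simp
      with a_inj[of j j'] lt i' i(1) have "j = j'" by auto
      with \<open>c = c'\<close> i' il show False by simp
    qed
  qed
qed

lemma block_inv_holds: "k \<le> g \<Longrightarrow> block_inv k"
proof (induction k)
  case 0
  have b: "block 0 = 1" using n_pos by (simp add: block_def gens_gcd_0 v_0)
  have "nat_span v (Suc 0) = U 1"
    by (auto simp: nat_span_Suc nat_span_0 U_def a_0 v_0)
  then show ?case by (simp add: block_inv_def b gens_gcd_0 v_0 a_0)
next
  case (Suc k)
  then have I: "block_inv k" by simp
  define r where "r = gens_gcd v k div gens_gcd v (Suc k)"
  have bS: "block (Suc k) = r * block k" by (simp add: block_Suc r_def)
  have ex: "\<exists>c j. i = c * block k + j \<and> c < r \<and> j < block k \<and> a i = c * v (Suc k) + a j"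
    if "i < block (Suc k)" for i
  proof -
    have "i = (i div block k) * block k + i mod block k" by simp
    moreover have "i div block k < r" using that bS by (simp add: less_mult_imp_div_less)
    moreover have "i mod block k < block k" using block_pos by simp
    ultimately show ?thesis using block_inv_a[OF I Suc.prems r_def] by metis
  qed
  have dvd: "gens_gcd v (Suc k) dvd a i" if i: "i < block (Suc k)" for i
  proof -
    obtain c j where "j < block k" "a i = c * v (Suc k) + a j" using ex[OF i] by blast
    moreover have "gens_gcd v (Suc k) dvd v (Suc k)" "gens_gcd v (Suc k) dvd gens_gcd v k"
      by (simp_all add: gens_gcd_Suc)
    moreover have "gens_gcd v k dvd a j" using I \<open>j < block k\<close> by (simp add: block_inv_def)
    ultimately show ?thesis by (metis dvd_add dvd_mult dvd_trans)
  qed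
  have U: "U (block (Suc k)) = {s \<in> S. gens_gcd v (Suc k) dvd s}"
    by (rule U_eq_multiples[OF block_mult dvd])
  have "nat_span v (Suc (Suc k)) = U (block (Suc k))"
  proof (intro equalityI subsetI)
    fix s assume s: "s \<in> nat_span v (Suc (Suc k))"
    then have "s \<in> S" unfolding S_span using nat_span_mono[of "Suc (Suc k)" "Suc g" v] Suc.prems by auto
    with s show "s \<in> U (block (Suc k))" unfolding U using gens_gcd_dvd_span by blast
  next
    fix s assume "s \<in> U (block (Suc k))"
    then obtain i t where i: "i < block (Suc k)" "s = a i + t * n" by (auto simp: U_def)
    then obtain c j where j: "j < block k" "a i = c * v (Suc k) + a j" using ex by blast
    have "a j + t * n \<in> nat_span v (Suc k)" using I j by (simp add: block_inv_def U_I)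
    from nat_span_SucI[OF this, of c] i j show "s \<in> nat_span v (Suc (Suc k))"
      by (simp add: algebra_simps)
  qed
  with dvd show ?case unfolding block_inv_def using block_mult by blast
qed

text \<open>Otherwise the Apery element at index \<open>block g\<close> would lie outside the span
  of all generators. Equivalently, the generators have gcd 1.\<close>

lemma block_last: "block g = n"
proof (rule ccontr)
  assume "block g \<noteq> n"
  then have "block g < n" using block_le[of g] by simp
  from a_notin_U[OF this] a_in_S[OF this] block_inv_holds[of g] show False
    by (simp add: block_inv_def S_span)
qed

lemma v_Suc: "Suc k \<le> g \<Longrightarrow> v (Suc k) = a (block k) \<and> block k < n"
  using block_inv_v[OF block_inv_holds] by simp

lemma span_Suc: "k \<le> g \<Longrightarrow> nat_span v (Suc k) = U (block k)"
  using block_inv_holds by (simp add: block_inv_def)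

text \<open>Writing j in digits as in \<open>block_inv_a\<close> gives the weak inequality for the
  previous slope. The slope strictly increases from block to block: r v_(k+1) is at most v_(k+2) by
  superadditivity, and it lies in the span of the earlier generators while v_(k+2) does not.\<close>

lemma slope:
  assumes "Suc k \<le> g"
  shows "0 < j \<Longrightarrow> j < block k \<Longrightarrow> block k * a j < j * v (Suc k)"
  using assms
proof (induction k arbitrary: j)
  case 0
  then show ?case using n_pos by (simp add: block_def gens_gcd_0 v_0)
next
  case (Suc k)
  define r where "r = gens_gcd v k div gens_gcd v (Suc k)"
  define b where "b = block k"
  have bS: "block (Suc k) = r * b" by (simp add: block_Suc r_def b_def)
  define c j' where "c = j div b" and "j' = j mod b"
  have j: "j = c * b + j'" "j' < b" "c < r"
    using Suc.prems block_pos[of k] bS by (simp_all add: c_def j'_def b_def less_mult_imp_div_less)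
  have aj: "a j = c * v (Suc k) + a j'"
    using block_inv_a[OF block_inv_holds _ r_def j(3)] j Suc.prems by (simp add: b_def)
  have "b * a j' \<le> j' * v (Suc k)"
    using Suc.IH[of j'] Suc.prems j a_0 by (cases "j' = 0") (auto simp: b_def)
  then have "c * b * v (Suc k) + b * a j' \<le> (c * b + j') * v (Suc k)"
    by (simp add: algebra_simps)
  then have "b * a j \<le> j * v (Suc k)"
    unfolding aj j(1)[symmetric] by (simp add: algebra_simps)
  then have "r * (b * a j) \<le> r * (j * v (Suc k))" by (rule mult_le_mono2)
  then have le: "block (Suc k) * a j \<le> j * (r * v (Suc k))" by (simp add: bS algebra_simps)
  have "r * v (Suc k) < v (Suc (Suc k))"
  proof -
    have "r * v (Suc k) \<in> nat_span v (Suc (Suc k))"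
      using nat_span_SucI[of 0 v "Suc k" r] nat_span_mono[of 0 "Suc k" v] by (simp add: nat_span_0)
    then have "r * v (Suc k) \<noteq> v (Suc (Suc k))" using v_notin_span Suc.prems by metis
    moreover have "r * v (Suc k) \<le> v (Suc (Suc k))"
      using a_mult[of r b] v_Suc[of k] v_Suc[of "Suc k"] Suc.prems bS by (simp add: b_def)
    ultimately show ?thesis by simp
  qed
  with le Suc.prems show ?case by (meson mult_less_mono2 order.strict_trans1)
qed

end

section \<open>Suprema of contacts\<close>

lemma bijective_local_hom_quotient_basis:
  assumes \<Theta>: "local_hom \<Theta>" and \<Psi>: "local_hom \<Psi>" and inv: "\<And>f. \<Psi> (\<Theta> f) = f" "\<And>f. \<Theta> (\<Psi> f) = f"
    and B: "quotient_basis I B"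
  shows "quotient_basis (\<Theta> ` I) (\<Theta> ` B)"
  unfolding quotient_basis_def
proof (intro conjI allI)
  show "finite (\<Theta> ` B)" using B by (simp add: quotient_basis_def)
  fix h
  define Q where "Q = (\<lambda>c. (\<forall>b. b \<notin> B \<longrightarrow> c b = 0) \<and> \<Psi> h - (\<Sum>b\<in>B. K2 (c b) * b) \<in> I)"
  define R where "R = (\<lambda>c. (\<forall>b. b \<notin> \<Theta> ` B \<longrightarrow> c b = 0) \<and> h - (\<Sum>b\<in>\<Theta> ` B. K2 (c b) * b) \<in> \<Theta> ` I)"
  have inj: "inj_on \<Theta> B" by (rule inj_on_inverseI) (rule inv)
  have mem: "x \<in> \<Theta> ` A \<longleftrightarrow> \<Psi> x \<in> A" for x A
    using inv by (metis image_iff)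
  have RQ: "R c \<longleftrightarrow> Q (\<lambda>b. c (\<Theta> b))" for c
  proof -
    have "\<Psi> (h - (\<Sum>b\<in>\<Theta> ` B. K2 (c b) * b)) = \<Psi> h - (\<Sum>b\<in>B. K2 (c (\<Theta> b)) * b)"
      by (simp add: local_hom_diff[OF \<Psi>] local_hom_sum[OF \<Psi>] local_hom_mult[OF \<Psi>] local_hom_K[OF \<Psi>] sum.reindex[OF inj] inv)
    then have "h - (\<Sum>b\<in>\<Theta> ` B. K2 (c b) * b) \<in> \<Theta> ` I \<longleftrightarrow> \<Psi> h - (\<Sum>b\<in>B. K2 (c (\<Theta> b)) * b) \<in> I"
      by (simp only: mem)
    moreover have "(\<forall>b. b \<notin> \<Theta> ` B \<longrightarrow> c b = 0) \<longleftrightarrow> (\<forall>b. b \<notin> B \<longrightarrow> c (\<Theta> b) = 0)"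
      unfolding mem using inv by metis
    ultimately show ?thesis by (simp only: R_def Q_def)
  qed
  have "\<exists>!c. Q c" using B unfolding quotient_basis_def Q_def by blast
  then obtain d where d: "Q d" "\<And>c. Q c \<Longrightarrow> c = d" by (elim ex1E) blast
  have "\<exists>!c. R c"
  proof (rule ex1I)
    show "R (\<lambda>b. d (\<Psi> b))" unfolding RQ inv by (rule d(1))
    fix c assume "R c"
    then have "(\<lambda>b. c (\<Theta> b)) = d" unfolding RQ by (rule d(2))
    then show "c = (\<lambda>b. d (\<Psi> b))" by (auto simp: inv)
  qed
  then show "\<exists>!c. (\<forall>b. b \<notin> \<Theta> ` B \<longrightarrow> c b = 0) \<and> h - (\<Sum>b\<in>\<Theta> ` B. K2 (c b) * b) \<in> \<Theta> ` I"
    by (simp only: R_def)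
qed

text \<open>The opposite inequality is the same statement for the inverse map.\<close>

lemma bijective_local_hom_quotient_dim:
  assumes \<Theta>: "local_hom \<Theta>" and \<Psi>: "local_hom \<Psi>" and inv: "\<And>f. \<Psi> (\<Theta> f) = f" "\<And>f. \<Theta> (\<Psi> f) = f"
  shows "quotient_dim (\<Theta> ` I) \<le> quotient_dim I"
  unfolding quotient_dim_def
proof (rule INF_greatest)
  fix B assume "B \<in> {B. quotient_basis I B}"
  then have B: "quotient_basis I B" by simp
  have "inj_on \<Theta> B" by (rule inj_on_inverseI) (rule inv)
  then have "card (\<Theta> ` B) = card B" by (rule card_image)
  moreover have "(INF B\<in>{B. quotient_basis (\<Theta> ` I) B}. enat (card B)) \<le> enat (card (\<Theta> ` B))"
    using bijective_local_hom_quotient_basis[OF \<Theta> \<Psi> inv B] by (intro INF_lower) simp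
  ultimately show "(INF B\<in>{B. quotient_basis (\<Theta> ` I) B}. enat (card B)) \<le> enat (card B)" by simp
qed

lemma shear_inverse: "shear (- c) (shear c f) = f"
proof -
  have "shear (- c) (shear c xx) = xx" "shear (- c) (shear c yy) = yy"
    unfolding shear_x shear_y local_hom_add[OF local_hom_shear] local_hom_mult[OF local_hom_shear] local_hom_K[OF local_hom_shear]
    by (simp_all flip: fps_const_neg)
  moreover have "local_hom (\<lambda>f :: 'a fps2. f)" by (simp add: local_hom_def vanish_1_iff)
  ultimately have "shear (- c) \<circ> shear c = (\<lambda>f. f)"
    by (intro local_hom_unique[OF local_hom_comp[OF local_hom_shear local_hom_shear]]) simp_all
  from fun_cong[OF this, of f] show ?thesis by simp
qed

lemma shear_inverse': "shear c (shear (- c) f) = f"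
  using shear_inverse[of "- c" f] by simp

lemma intersection_number_shear:
  "intersection_number (shear c f) (shear c h) = intersection_number f h"
proof -
  have img: "ideal2 (shear c f) (shear c h) = shear c ` ideal2 f h" for c and f h :: "'a fps2"
  proof (intro equalityI subsetI)
    fix z assume "z \<in> ideal2 (shear c f) (shear c h)"
    then obtain a b where "z = a * shear c f + b * shear c h" by (auto simp: ideal2_def)
    then have "z = shear c (shear (- c) a * f + shear (- c) b * h)"
      by (simp add: local_hom_add[OF local_hom_shear] local_hom_mult[OF local_hom_shear] shear_inverse')
    then show "z \<in> shear c ` ideal2 f h" by (auto simp: ideal2_def)
  next
    fix z assume "z \<in> shear c ` ideal2 f h"
    then obtain a b where "z = shear c (a * f + b * h)" by (auto simp: ideal2_def)
    then have "z = shear c a * shear c f + shear c b * shear c h"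
      by (simp add: local_hom_add[OF local_hom_shear] local_hom_mult[OF local_hom_shear])
    then show "z \<in> ideal2 (shear c f) (shear c h)" by (auto simp: ideal2_def)
  qed
  have le: "intersection_number (shear c f) (shear c h) \<le> intersection_number f h" for c and f h :: "'a fps2"
    unfolding intersection_number_def img
    by (rule bijective_local_hom_quotient_dim[OF local_hom_shear local_hom_shear shear_inverse shear_inverse'])
  from le[of c f h] le[of "- c" "shear c f" "shear c h"] show ?thesis
    by (simp add: shear_inverse)
qed

lemma shear_dvd_iff: "shear c f dvd shear c h \<longleftrightarrow> f dvd h"
proof
  assume "shear c f dvd shear c h"
  then obtain z where "shear c h = shear c f * z" by (elim dvdE)
  then have "shear (- c) (shear c h) = shear (- c) (shear c f) * shear (- c) z"
    by (simp add: local_hom_mult[OF local_hom_shear])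
  then show "f dvd h" by (simp add: shear_inverse)
next
  assume "f dvd h"
  then show "shear c f dvd shear c h" by (elim dvdE) (simp add: local_hom_mult[OF local_hom_shear])
qed

lemma irreducible_shear:
  assumes "irreducible f"
  shows "irreducible (shear c f)"
proof (rule irreducibleI)
  show "shear c f \<noteq> 0"
    using assms shear_inverse[of c f] local_hom_0[OF local_hom_shear] by (metis not_irreducible_zero)
  have unit: "shear c h dvd 1 \<longleftrightarrow> h dvd 1" for c and h :: "'a fps2"
    by (simp add: fps2_unit_iff local_hom_nth_0[OF local_hom_shear])
  show "\<not> shear c f dvd 1" unfolding unit using assms irreducible_not_unit by blast
  fix a b assume "shear c f = a * b"
  then have "f = shear (- c) a * shear (- c) b"
    using shear_inverse[of c f] by (simp add: local_hom_mult[OF local_hom_shear])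
  from irreducibleD[OF assms this] show "a dvd 1 \<or> b dvd 1" by (simp only: unit)
qed

lemma branch_semigroup_shear: "branch_semigroup (shear c f) = branch_semigroup f"
proof (intro equalityI subsetI)
  fix s assume "s \<in> branch_semigroup (shear c f)"
  then obtain h where "\<not> shear c f dvd h" "intersection_number (shear c f) h = enat s"
    by (auto simp: branch_semigroup_def)
  then have "\<not> f dvd shear (- c) h" "intersection_number f (shear (- c) h) = enat s"
    using shear_dvd_iff[of c f "shear (- c) h"] intersection_number_shear[of c f "shear (- c) h"]
    by (simp_all add: shear_inverse')
  then show "s \<in> branch_semigroup f" by (auto simp: branch_semigroup_def)
next
  fix s assume "s \<in> branch_semigroup f"
  then obtain h where "\<not> f dvd h" "intersection_number f h = enat s"
    by (auto simp: branch_semigroup_def)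
  then have "\<not> shear c f dvd shear c h" "intersection_number (shear c f) (shear c h) = enat s"
    by (simp_all add: shear_dvd_iff intersection_number_shear)
  then show "s \<in> branch_semigroup (shear c f)" by (auto simp: branch_semigroup_def)
qed

section \<open>Branches in transversal coordinates\<close>

lemma (in semival_branch) v_y_ge:
  assumes "vanish N g" "g $ N $ 0 \<noteq> 0"
  shows "enat N \<le> v yy"
proof (rule ccontr)
  assume "\<not> enat N \<le> v yy"
  then obtain s where s: "v yy = enat s" "s < N" by (cases "v yy") auto
  from vanish_decomposition[OF assms(1)] obtain h where h: "g = (\<Sum>j\<le>N. xx ^ (N - j) * yy ^ j * h j)"
    and h0: "\<forall>j\<le>N. h j $ 0 $ 0 = g $ j $ (N - j)" by blast
  have "v (h N) = 0" using h0 assms(2) by (intro v_unit) (simp add: fps2_unit_iff)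
  \<comment> \<open>If y had smaller value than x, this term would be the only one of least value in
    g, and g would have a finite value.\<close>
  then have top: "v (yy ^ N * h N) = enat (N * s)"
    by (simp add: v_mult v_power s of_nat_eq_enat)
  have "enat (Suc (N * s)) \<le> v (xx ^ (N - j) * yy ^ j * h j)" if "j < N" for j
  proof -
    from that obtain d where d: "N = j + Suc d" by (auto dest: less_imp_Suc_add)
    from s(2) obtain t where t: "N = s + Suc t" by (auto dest: less_imp_Suc_add)
    have eq: "N * s + Suc d * Suc t = (N - j) * N + j * s"
    proof -
      have "(N - j) * N + j * s = Suc d * (s + Suc t) + j * s" using d t by simp
      also have "\<dots> = (j + Suc d) * s + Suc d * Suc t" by (simp add: algebra_simps)
      finally show ?thesis using d by simp
    qed
    have "Suc (N * s) \<le> (N - j) * N + j * s" unfolding eq[symmetric] by simp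
    moreover have "v (yy ^ j) = enat (j * s)" by (simp add: v_power s of_nat_eq_enat)
    ultimately have "enat (Suc (N * s)) \<le> v (xx ^ (N - j)) + v (yy ^ j)"
      unfolding v_x_power by simp
    also have "\<dots> \<le> v (xx ^ (N - j)) + v (yy ^ j) + v (h j)" by (rule le_iff_add[THEN iffD2]) blast
    finally show ?thesis by (simp only: v_mult)
  qed
  then have low: "enat (Suc (N * s)) \<le> v (\<Sum>j<N. xx ^ (N - j) * yy ^ j * h j)"
    by (intro v_sum_ge) simp
  have "g = yy ^ N * h N + (\<Sum>j<N. xx ^ (N - j) * yy ^ j * h j)"
    by (subst h) (simp add: lessThan_Suc_atMost[symmetric] add.commute)
  moreover have "v (yy ^ N * h N) < v (\<Sum>j<N. xx ^ (N - j) * yy ^ j * h j)"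
    unfolding top using low by (rule order.strict_trans2[rotated]) simp
  ultimately have "v g = enat (N * s)" using v_add_eq top by metis
  with v_g show False by simp
qed

text \<open>The value N of x is thus the least positive one, which identifies v_0 with the
  y-order.\<close>

lemma (in semival_branch) v_nonunit_ge:
  assumes "vanish N g" "g $ N $ 0 \<noteq> 0" "h $ 0 $ 0 = 0"
  shows "enat N \<le> v h"
proof -
  have h: "h = xx * fps_const (fps_shift 1 (h $ 0)) + yy * fps_shift 1 h"
    using fps2_expand[of h] assms(3) by simp
  have "enat N \<le> v (xx * fps_const (fps_shift 1 (h $ 0)))"
    unfolding v_mult v_x by (rule le_iff_add[THEN iffD2]) blast
  moreover have "enat N \<le> v (yy * fps_shift 1 h)"
    unfolding v_mult by (rule order.trans[OF v_y_ge[OF assms(1,2)] le_iff_add[THEN iffD2]]) blast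
  ultimately show ?thesis by (subst h) (rule v_add_ge)
qed

text \<open>The line x = 0 is not tangent to the branch, so it meets the branch with intersection
  number equal to the multiplicity.\<close>

definition transversal :: "'a::field fps2 \<Rightarrow> bool" where
  "transversal f \<longleftrightarrow> irreducible f \<and> at_x0 f \<noteq> 0 \<and> yord f = fps2_order f"

definition apery :: "'a::alg_closed_field fps2 \<Rightarrow> nat \<Rightarrow> nat" where
  "apery f = semival_branch.ap (intersection_number f)"

lemma branch_semigroup_eq_S:
  fixes f :: "'a::alg_closed_field fps2"
  assumes "irreducible f" "at_x0 f \<noteq> 0"
  shows "branch_semigroup f = semival.S (intersection_number f)"
proof -
  interpret semival_branch "intersection_number f" "yord f" f
    using assms by (rule semival_branch_intersection)
  show ?thesis
    unfolding branch_semigroup_def S_def using v_inf_iff by (metis enat.distinct(1))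
qed

lemma branch_semigroup_apery:
  fixes f :: "'a::alg_closed_field fps2"
  assumes "irreducible f" "at_x0 f \<noteq> 0"
  shows "branch_semigroup f = (\<Union>j<yord f. range (\<lambda>k. apery f j + k * yord f))"
proof -
  interpret semival_branch "intersection_number f" "yord f" f
    using assms by (rule semival_branch_intersection)
  show ?thesis
    unfolding branch_semigroup_eq_S[OF assms] apery_def using S_eq yord_g by simp
qed

lemma apery_attained:
  fixes f :: "'a::alg_closed_field fps2"
  assumes "irreducible f" "at_x0 f \<noteq> 0" "j < yord f"
  shows "\<exists>q. at_x0 q \<noteq> 0 \<and> yord q = j \<and> intersection_number f q = enat (apery f j)"
proof -
  interpret semival_branch "intersection_number f" "yord f" f
    using assms(1,2) by (rule semival_branch_intersection)
  show ?thesis unfolding apery_def using ap_attained assms yord_g by simp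
qed

lemma apery_ge:
  fixes f :: "'a::alg_closed_field fps2"
  assumes "irreducible f" "at_x0 f \<noteq> 0" "at_x0 q \<noteq> 0" "yord q < yord f"
  shows "intersection_number f q \<le> enat (apery f (yord q))"
proof -
  interpret semival_branch "intersection_number f" "yord f" f
    using assms(1,2) by (rule semival_branch_intersection)
  show ?thesis unfolding apery_def using ap_ge assms yord_g by simp
qed

text \<open>Transversality enters through v_0 = \<open>yord f\<close>; the remaining properties come
  from the value sequence of the branch.\<close>

lemma apery_sequence_branch:
  fixes f :: "'a::alg_closed_field fps2"
  assumes f: "transversal f" and gens: "minimal_generators (branch_semigroup f) g v"
  shows "apery_sequence (yord f) (apery f) (branch_semigroup f) g v"
proof -
  have f': "irreducible f" "at_x0 f \<noteq> 0" "yord f = fps2_order f" using f by (simp_all add: transversal_def)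
  interpret semival_branch "intersection_number f" "yord f" f
    using f'(1,2) by (rule semival_branch_intersection)
  have ord: "vanish (yord f) f" using f' fps2_order_vanish by (metis at_x0_0)
  have top: "f $ yord f $ 0 \<noteq> 0" using nth_subdegree_nonzero[OF f'(2)] by simp
  have v0: "v 0 \<in> branch_semigroup f - {0}" "\<And>s. s \<in> branch_semigroup f - {0} \<Longrightarrow> v 0 \<le> s"
    using gens unfolding minimal_generators_def by (metis nat_span_0 zero_le)+
  have "v 0 = yord f"
  proof (rule antisym)
    show "v 0 \<le> yord f"
      using v0(2)[of "yord f"] S_N N_pos unfolding branch_semigroup_eq_S[OF f'(1,2)] by simp
    from v0(1) obtain h where h: "intersection_number f h = enat (v 0)" "v 0 \<noteq> 0"
      unfolding branch_semigroup_eq_S[OF f'(1,2)] S_def by auto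
    then have "\<not> h dvd 1" using v_unit[of h] by (auto simp: zero_enat_def)
    then have "h $ 0 $ 0 = 0" by (simp add: fps2_unit_iff)
    from v_nonunit_ge[OF ord top this] h show "yord f \<le> v 0" by simp
  qed
  moreover have "apery f 0 = 0" using ap_0[OF rho_pos] by (simp add: apery_def)
  moreover have "apery f i < apery f j" if "i < j" "j < yord f" for i j
    using ap_strict_mono[of i j] that by (simp add: apery_def yord_g)
  moreover have "apery f i + apery f j \<le> apery f (i + j)" if "i + j < yord f" for i j
    using ap_superadd[of i j] that by (simp add: apery_def yord_g)
  moreover have "i = j"
    if "i < yord f" "j < yord f" "apery f i mod yord f = apery f j mod yord f" for i j
  proof -
    have "i < rho" "j < rho" using that by (simp_all add: yord_g)
    from ap_mod_inj[OF this] that(3) show ?thesis unfolding apery_def by blast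
  qed
  ultimately show ?thesis
    using N_pos gens branch_semigroup_apery[OF f'(1,2)] unfolding apery_sequence_def by blast
qed

section \<open>Proportionality of intersection numbers\<close>

lemma intersection_number_mult:
  fixes f :: "'a::alg_closed_field fps2"
  assumes "irreducible f" "at_x0 f \<noteq> 0"
  shows "intersection_number f (p * q) = intersection_number f p + intersection_number f q"
    and "p dvd 1 \<Longrightarrow> intersection_number f p = 0"
    and "intersection_number f f = \<infinity>"
proof -
  interpret semival_branch "intersection_number f" "yord f" f
    using assms by (rule semival_branch_intersection)
  show "intersection_number f (p * q) = intersection_number f p + intersection_number f q"
    by (rule v_mult)
  show "p dvd 1 \<Longrightarrow> intersection_number f p = 0" by (rule v_unit)
  show "intersection_number f f = \<infinity>" by (rule v_g)
qed

text \<open>The isosceles case: a branch q with less contact with f than w has is in equal contact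
  with f and with w, contact being normalized by y-orders.\<close>

lemma ultrametric_eq:
  fixes f w q :: "'a::alg_closed_field fps2"
  assumes f: "irreducible f" "at_x0 f \<noteq> 0" and w: "irreducible w" "at_x0 w \<noteq> 0"
    and q: "irreducible q" "at_x0 q \<noteq> 0"
    and lt: "enat (yord w) * intersection_number f q < enat (yord q) * intersection_number f w"
  shows "enat (yord f) * intersection_number w q = enat (yord w) * intersection_number f q"
proof (rule antisym)
  from intersection_number_ultrametric[OF w f q] lt
  show "enat (yord w) * intersection_number f q \<le> enat (yord f) * intersection_number w q"
    by (simp add: intersection_number_commute[of w f] min_def split: if_splits)
  from intersection_number_ultrametric[OF f w q] lt
  show "enat (yord f) * intersection_number w q \<le> enat (yord w) * intersection_number f q"
    by (simp add: min_def split: if_splits)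
qed

text \<open>Intersection numbers are additive in q, and the factors in a proper factorization have
  smaller y-order, so induction reduces the claim to irreducible series.\<close>

lemma proportional_extends:
  fixes f w :: "'a::alg_closed_field fps2"
  assumes f: "irreducible f" "at_x0 f \<noteq> 0" and w: "irreducible w" "at_x0 w \<noteq> 0"
    and irr: "\<And>q. irreducible q \<Longrightarrow> at_x0 q \<noteq> 0 \<Longrightarrow> yord q \<le> b \<Longrightarrow>
      enat n * intersection_number w q = enat m * intersection_number f q"
  shows "at_x0 q \<noteq> 0 \<Longrightarrow> yord q \<le> b \<Longrightarrow>
    enat n * intersection_number w q = enat m * intersection_number f q"
proof (induction "yord q" arbitrary: q rule: less_induct)
  case less
  consider "q dvd 1" | "irreducible q" | "\<not> q dvd 1" "\<not> irreducible q" by blast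
  then show ?case
  proof cases
    case 1
    then show ?thesis using intersection_number_mult(2)[OF f] intersection_number_mult(2)[OF w] by simp
  next
    case 2
    then show ?thesis using irr less.prems by blast
  next
    case 3
    moreover have "q \<noteq> 0" using less.prems by auto
    ultimately obtain p r where pr: "q = p * r" "\<not> p dvd 1" "\<not> r dvd 1"
      unfolding irreducible_def by blast
    then have nz: "at_x0 p \<noteq> 0" "at_x0 r \<noteq> 0" using less.prems by auto
    then have "yord q = yord p + yord r" "0 < yord p" "0 < yord r"
      using pr(2,3) unit_iff_yord[of p] unit_iff_yord[of r] by (simp_all add: pr(1))
    with less.hyps[of p] less.hyps[of r] less.prems nz
    have "enat n * intersection_number w p = enat m * intersection_number f p"
      "enat n * intersection_number w r = enat m * intersection_number f r" by auto
    then show ?thesis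
      unfolding pr(1) intersection_number_mult(1)[OF f] intersection_number_mult(1)[OF w]
      by (simp only: distrib_left)
  qed
qed

section \<open>The upper bound for branches with few Zariski pairs\<close>

lemma upper_bound_transversal:
  fixes f w :: "'a::alg_closed_field fps2"
  assumes f: "transversal f" and w: "transversal w"
    and gf: "minimal_generators (branch_semigroup f) g v"
    and gw: "minimal_generators (branch_semigroup w) h u"
    and k: "Suc k \<le> g" "h \<le> k"
  shows "enat (yord f div gens_gcd v k) * intersection_number f w \<le> enat (yord w * v (Suc k))"
proof (rule ccontr)
  interpret F: apery_sequence "yord f" "apery f" "branch_semigroup f" g v
    using f gf by (rule apery_sequence_branch)
  interpret W: apery_sequence "yord w" "apery w" "branch_semigroup w" h u
    using w gw by (rule apery_sequence_branch)
  have f': "irreducible f" "at_x0 f \<noteq> 0" and w': "irreducible w" "at_x0 w \<noteq> 0"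
    using f w by (simp_all add: transversal_def)
  define b where "b = F.block k"
  have b: "v (Suc k) = apery f b" "b < yord f" "0 < b"
    using F.v_Suc[OF k(1)] F.block_pos by (simp_all add: b_def)
  assume "\<not> enat (yord f div gens_gcd v k) * intersection_number f w \<le> enat (yord w * v (Suc k))"
  then have big: "enat (yord w * v (Suc k)) < enat b * intersection_number f w"
    by (simp add: b_def F.block_def)
  have slope: "b * apery f j \<le> j * v (Suc k)" if "j \<le> b" for j
  proof (cases "j = 0 \<or> j = b")
    case True
    then show ?thesis using F.a_0 b by auto
  next
    case False
    then show ?thesis using F.slope[OF k(1), of j] that by (simp add: b_def)
  qed
  have fin: "\<exists>s. intersection_number f q = enat s \<and> b * s \<le> yord q * v (Suc k)"
    if "at_x0 q \<noteq> 0" "yord q \<le> b" for q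
  proof -
    have "yord q < yord f" using that b by simp
    from apery_ge[OF f' that(1) this] obtain s where "intersection_number f q = enat s"
      "s \<le> apery f (yord q)" by (cases "intersection_number f q") auto
    moreover from this(2) slope[OF that(2)] have "b * s \<le> yord q * v (Suc k)"
      by (meson le_trans mult_le_mono2)
    ultimately show ?thesis by blast
  qed
  \<comment> \<open>By the slope bound the normalized contact of q with f is at most v_(k+1) / (b
    v_0), and \<open>big\<close> says that the contact of w with f exceeds this number.\<close>
  have irr: "enat (yord f) * intersection_number w q = enat (yord w) * intersection_number f q"
    if q: "irreducible q" "at_x0 q \<noteq> 0" "yord q \<le> b" for q
  proof (rule ultrametric_eq[OF f' w' q(1,2)])
    obtain s where s: "intersection_number f q = enat s" "b * s \<le> yord q * v (Suc k)"
      using fin q by blast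
    have jpos: "0 < yord q" using yord_pos q by blast
    show "enat (yord w) * intersection_number f q < enat (yord q) * intersection_number f w"
    proof (cases "intersection_number f w")
      case (enat i)
      have "b * (yord w * s) \<le> yord w * (yord q * v (Suc k))"
        using mult_le_mono2[OF s(2), of "yord w"] by (simp only: ac_simps)
      also have "\<dots> < yord q * (b * i)"
        using big enat jpos by (simp add: mult.left_commute)
      finally have "b * (yord w * s) < b * (yord q * i)" by (simp only: ac_simps)
      then show ?thesis using s enat by simp
    next
      case infinity
      then show ?thesis using s jpos by (simp add: zero_enat_def)
    qed
  qed
  have pex: "enat (yord f) * intersection_number w q = enat (yord w) * intersection_number f q"
    if "at_x0 q \<noteq> 0" "yord q \<le> b" for q
    by (rule proportional_extends[OF f' w' _ that]) (rule irr)
  \<comment> \<open>Otherwise w itself is an admissible q, but it meets w infinitely and f only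
    finitely.\<close>
  have bN: "b < yord w"
  proof (rule ccontr)
    assume "\<not> b < yord w"
    then have le: "yord w \<le> b" by simp
    obtain s where "intersection_number f w = enat s" using fin[OF w'(2) le] by blast
    with pex[OF w'(2) le] intersection_number_mult(3)[OF w'] F.n_pos
    show False by (simp add: zero_enat_def)
  qed
  \<comment> \<open>A series optimal for one branch is a candidate for the other. Index b is
    included, since the next generator of f sits there.\<close>
  have ap: "yord f * apery w j = yord w * apery f j" if j: "j \<le> b" for j
  proof (rule antisym)
    obtain q where q: "at_x0 q \<noteq> 0" "yord q = j" "intersection_number w q = enat (apery w j)"
      using apery_attained[OF w', of j] j bN by auto
    have "intersection_number f q \<le> enat (apery f j)" using apery_ge[OF f' q(1)] q j b by simp
    then have le: "enat (yord w) * intersection_number f q \<le> enat (yord w * apery f j)"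
      by (cases "intersection_number f q") auto
    have "enat (yord f * apery w j) = enat (yord w) * intersection_number f q"
      using pex[of q] q j by simp
    also note le
    finally show "yord f * apery w j \<le> yord w * apery f j" by simp
  next
    obtain q where q: "at_x0 q \<noteq> 0" "yord q = j" "intersection_number f q = enat (apery f j)"
      using apery_attained[OF f', of j] j b by auto
    have "intersection_number w q \<le> enat (apery w j)" using apery_ge[OF w' q(1)] q j bN by simp
    then have "enat (yord f) * intersection_number w q \<le> enat (yord f) * enat (apery w j)"
      by (intro mult_left_mono) auto
    then show "yord w * apery f j \<le> yord f * apery w j" using pex[of q] q j by simp
  qed
  \<comment> \<open>The generators numbered i + 1 are the Apery values at the end of block i, which
    is at most b, so gcds and blocks of both branches are matched one by one.\<close>
  have main: "i \<le> h \<Longrightarrow> yord f * gens_gcd u i = yord w * gens_gcd v i \<and> W.block i = F.block i" for i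
  proof (induction i)
    case 0
    then show ?case using F.n_pos W.n_pos by (simp add: gens_gcd_0 F.v_0 W.v_0 W.block_def F.block_def)
  next
    case (Suc i)
    then have IH: "yord f * gens_gcd u i = yord w * gens_gcd v i" "W.block i = F.block i" by auto
    have "F.block i \<le> b" unfolding b_def using Suc.prems k by (intro F.block_mono) simp
    then have "yord f * u (Suc i) = yord w * v (Suc i)"
      using ap[of "F.block i"] F.v_Suc[of i] W.v_Suc[of i] IH(2) Suc.prems k by simp
    then have gcd: "yord f * gens_gcd u (Suc i) = yord w * gens_gcd v (Suc i)"
      unfolding gens_gcd_Suc using IH(1) by (simp add: gcd_mult_distrib_nat)
    have "yord f * (W.block (Suc i) * gens_gcd u (Suc i)) = yord f * (F.block (Suc i) * gens_gcd u (Suc i))"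
    proof -
      have "yord f * (W.block (Suc i) * gens_gcd u (Suc i)) = F.block (Suc i) * gens_gcd v (Suc i) * yord w"
        by (simp only: W.block_mult F.block_mult)
      also have "\<dots> = F.block (Suc i) * (yord f * gens_gcd u (Suc i))" by (simp only: gcd ac_simps)
      finally show ?thesis by (simp only: ac_simps)
    qed
    then have "W.block (Suc i) = F.block (Suc i)" using F.n_pos W.gens_gcd_pos[of "Suc i"] by simp
    with gcd show ?case by simp
  qed
  \<comment> \<open>The last block of w has length \<open>yord w\<close>, yet it equals a block of f
    of length at most b < \<open>yord w\<close>.\<close>
  have "W.block h = yord w" by (rule W.block_last)
  moreover have "F.block h \<le> b" unfolding b_def using k(2) by (rule F.block_mono)
  ultimately show False using main[of h] bN by simp
qed

section \<open>Semiroots\<close>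

lemma nat_span_scale:
  assumes "\<And>i. i < m \<Longrightarrow> v i = e * v' i" "0 < e"
  shows "e * x \<in> nat_span v m \<longleftrightarrow> x \<in> nat_span v' m"
proof -
  have "(\<Sum>i<m. c i * v i) = e * (\<Sum>i<m. c i * v' i)" for c
    unfolding sum_distrib_left by (intro sum.cong) (simp_all add: assms(1))
  then show ?thesis using assms(2) by (auto simp: nat_span_def)
qed

text \<open>The classical semiroot of f: a series of y-order b = v_0 / e_k with the largest possible
  value, which is the generator v_(k+1). Its semigroup is the span of v_0, ..., v_k divided by
  e_k.\<close>

lemma semiroot_exists:
  fixes f :: "'a::alg_closed_field fps2"
  assumes f: "transversal f"
    and gf: "minimal_generators (branch_semigroup f) g v"
    and k: "Suc k \<le> g"
  shows "\<exists>w. irreducible w \<and> at_x0 w \<noteq> 0 \<and> yord w = yord f div gens_gcd v k \<and>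
    intersection_number f w = enat (v (Suc k)) \<and>
    minimal_generators (branch_semigroup w) k (\<lambda>i. v i div gens_gcd v k)"
proof -
  interpret F: apery_sequence "yord f" "apery f" "branch_semigroup f" g v
    using f gf by (rule apery_sequence_branch)
  have f': "irreducible f" "at_x0 f \<noteq> 0" using f by (simp_all add: transversal_def)
  define b where "b = F.block k"
  define e where "e = gens_gcd v k"
  have be: "b * e = yord f" unfolding b_def e_def by (rule F.block_mult)
  have epos: "0 < e" unfolding e_def by (rule F.gens_gcd_pos)
  have b: "v (Suc k) = apery f b" "b < yord f" "0 < b"
    using F.v_Suc[OF k(1)] F.block_pos by (simp_all add: b_def)
  obtain w where w: "at_x0 w \<noteq> 0" "yord w = b" "intersection_number f w = enat (v (Suc k))"
    using apery_attained[OF f' b(2)] b(1) by auto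
  \<comment> \<open>Values at y-orders below b are less than v_(k+1), and by its minimality they lie
    in the span of the earlier generators.\<close>
  have small: "\<exists>s. intersection_number f q = enat s \<and> s \<le> apery f (yord q) \<and> s \<in> nat_span v (Suc k)"
    if q: "at_x0 q \<noteq> 0" "yord q < b" for q
  proof -
    have "yord q < yord f" using q b by simp
    from apery_ge[OF f' q(1) this] obtain s where s: "intersection_number f q = enat s"
      "s \<le> apery f (yord q)" by (cases "intersection_number f q") auto
    have "apery f (yord q) < v (Suc k)" using F.a_mono[OF q(2) b(2)] b(1) by simp
    then have "s < v (Suc k)" using s by simp
    moreover have "s \<in> branch_semigroup f"
      unfolding branch_semigroup_eq_S[OF f'] 
      using s(1) semival.S_I semival_branch_intersection[OF f'] semival_branch_def by blast
    ultimately have "s \<in> nat_span v (Suc k)" using F.span_le_v[OF k] by (metis not_le)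
    with s show ?thesis by blast
  qed
  have irr_w: "irreducible w"
  proof (rule irreducibleI)
    show "w \<noteq> 0" using w by auto
    show "\<not> w dvd 1" using unit_iff_yord[of w] w b by simp
    fix p q assume pq: "w = p * q"
    show "p dvd 1 \<or> q dvd 1"
    proof (rule ccontr)
      assume nu: "\<not> (p dvd 1 \<or> q dvd 1)"
      have nz: "at_x0 p \<noteq> 0" "at_x0 q \<noteq> 0" using w pq by auto
      then have "yord p + yord q = b" using w pq by simp
      moreover have "0 < yord p" "0 < yord q"
        using nu nz unit_iff_yord[of p] unit_iff_yord[of q] by auto
      ultimately have "yord p < b" "yord q < b" by auto
      \<comment> \<open>Both factors of w have y-order below b, so their values lie in the span, and
        so would the sum v_(k+1).\<close>
      from small[OF nz(1) this(1)] small[OF nz(2) this(2)] obtain s t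
        where "intersection_number f p = enat s" "s \<in> nat_span v (Suc k)"
          "intersection_number f q = enat t" "t \<in> nat_span v (Suc k)" by blast
      then have "v (Suc k) \<in> nat_span v (Suc k)"
        using w(3) intersection_number_mult(1)[OF f', of p q] nat_span_add[of s v "Suc k" t] pq by simp
      then show False using F.v_notin_span[OF k] by simp
    qed
  qed
  note w' = irr_w w(1)
  \<comment> \<open>The bound b - 1 keeps y-orders in the range where \<open>slope\<close> is
    strict, so that q has less contact with f than w has.\<close>
  have irr: "enat (yord f) * intersection_number w q = enat b * intersection_number f q"
    if q: "irreducible q" "at_x0 q \<noteq> 0" "yord q \<le> b - 1" for q
  proof -
    have j: "0 < yord q" "yord q < b" using yord_pos q b by auto
    obtain s where s: "intersection_number f q = enat s" "s \<le> apery f (yord q)"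
      using small[OF q(2) j(2)] by blast
    have "b * s \<le> b * apery f (yord q)" using s by simp
    also have "\<dots> < yord q * v (Suc k)" using F.slope[OF k j(1)] j by (simp add: b_def)
    finally have "enat (yord w) * intersection_number f q < enat (yord q) * intersection_number f w"
      using s w by simp
    from ultrametric_eq[OF f' w' q(1,2) this] show ?thesis using w by simp
  qed
  have pex: "enat (yord f) * intersection_number w q = enat b * intersection_number f q"
    if q: "at_x0 q \<noteq> 0" "yord q < b" for q
  proof -
    have "yord q \<le> b - 1" using q b by simp
    show ?thesis by (rule proportional_extends[OF f' w' _ q(1) \<open>yord q \<le> b - 1\<close>]) (rule irr)
  qed
  \<comment> \<open>The proportionality factor b / v_0 is 1 / e, as b e = v_0.\<close>
  have eA: "e * apery w j = apery f j" if j: "j < b" for j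
  proof -
    have "yord f * apery w j = b * apery f j"
    proof (rule antisym)
      obtain q where q: "at_x0 q \<noteq> 0" "yord q = j" "intersection_number w q = enat (apery w j)"
        using apery_attained[OF w', of j] j w by auto
      have "intersection_number f q \<le> enat (apery f j)" using apery_ge[OF f' q(1)] q j b by simp
      then have le: "enat b * intersection_number f q \<le> enat (b * apery f j)"
        by (cases "intersection_number f q") auto
      have "enat (yord f * apery w j) = enat b * intersection_number f q"
        using pex[of q] q j by simp
      also note le
      finally show "yord f * apery w j \<le> b * apery f j" by simp
    next
      obtain q where q: "at_x0 q \<noteq> 0" "yord q = j" "intersection_number f q = enat (apery f j)"
        using apery_attained[OF f', of j] j b by auto
      have "intersection_number w q \<le> enat (apery w j)" using apery_ge[OF w' q(1)] q j w by simp
      then have "enat (yord f) * intersection_number w q \<le> enat (yord f) * enat (apery w j)"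
        by (intro mult_left_mono) auto
      then show "b * apery f j \<le> yord f * apery w j" using pex[of q] q j by simp
    qed
    then have "b * (e * apery w j) = b * apery f j" using be by (metis mult.assoc)
    then show ?thesis using b by simp
  qed
  have span: "nat_span v (Suc k) = (\<Union>j<b. range (\<lambda>t. apery f j + t * yord f))"
    using F.span_Suc[of k] k by (simp add: b_def F.U_def)
  \<comment> \<open>Multiplication by e identifies the semigroup of w with a span of generators of
    f, so membership and minimality can be read off there.\<close>
  have S_w: "s \<in> branch_semigroup w \<longleftrightarrow> e * s \<in> nat_span v (Suc k)" for s
  proof -
    have scale: "e * (apery w j + t * b) = apery f j + t * yord f" if "j < b" for j t
      using eA[OF that] be by (simp add: algebra_simps)
    have "s \<in> branch_semigroup w \<longleftrightarrow> (\<exists>j<b. \<exists>t. s = apery w j + t * b)"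
      unfolding branch_semigroup_apery[OF w'] w(2) by auto
    also have "\<dots> \<longleftrightarrow> (\<exists>j<b. \<exists>t. e * s = e * (apery w j + t * b))" using epos by simp
    also have "\<dots> \<longleftrightarrow> (\<exists>j<b. \<exists>t. e * s = apery f j + t * yord f)" using scale by metis
    also have "\<dots> \<longleftrightarrow> e * s \<in> nat_span v (Suc k)" unfolding span by auto
    finally show ?thesis .
  qed
  define v' where "v' = (\<lambda>i. v i div e)"
  have v': "v i = e * v' i" if "i < Suc k" for i
  proof -
    have "e dvd v i" using that unfolding e_def gens_gcd_def by (intro Gcd_dvd) auto
    then show ?thesis by (simp add: v'_def)
  qed
  have scale: "e * x \<in> nat_span v m \<longleftrightarrow> x \<in> nat_span v' m" if "m \<le> Suc k" for x m
    using v' that epos by (intro nat_span_scale) auto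
  have "minimal_generators (branch_semigroup w) k v'"
    unfolding minimal_generators_def
  proof (intro conjI allI impI ballI)
    have "strict_mono_on {0..g} v" using gf by (simp add: minimal_generators_def)
    then have "v i < v j" if "i < j" "j \<le> k" for i j
      using that k by (auto simp: strict_mono_on_def)
    then show "strict_mono_on {0..k} v'"
      using v' epos by (auto simp: strict_mono_on_def)
  next
    fix i assume i: "i \<le> k"
    have "v i \<in> nat_span v (Suc i)" using nat_span_SucI[of 0 v i 1] nat_span_mono[of 0 i v] by (auto simp: nat_span_0)
    then have "v i \<in> nat_span v (Suc k)" using nat_span_mono[of "Suc i" "Suc k" v] i by auto
    then have "v' i \<in> branch_semigroup w" unfolding S_w using v'[of i] i by simp
    moreover have "v' i \<notin> nat_span v' i"
      using scale[of i "v' i"] v'[of i] F.v_notin_span[of i] i k by simp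
    ultimately show "v' i \<in> branch_semigroup w - nat_span v' i" by simp
    fix s assume "s \<in> branch_semigroup w - nat_span v' i"
    then have s: "e * s \<in> nat_span v (Suc k)" "e * s \<notin> nat_span v i"
      using S_w scale[of i s] i by auto
    then have "e * s \<in> branch_semigroup f"
      using nat_span_mono[of "Suc k" "Suc g" v] k unfolding F.S_span by auto
    with s F.span_le_v[of i "e * s"] i k have "v i \<le> e * s" by simp
    then show "v' i \<le> s" using v'[of i] i epos by simp
  next
    show "branch_semigroup w = nat_span v' (Suc k)"
      using S_w scale[of "Suc k"] by auto
  qed
  with irr_w w show ?thesis
    unfolding v'_def e_def b_def F.block_def by blast
qed

lemma transversal_shear:
  assumes "irreducible f" "at_x0 (shear c f) $ fps2_order f \<noteq> 0"
  shows "transversal (shear c f)" "yord (shear c f) = fps2_order f"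
proof -
  have "f \<noteq> 0" using assms(1) by auto
  from shear_transversal[OF this assms(2)] irreducible_shear[OF assms(1)]
  show "transversal (shear c f)" "yord (shear c f) = fps2_order f"
    by (simp_all add: transversal_def)
qed

lemma length_zariski_pairs: "length (zariski_pairs g v) = g"
  by (simp add: zariski_pairs_def del: upt_Suc)

section \<open>The supremum of contacts\<close>

theorem proposition5p3:
  fixes f :: "'a::alg_closed_field fps fps" and v :: "nat \<Rightarrow> nat" and g k :: nat
  assumes "branch f"
    and "minimal_generators (branch_semigroup f) g v"
    and "1 \<le> k" and "k \<le> g"
  shows "contact_sup k f = ereal (real (gens_gcd v (k - 1)) * real (v k) / (real (v 0))\<^sup>2)"
proof -
  \<comment> \<open>The preceding lemmas index from the predecessor: v_k becomes v_(l+1) and e_(k-1)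
    becomes e_l.\<close>
  obtain l where l: "k = Suc l" using assms(3) by (cases k) auto
  have irr: "irreducible f" and f0: "f \<noteq> 0" using assms(1) by (auto simp: branch_def)
  define n where "n = fps2_order f"
  define e where "e = gens_gcd v l"
  define b where "b = n div e"
  have data: "v 0 = n \<and> b * e = n \<and> 0 < n \<and> 0 < b \<and> 0 < e"
    if "transversal (shear c f)" "yord (shear c f) = n" for c
  proof -
    interpret F: apery_sequence "yord (shear c f)" "apery (shear c f)" "branch_semigroup (shear c f)" g v
      using that(1) assms(2) by (intro apery_sequence_branch) (simp_all add: branch_semigroup_shear)
    show ?thesis
      using F.v_0 F.block_mult[of l, unfolded F.block_def] F.block_pos[of l, unfolded F.block_def]
        F.n_pos F.gens_gcd_pos[of l]
      unfolding that(2) b_def e_def by blast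
  qed
  have upper: "contact f w \<le> ereal (real e * real (v k) / (real (v 0))\<^sup>2)" if "w \<in> branch_family k" for w
  proof -
    from that obtain h u where w: "irreducible w" "minimal_generators (branch_semigroup w) h u" "h \<le> l"
      by (auto simp: branch_family_def branch_def length_zariski_pairs l)
    then have w0: "w \<noteq> 0" by auto
    define m where "m = fps2_order w"
    \<comment> \<open>The shear depends on w. The bound is expressed by quantities that no shear
      changes, so different competitors may use different coordinates.\<close>
    from shear_transversal2[OF f0 w0] obtain c
      where c: "at_x0 (shear c f) $ fps2_order f \<noteq> 0" "at_x0 (shear c w) $ fps2_order w \<noteq> 0" by blast
    have F: "transversal (shear c f)" "yord (shear c f) = n"
      using transversal_shear[OF irr c(1)] by (simp_all add: n_def)
    have W: "transversal (shear c w)" "yord (shear c w) = m"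
      using transversal_shear[OF w(1) c(2)] by (simp_all add: m_def)
    have m: "0 < m" using W yord_pos unfolding transversal_def by metis
    have "enat b * intersection_number f w \<le> enat (m * v k)"
      using upper_bound_transversal[OF F(1) W(1), of g v h u l] assms(2,4) w F(2) W(2)
      by (simp add: branch_semigroup_shear intersection_number_shear l b_def e_def)
    moreover note d = data[OF F]
    ultimately obtain i where i: "intersection_number f w = enat i" "b * i \<le> m * v k"
      by (cases "intersection_number f w") (auto simp: zero_enat_def)
    have "b * e * i \<le> e * m * v k" using mult_le_mono2[OF i(2), of e] by (simp only: ac_simps)
    then have "real n * real i \<le> real e * real m * real (v k)"
      using d by (metis of_nat_le_iff of_nat_mult)
    then have "real i / (real n * real m) \<le> real e * real (v k) / (real n)\<^sup>2"
      using d m by (simp add: divide_simps power2_eq_square) (simp add: algebra_simps)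
    then show ?thesis using d i(1) m by (simp add: contact_def n_def m_def)
  qed
  from shear_transversal2[OF f0 f0] obtain c where c: "at_x0 (shear c f) $ fps2_order f \<noteq> 0" by blast
  have F: "transversal (shear c f)" "yord (shear c f) = n"
    using transversal_shear[OF irr c] by (simp_all add: n_def)
  note d = data[OF F]
  obtain w' where w': "irreducible w'" "at_x0 w' \<noteq> 0" "yord w' = b"
    "intersection_number (shear c f) w' = enat (v k)"
    "minimal_generators (branch_semigroup w') l (\<lambda>i. v i div e)"
    using semiroot_exists[OF F(1), of g v l] assms(2,4) F(2)
    by (auto simp: branch_semigroup_shear l b_def e_def)
  \<comment> \<open>The semiroot is found in sheared coordinates and carried back to the original
    ones.\<close>
  define w where "w = shear (- c) w'"
  have sw: "shear c w = w'" by (simp add: w_def shear_inverse')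
  have "branch w" unfolding branch_def w_def using w'(1) by (rule irreducible_shear)
  moreover have "minimal_generators (branch_semigroup w) l (\<lambda>i. v i div e)"
    unfolding w_def branch_semigroup_shear by (rule w'(5))
  ultimately have mem: "w \<in> branch_family k"
    by (auto simp: branch_family_def length_zariski_pairs l)
  have w0: "w \<noteq> 0" using \<open>branch w\<close> by (auto simp: branch_def)
  have "vanish (fps2_order w) w'"
    unfolding sw[symmetric] using w0 by (intro local_hom_vanish[OF local_hom_shear] fps2_order_vanish)
  then have mb: "fps2_order w \<le> b"
    using vanish_imp_at_x0[of "fps2_order w" w'] w'(2,3) subdegree_geI[of "at_x0 w'"] by auto
  have "w $ 0 $ 0 = 0" using \<open>branch w\<close> by (simp add: branch_def irreducible_not_unit2)
  then have mpos: "0 < fps2_order w"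
    using fps2_order_eq_iff[OF w0, of 0] by (auto simp: vanish_1_iff)
  have I: "intersection_number f w = enat (v k)"
    using w'(4) intersection_number_shear[of c f w] by (simp add: sw)
  have "real n = real b * real e" using d by (metis of_nat_mult)
  then have "real e * real (v k) / (real n)\<^sup>2 = real (v k) / (real n * real b)"
    using d by (simp add: power2_eq_square)
  also have "\<dots> \<le> real (v k) / (real n * real (fps2_order w))"
    using d mb mpos by (intro divide_left_mono mult_left_mono mult_pos_pos) auto
  finally have lower: "ereal (real e * real (v k) / (real (v 0))\<^sup>2) \<le> contact f w"
    using d I by (simp add: contact_def n_def)
  have "contact_sup k f = ereal (real e * real (v k) / (real (v 0))\<^sup>2)"
    unfolding contact_sup_def
    by (intro antisym SUP_least upper order.trans[OF lower] SUP_upper mem)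
  then show ?thesis by (simp add: e_def l)
qed

end
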